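(* For every integer $d\ge d_0$ let $$p^*_d=\inf_{y}\ \sum_{j=1}^m L_{y_j}(l_j)$$ where the infimum is over $y=(y_1,\dots,y_m)$, $y_j=(y_{j,\beta})_{\beta\in\mathbb{N}^{n+1}_{2d}}$ real, subject to $$\sum_{j=1}^m L_{y_j}(\mathcal{L}'_jv_\alpha)=v_\alpha(T,x_T)-v_\alpha(0,x_0)\quad\text{for all }\alpha\in\bar{\mathbb{N}}^{n+1}_{2d},$$ $$M_{d-\lceil \deg g_i/2\rceil}(g_i\,y_j)\succeq0,\quad i=0,1,\dots,n_K,\ j=1,\dots,m.$$ Let $p^*_\infty$ be the infimum of $\sum_{j=1}^mL_{y_j}(l_j)$ over $y=(y_1,\dots,y_m)$, $y_j=(y_{j,\beta})_{\beta\in\mathbb{N}^{n+1}}$ real sequences, subject to $\sum_{j=1}^mL_{y_j}(\mathcal{L}'_jv_\alpha)=v_\alpha(T,x_T)-v_\alpha(0,x_0)$ for all $\alpha\in\mathbb{N}^{n+1}$ and $M_d(g_i\,y_j)\succeq0$ for all $i=0,\dots,n_K$, $j=1,\dots,m$, $d\in\mathbb{N}$. Let $p^*$ be the infimum of $\sum_{j=1}^m\int_Kl_j\,\mathrm{d}\mu_j$ over $(\mu_1,\dots,\mu_m)\in\mathcal{M}^+(K)^m$ subject to $\sum_{j=1}^m\int_K\mathcal{L}'_jv\,\mathrm{d}\mu_j=v(T,x_T)-v(0,x_0)$ for all $v\in C^1(K)$. Then, for increasing relaxation orders $d$, the values $p^*_d$ form a monotonically non-decreasing sequence of lower bounds converging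 asymptotically to $p^*_\infty=p^*$: $$p^*_{d_0}\le p^*_{d_0+1}\le\cdots\le p^*_\infty=p^*,\qquad \lim_{d\to\infty}p^*_d=p^*_\infty=p^*.$$
   Context: Standing setting: $T>0$ and $x_0,x_T\in\mathbb{R}^n$ are given; $X\subset\mathbb{R}^n$ is compact; $K=[0,T]\times X$ is basic semi-algebraic, $K=\{(t,x)\in\mathbb{R}\times\mathbb{R}^n:\ g_i(t,x)\ge0,\ i=1,\dots,n_K\}$ with $g_i\in\mathbb{R}[t,x]$, and one of the $g_i$ enforces a ball constraint on all variables (i.e. is of the form $R^2-t^2-\|x\|^2$). $g_0$ is the constant polynomial $1$. For $j=1,\dots,m$, $l_j\in\mathbb{R}[t,x]$ and $f_j\in\mathbb{R}[t,x]^n$. Notation: $\mathcal{M}^+(K)$ is the cone of finite non-negative Borel measures on $K$. $C^1(K)$ denotes the continuously differentiable functions $v(t,x)$, understood as functions in $C^1(\mathbb{R}\times\mathbb{R}^n)$ whose derivatives are evaluated on $K$. $\mathcal{L}'_jv:=\frac{\partial v}{\partial t}+\frac{\partial v}{\partial x}\cdot f_j$. $\mathbb{N}^{n+1}_{k}$ is the set of $\alpha\in\mathbb{N}^{n+1}$ with $\sum_i\alpha_i\le k$. $v_\beta(t,x):=t^{\beta_0}x_1^{\beta_1}\cdots x_n^{\beta_n}$ for $\beta\in\mathbb{N}^{n+1}$. For a (possibly truncated) real sequence $w=(w_\beta)$ and a polynomial $f=\sum_\beta f_\beta v_\beta$, $L_w(f):=\sum_\beta f_\beta w_\beta$. For a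 polynomial $g=\sum_\gamma g_\gamma v_\gamma$, the localizing matrix $M_k(g\,w)$ of order $k$ is the symmetric matrix indexed by $\alpha,\beta\in\mathbb{N}^{n+1}_k$ with entries $L_w(g\,v_{\alpha+\beta})=\sum_\gamma g_\gamma w_{\alpha+\beta+\gamma}$. $A\succeq0$ means $A$ is positive semidefinite. $d_0$ is the smallest integer such that all monomials of the $l_j$, of the components of the $f_j$, and of the $g_i$ have exponents in $\mathbb{N}^{n+1}_{2d_0}$. $\bar{\mathbb{N}}^{n+1}_{2d}:=\{\alpha\in\mathbb{N}^{n+1}:\ \deg\mathcal{L}'_jv_\alpha\le2d,\ j=1,\dots,m\}$, which is taken to be finite (it always contains $0$). The infimum over an empty set is $+\infty$. *)

theory Defs
  imports "HOL-Analysis.Analysis" "HOL-Library.Poly_Mapping"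
begin

section \<open>Real polynomials in the variables t, x\<close>

text \<open>
  The space R x R^n is \<^typ>\<open>real \<times> (real^'n)\<close>. Accordingly, an exponent (b_0, b_1, ..., b_n) is an element
  of \<^typ>\<open>nat \<times> (nat^'n)\<close> (the first component being the exponent of t), and a polynomial is a finitely
  supported map from exponents to coefficients; its ring operations are those of
  \<^type>\<open>poly_mapping\<close>, for which \<open>Poly_Mapping.single b c\<close> is the term c v_b.
\<close>

type_synonym 'n expo = "nat \<times> (nat^'n)"

type_synonym 'n rpoly = "'n expo \<Rightarrow>\<^sub>0 real"

definition expo_deg :: "('n::finite) expo \<Rightarrow> nat" where
  "expo_deg \<beta> = fst \<beta> + (\<Sum>k\<in>UNIV. snd \<beta> $ k)"

definition expos_upto :: "nat \<Rightarrow> ('n::finite) expo set" where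
  "expos_upto k = {\<beta>. expo_deg \<beta> \<le> k}"

definition monom_val :: "('n::finite) expo \<Rightarrow> real \<times> (real^'n) \<Rightarrow> real" where
  "monom_val \<beta> p = fst p ^ fst \<beta> * (\<Prod>k\<in>UNIV. (snd p $ k) ^ (snd \<beta> $ k))"

definition monomial_poly :: "('n::finite) expo \<Rightarrow> 'n rpoly" where
  "monomial_poly \<beta> = Poly_Mapping.single \<beta> 1"

definition peval :: "('n::finite) rpoly \<Rightarrow> real \<times> (real^'n) \<Rightarrow> real" where
  "peval q p = (\<Sum>\<beta>\<in>Poly_Mapping.keys q. Poly_Mapping.lookup q \<beta> * monom_val \<beta> p)"

text \<open>The zero polynomial gets degree 0.\<close>

definition pdeg :: "('n::finite) rpoly \<Rightarrow> nat" where
  "pdeg q = Max (insert 0 (expo_deg ` Poly_Mapping.keys q))"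

text \<open>
  Formal partial derivatives. The subtraction of exponents is truncated only in terms whose
  coefficient is 0.
\<close>

definition pderiv_t :: "('n::finite) rpoly \<Rightarrow> 'n rpoly" where
  "pderiv_t q = (\<Sum>\<beta>\<in>Poly_Mapping.keys q.
     Poly_Mapping.single (\<beta> - (1, 0)) (of_nat (fst \<beta>) * Poly_Mapping.lookup q \<beta>))"

definition pderiv_x :: "'n::finite \<Rightarrow> 'n rpoly \<Rightarrow> 'n rpoly" where
  "pderiv_x k q = (\<Sum>\<beta>\<in>Poly_Mapping.keys q.
     Poly_Mapping.single (\<beta> - (0, axis k 1)) (of_nat (snd \<beta> $ k) * Poly_Mapping.lookup q \<beta>))"

text \<open>The polynomial R^2 - t^2 - |x|^2.\<close>

definition ball_poly :: "real \<Rightarrow> ('n::finite) rpoly" where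
  "ball_poly R = Poly_Mapping.single 0 (R\<^sup>2) - monomial_poly (2, 0)
     - (\<Sum>k\<in>UNIV. monomial_poly (0, axis k 2))"


section \<open>The operator v |-> dv/dt + dv/dx . F\<close>

text \<open>On polynomials, where the outcome is needed through its coefficients:\<close>

definition transport_poly :: "('n::finite) rpoly ^ 'n \<Rightarrow> 'n rpoly \<Rightarrow> 'n rpoly" where
  "transport_poly F q = pderiv_t q + (\<Sum>k\<in>UNIV. pderiv_x k q * F $ k)"

text \<open>On functions of class C^1, with the partial derivatives taken in the coordinate directions:\<close>

definition transport_fun ::
    "('n::finite) rpoly ^ 'n \<Rightarrow> (real \<times> (real^'n) \<Rightarrow> real) \<Rightarrow> real \<times> (real^'n) \<Rightarrow> real" where
  "transport_fun F v p = frechet_derivative v (at p) (1, 0)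
     + (\<Sum>k\<in>UNIV. frechet_derivative v (at p) (0, axis k 1) * peval (F $ k) p)"

text \<open>
  The domain being finite-dimensional, continuity of the derivative as a map into the linear forms
  amounts to continuity of all directional derivatives.
\<close>

definition C1_fun :: "(real \<times> (real^'n::finite) \<Rightarrow> real) \<Rightarrow> bool" where
  "C1_fun v \<longleftrightarrow> v differentiable_on UNIV
     \<and> (\<forall>h. continuous_on UNIV (\<lambda>p. frechet_derivative v (at p) h))"


section \<open>The linear program on measures\<close>

definition finite_borel_measures :: "'a::topological_space set \<Rightarrow> 'a measure set" where
  "finite_borel_measures K = {\<mu>. finite_measure \<mu> \<and> sets \<mu> = sets (restrict_space borel K)}"

definition measure_feasible ::
    "nat \<Rightarrow> (real \<times> (real^'n::finite)) set \<Rightarrow> (nat \<Rightarrow> 'n rpoly ^ 'n)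
     \<Rightarrow> real \<Rightarrow> real^'n \<Rightarrow> real^'n \<Rightarrow> (nat \<Rightarrow> (real \<times> (real^'n)) measure) set" where
  "measure_feasible m K f T x0 xT = {\<mu> \<in> {1..m} \<rightarrow>\<^sub>E finite_borel_measures K.
     \<forall>v. C1_fun v \<longrightarrow> (\<Sum>j=1..m. \<integral>p. transport_fun (f j) v p \<partial>\<mu> j) = v (T, xT) - v (0, x0)}"

definition measure_value ::
    "nat \<Rightarrow> (real \<times> (real^'n::finite)) set \<Rightarrow> (nat \<Rightarrow> 'n rpoly) \<Rightarrow> (nat \<Rightarrow> 'n rpoly ^ 'n)
     \<Rightarrow> real \<Rightarrow> real^'n \<Rightarrow> real^'n \<Rightarrow> ereal" where
  "measure_value m K l f T x0 xT =
     (INF \<mu>\<in>measure_feasible m K f T x0 xT. ereal (\<Sum>j=1..m. \<integral>p. peval (l j) p \<partial>\<mu> j))"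


section \<open>Moment sequences and the relaxations\<close>

definition riesz :: "(('n::finite) expo \<Rightarrow> real) \<Rightarrow> 'n rpoly \<Rightarrow> real" where
  "riesz w q = (\<Sum>\<beta>\<in>Poly_Mapping.keys q. Poly_Mapping.lookup q \<beta> * w \<beta>)"

definition localizing :: "('n::finite) rpoly \<Rightarrow> ('n expo \<Rightarrow> real) \<Rightarrow> 'n expo \<Rightarrow> 'n expo \<Rightarrow> real" where
  "localizing q w \<alpha> \<beta> = riesz w (q * monomial_poly (\<alpha> + \<beta>))"

text \<open>Positive semidefiniteness of a real matrix with rows and columns indexed by the finite set I.\<close>

definition psd_on :: "'a set \<Rightarrow> ('a \<Rightarrow> 'a \<Rightarrow> real) \<Rightarrow> bool" where
  "psd_on I A \<longleftrightarrow> (\<forall>a\<in>I. \<forall>b\<in>I. A a b = A b a)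
     \<and> (\<forall>c. 0 \<le> (\<Sum>a\<in>I. \<Sum>b\<in>I. c a * A a b * c b))"

definition basis_order ::
    "nat \<Rightarrow> nat \<Rightarrow> (nat \<Rightarrow> ('n::finite) rpoly) \<Rightarrow> (nat \<Rightarrow> 'n rpoly) \<Rightarrow> (nat \<Rightarrow> 'n rpoly ^ 'n) \<Rightarrow> nat" where
  "basis_order m nK g l f = (LEAST d.
     (\<forall>j\<in>{1..m}. Poly_Mapping.keys (l j) \<subseteq> expos_upto (2 * d)
        \<and> (\<forall>k. Poly_Mapping.keys (f j $ k) \<subseteq> expos_upto (2 * d)))
     \<and> (\<forall>i\<in>{0..nK}. Poly_Mapping.keys (g i) \<subseteq> expos_upto (2 * d)))"

definition test_expos :: "nat \<Rightarrow> (nat \<Rightarrow> ('n::finite) rpoly ^ 'n) \<Rightarrow> nat \<Rightarrow> 'n expo set" where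
  "test_expos m f d = {\<alpha>. \<forall>j\<in>{1..m}. pdeg (transport_poly (f j) (monomial_poly \<alpha>)) \<le> 2 * d}"

definition liouville_eq ::
    "nat \<Rightarrow> (nat \<Rightarrow> ('n::finite) rpoly ^ 'n) \<Rightarrow> real \<Rightarrow> real^'n \<Rightarrow> real^'n
     \<Rightarrow> (nat \<Rightarrow> 'n expo \<Rightarrow> real) \<Rightarrow> 'n expo \<Rightarrow> bool" where
  "liouville_eq m f T x0 xT y \<alpha> \<longleftrightarrow>
     (\<Sum>j=1..m. riesz (y j) (transport_poly (f j) (monomial_poly \<alpha>)))
       = monom_val \<alpha> (T, xT) - monom_val \<alpha> (0, x0)"

text \<open>
  Truncated sequences are extensional functions on \<^term>\<open>expos_upto (2 * d)\<close>. The truncated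
  subtraction and the functionals below are only meaningful for d at least \<^const>\<open>basis_order\<close>:
  then the subtraction is exact, and only entries of y on \<^term>\<open>expos_upto (2 * d)\<close> occur.
\<close>

definition relax_feasible ::
    "nat \<Rightarrow> nat \<Rightarrow> (nat \<Rightarrow> ('n::finite) rpoly) \<Rightarrow> (nat \<Rightarrow> 'n rpoly ^ 'n)
     \<Rightarrow> real \<Rightarrow> real^'n \<Rightarrow> real^'n \<Rightarrow> nat \<Rightarrow> (nat \<Rightarrow> 'n expo \<Rightarrow> real) set" where
  "relax_feasible m nK g f T x0 xT d = {y \<in> {1..m} \<rightarrow>\<^sub>E (expos_upto (2 * d) \<rightarrow>\<^sub>E UNIV).
     (\<forall>\<alpha>\<in>test_expos m f d. liouville_eq m f T x0 xT y \<alpha>)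
     \<and> (\<forall>i\<in>{0..nK}. \<forall>j\<in>{1..m}.
          psd_on (expos_upto (d - nat \<lceil>real (pdeg (g i)) / 2\<rceil>)) (localizing (g i) (y j)))}"

definition relax_value ::
    "nat \<Rightarrow> nat \<Rightarrow> (nat \<Rightarrow> ('n::finite) rpoly) \<Rightarrow> (nat \<Rightarrow> 'n rpoly) \<Rightarrow> (nat \<Rightarrow> 'n rpoly ^ 'n)
     \<Rightarrow> real \<Rightarrow> real^'n \<Rightarrow> real^'n \<Rightarrow> nat \<Rightarrow> ereal" where
  "relax_value m nK g l f T x0 xT d =
     (INF y\<in>relax_feasible m nK g f T x0 xT d. ereal (\<Sum>j=1..m. riesz (y j) (l j)))"

definition moment_feasible ::
    "nat \<Rightarrow> nat \<Rightarrow> (nat \<Rightarrow> ('n::finite) rpoly) \<Rightarrow> (nat \<Rightarrow> 'n rpoly ^ 'n)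
     \<Rightarrow> real \<Rightarrow> real^'n \<Rightarrow> real^'n \<Rightarrow> (nat \<Rightarrow> 'n expo \<Rightarrow> real) set" where
  "moment_feasible m nK g f T x0 xT = {y \<in> {1..m} \<rightarrow>\<^sub>E UNIV.
     (\<forall>\<alpha>. liouville_eq m f T x0 xT y \<alpha>)
     \<and> (\<forall>i\<in>{0..nK}. \<forall>j\<in>{1..m}. \<forall>d. psd_on (expos_upto d) (localizing (g i) (y j)))}"

definition moment_value ::
    "nat \<Rightarrow> nat \<Rightarrow> (nat \<Rightarrow> ('n::finite) rpoly) \<Rightarrow> (nat \<Rightarrow> 'n rpoly) \<Rightarrow> (nat \<Rightarrow> 'n rpoly ^ 'n)
     \<Rightarrow> real \<Rightarrow> real^'n \<Rightarrow> real^'n \<Rightarrow> ereal" where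
  "moment_value m nK g l f T x0 xT =
     (INF y\<in>moment_feasible m nK g f T x0 xT. ereal (\<Sum>j=1..m. riesz (y j) (l j)))"

end

theory Submission
  imports Defs "HOL-Probability.Helly_Selection" "HOL-Library.Diagonal_Subsequence"
begin

text \<open>
  Write \<open>L\<close> for the linear functional on polynomials belonging to a sequence of moments.

  The values of the relaxations increase with the order and stay below the value of the moment problem
  because every polynomial entering the constraints of order \<open>d\<close> has degree at most \<open>2 d\<close>: cutting off the
  higher entries of a sequence that is feasible at order \<open>d + 1\<close>, or for the full moment problem, leaves a
  sequence that is feasible at order \<open>d\<close> and has the same cost (\<open>truncation_relax_feasible\<close>).

  They converge to the value of the moment problem by compactness. The equation for the test function t
  says that the masses add up to \<open>T\<close>, and the ball constraint bounds every moment by a multiple of the mass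
  which depends on the degree of the moment but not on the order of the relaxation
  (\<open>truncated_moment_bound\<close>). So points of the relaxations with cost below a given number have a limit
  point, and this is feasible for the moment problem (\<open>moment_feasible_limit\<close>).

  The moments of feasible measures are feasible for the moment problem. Conversely, let \<open>L\<close> come from a
  feasible sequence. It is nonnegative on squares, and by the ball constraint its moments grow at most
  exponentially. Iterating the Cauchy-Schwarz inequality gives \<open>\<bar>L(x_i q\<^sup>2)\<bar> \<le> R L(q\<^sup>2)\<close>; hence
  \<open>q \<mapsto> L((R \<plusminus> x_i) q)\<close> has the same two properties, and by induction \<open>L\<close> is nonnegative on all products of
  the factors \<open>R \<plusminus> x_i\<close>. In particular \<open>L\<close> is nonnegative on the Bernstein basis of the box. Its values there
  are the weights of discrete measures whose moments converge to those of \<open>L\<close>. A Peano curve reduces the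
  choice of a weak limit to Helly's selection theorem on the line, and the limit represents \<open>L\<close>
  (\<open>representing_measure_on_box\<close>). The localizing conditions \<open>L(g q\<^sup>2) \<ge> 0\<close> then confine the measure to the
  set where \<open>g \<ge> 0\<close>, because squares of polynomials approximate every nonnegative continuous function
  (\<open>AE_nonneg_of_localizing\<close>).

  The representing measures satisfy the transport equation for polynomial test functions. It extends to
  all C1 test functions since polynomials approximate a C1 function and its partial derivatives uniformly
  on bounded sets (\<open>C1_polynomial_approximation\<close>): a Bernstein operator acting in a single coordinate
  approximates the function together with its derivatives, and it is applied to one coordinate after the
  other.
\<close>

section \<open>Linear functionals on polynomials\<close>

lemma riesz_eq_sum:
  assumes "finite S" "Poly_Mapping.keys q \<subseteq> S"
  shows "riesz w q = (\<Sum>\<beta>\<in>S. Poly_Mapping.lookup q \<beta> * w \<beta>)"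
  unfolding riesz_def
  by (rule sum.mono_neutral_left) (use assms in \<open>auto simp: in_keys_iff\<close>)

lemma riesz_zero [simp]: "riesz w 0 = 0"
  by (simp add: riesz_def)

lemma riesz_single [simp]: "riesz w (Poly_Mapping.single \<beta> c) = c * w \<beta>"
  by (subst riesz_eq_sum[of "{\<beta>}"]) auto

lemma riesz_monomial_poly [simp]: "riesz w (monomial_poly \<beta>) = w \<beta>"
  by (simp add: monomial_poly_def)

lemma riesz_add [simp]: "riesz w (p + q) = riesz w p + riesz w q"
proof -
  let ?S = "Poly_Mapping.keys p \<union> Poly_Mapping.keys q"
  have "riesz w (p + q) = (\<Sum>\<beta>\<in>?S. Poly_Mapping.lookup (p + q) \<beta> * w \<beta>)"
    using keys_add[of p q] by (intro riesz_eq_sum) auto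
  also have "\<dots> = riesz w p + riesz w q"
    by (simp add: riesz_eq_sum[of ?S p] riesz_eq_sum[of ?S q] lookup_add distrib_right sum.distrib)
  finally show ?thesis .
qed

lemma riesz_uminus [simp]: "riesz w (- p) = - riesz w p"
  by (simp add: riesz_def sum_negf)

lemma riesz_diff [simp]: "riesz w (p - q) = riesz w p - riesz w q"
  using riesz_add[of w p "- q"] by simp

lemma riesz_sum: "riesz w (sum h S) = (\<Sum>s\<in>S. riesz w (h s))"
  by (induction S rule: infinite_finite_induct) auto

lemma rpoly_eq_sum_singles:
  "(q :: 'n::finite rpoly) = (\<Sum>\<beta>\<in>Poly_Mapping.keys q. Poly_Mapping.single \<beta> (Poly_Mapping.lookup q \<beta>))"
  by (rule poly_mapping_eqI)
     (simp add: lookup_sum lookup_single when_def in_keys_iff[symmetric] not_in_keys_iff_lookup_eq_zero)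

lemma rpoly_induct [case_names single add]:
  fixes q :: "'n::finite rpoly"
  assumes "\<And>\<beta> c. P (Poly_Mapping.single \<beta> c)"
    and "\<And>p q. P p \<Longrightarrow> P q \<Longrightarrow> P (p + q)"
  shows "P q"
proof -
  have "P (\<Sum>\<beta>\<in>S. Poly_Mapping.single \<beta> (Poly_Mapping.lookup q \<beta>))" if "finite S" for S
    using that by (induction S) (use assms(1)[of 0 0] in \<open>auto intro: assms\<close>)
  from this[of "Poly_Mapping.keys q"] show ?thesis
    by (simp add: rpoly_eq_sum_singles[symmetric])
qed

lemma riesz_scale [simp]: "riesz w (Poly_Mapping.single 0 c * q) = c * riesz w q"
  by (induction q rule: rpoly_induct) (simp_all add: mult_single algebra_simps)

text \<open>
  The sequence of the functional \<open>q \<mapsto> L(s q)\<close>, where \<open>L\<close> is the functional of \<open>w\<close>.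
\<close>

definition shift_seq :: "('n::finite expo \<Rightarrow> real) \<Rightarrow> 'n rpoly \<Rightarrow> 'n expo \<Rightarrow> real" where
  "shift_seq w s \<beta> = riesz w (s * monomial_poly \<beta>)"

lemma single_conv_monomial_poly: "Poly_Mapping.single \<beta> c = Poly_Mapping.single 0 c * monomial_poly \<beta>"
  by (simp add: monomial_poly_def mult_single)

lemma riesz_shift_seq: "riesz (shift_seq w s) q = riesz w (s * q)"
proof (induction q rule: rpoly_induct)
  case (single \<beta> c)
  have "s * Poly_Mapping.single \<beta> c = Poly_Mapping.single 0 c * (s * monomial_poly \<beta>)"
    by (subst single_conv_monomial_poly) (simp add: mult_ac)
  then show ?case
    by (simp add: shift_seq_def)
qed (simp add: algebra_simps)

lemma shift_seq_shift_seq: "shift_seq (shift_seq w s) s' = shift_seq w (s * s')"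
  by (rule ext) (simp add: shift_seq_def[of "shift_seq w s"] riesz_shift_seq shift_seq_def mult.assoc)

section \<open>Evaluation of polynomials\<close>

lemma peval_eq_riesz: "peval q p = riesz (\<lambda>\<beta>. monom_val \<beta> p) q"
  by (simp add: peval_def riesz_def)

lemma monom_val_0 [simp]: "monom_val 0 p = 1"
  by (simp add: monom_val_def)

lemma monom_val_add: "monom_val (\<alpha> + \<beta>) p = monom_val \<alpha> p * monom_val \<beta> p"
  by (simp add: monom_val_def power_add prod.distrib)

lemma peval_single [simp]: "peval (Poly_Mapping.single \<beta> c) p = c * monom_val \<beta> p"
  by (simp add: peval_eq_riesz)

lemma peval_monomial_poly [simp]: "peval (monomial_poly \<beta>) p = monom_val \<beta> p"
  by (simp add: peval_eq_riesz)

lemma peval_add [simp]: "peval (q + q') p = peval q p + peval q' p"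
  and peval_diff [simp]: "peval (q - q') p = peval q p - peval q' p"
  and peval_uminus [simp]: "peval (- q) p = - peval q p"
  and peval_zero [simp]: "peval 0 p = 0"
  by (simp_all add: peval_eq_riesz)

lemma peval_sum: "peval (sum h S) p = (\<Sum>s\<in>S. peval (h s) p)"
  by (simp add: peval_eq_riesz riesz_sum)

lemma peval_mult [simp]: "peval (q * q') p = peval q p * peval q' p"
proof (induction q rule: rpoly_induct)
  case (single \<beta> c)
  show ?case
    by (induction q' rule: rpoly_induct) (simp_all add: mult_single monom_val_add algebra_simps)
qed (simp add: algebra_simps)

lemma peval_one [simp]: "peval 1 p = 1"
  by (metis mult_1 peval_single monom_val_0 single_one)

lemma peval_power [simp]: "peval (q ^ k) p = peval q p ^ k"
  by (induction k) auto

lemma peval_prod: "peval (prod h S) p = (\<Prod>s\<in>S. peval (h s) p)"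
  by (induction S rule: infinite_finite_induct) auto

lemma continuous_on_monom_val [continuous_intros]: "continuous_on S (monom_val \<beta>)"
  unfolding monom_val_def by (intro continuous_intros)

lemma continuous_on_peval [continuous_intros]: "continuous_on S (peval q)"
  unfolding peval_def by (intro continuous_intros)

section \<open>Exponents and variables\<close>

text \<open>
  The variables are indexed by an option type: \<open>None\<close> stands for t and \<open>Some k\<close> for x_k.
\<close>

definition unit_expo :: "'n::finite option \<Rightarrow> 'n expo" where
  "unit_expo i = (case i of None \<Rightarrow> (1, 0) | Some k \<Rightarrow> (0, axis k 1))"

definition coord :: "'n::finite option \<Rightarrow> real \<times> (real^'n) \<Rightarrow> real" where
  "coord i p = (case i of None \<Rightarrow> fst p | Some k \<Rightarrow> snd p $ k)"

lemma prod_power_axis: "(\<Prod>l\<in>UNIV. (x $ l :: real) ^ (axis k a $ l)) = x $ (k :: 'n::finite) ^ a"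
proof -
  have "(\<Prod>l\<in>UNIV. (x $ l) ^ (axis k a $ l)) = (\<Prod>l\<in>UNIV. if l = k then x $ l ^ a else 1)"
    by (intro prod.cong) (auto simp: axis_def)
  then show ?thesis by simp
qed

lemma monom_val_unit_expo [simp]: "monom_val (unit_expo i) p = coord i p"
  by (cases i) (simp_all add: monom_val_def unit_expo_def coord_def prod_power_axis)

lemma expo_deg_0 [simp]: "expo_deg 0 = 0"
  by (simp add: expo_deg_def)

lemma expo_deg_add [simp]: "expo_deg (\<alpha> + \<beta>) = expo_deg \<alpha> + expo_deg \<beta>"
  by (simp add: expo_deg_def sum.distrib)

lemma sum_axis: "(\<Sum>l\<in>UNIV. (axis k a $ l :: nat)) = a"
  by (simp add: axis_def)

lemma expo_deg_unit [simp]: "expo_deg (unit_expo i) = 1"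
  by (cases i) (simp_all add: expo_deg_def unit_expo_def sum_axis)

lemma expo_split_unit:
  assumes "expo_deg \<beta> > 0"
  obtains i \<gamma> where "\<beta> = \<gamma> + unit_expo i"
proof (cases "fst \<beta> > 0")
  case True
  have "\<beta> = (fst \<beta> - 1, snd \<beta>) + unit_expo None"
    using True by (simp add: unit_expo_def prod_eq_iff)
  then show ?thesis using that by blast
next
  case False
  have "\<exists>k. snd \<beta> $ k \<noteq> 0"
  proof (rule ccontr)
    assume "\<nexists>k. snd \<beta> $ k \<noteq> 0"
    then show False using False assms by (simp add: expo_deg_def)
  qed
  then obtain k where k: "snd \<beta> $ k > 0" by auto
  have "\<beta> = (fst \<beta>, snd \<beta> - axis k 1) + unit_expo (Some k)"
    using k by (auto simp: unit_expo_def prod_eq_iff vec_eq_iff axis_def)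
  then show ?thesis using that by blast
qed

lemma expo_induct [case_names zero add_unit]:
  fixes \<beta> :: "'n::finite expo"
  assumes "P 0" and "\<And>\<beta> i. P \<beta> \<Longrightarrow> P (\<beta> + unit_expo i)"
  shows "P \<beta>"
proof (induction "expo_deg \<beta>" arbitrary: \<beta>)
  case 0
  then have "\<beta> = 0"
    by (auto simp: expo_deg_def prod_eq_iff vec_eq_iff)
  then show ?case using assms by simp
next
  case (Suc d)
  then obtain i \<gamma> where "\<beta> = \<gamma> + unit_expo i"
    using expo_split_unit[of \<beta>] by (metis zero_less_Suc)
  then show ?case using Suc assms(2) by simp
qed

text \<open>
  Splitting an exponent into two halves is what allows the even moments to control all others.
\<close>

lemma expo_split:
  fixes \<gamma> :: "'n::finite expo"
  assumes "k \<le> expo_deg \<gamma>"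
  obtains \<alpha> \<beta> where "\<gamma> = \<alpha> + \<beta>" "expo_deg \<alpha> = k"
  using assms
proof (induction k arbitrary: thesis)
  case 0
  then show ?case by (metis add_0 expo_deg_0)
next
  case (Suc k)
  then obtain \<alpha> \<beta> where "\<gamma> = \<alpha> + \<beta>" "expo_deg \<alpha> = k" by (metis Suc_leD)
  moreover from this Suc have "expo_deg \<beta> > 0" by simp
  then obtain i \<beta>' where "\<beta> = \<beta>' + unit_expo i" by (rule expo_split_unit)
  ultimately have "\<gamma> = (\<alpha> + unit_expo i) + \<beta>'" "expo_deg (\<alpha> + unit_expo i) = Suc k"
    by (simp_all add: add_ac)
  then show ?case using Suc by blast
qed

section \<open>A Peano curve\<close>

text \<open>
  At the first index j where the digits differ, the terms differ by \<open>2 / 3 ^ Suc j\<close>, and all later terms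
  together can cancel at most half of that. The digits 0 and 2 leave this gap; it makes finitely many
  digits a locally constant function of the value.
\<close>

lemma ternary_series_close_imp_digits_eq:
  fixes b b' :: "nat \<Rightarrow> bool"
  assumes close: "\<bar>suminf (\<lambda>k. 2 * of_bool (b k) / 3 ^ Suc k) - suminf (\<lambda>k. 2 * of_bool (b' k) / 3 ^ Suc k)\<bar> < (1 / 3 ^ Suc n :: real)"
    and "k \<le> n"
  shows "b k = b' k"
proof (rule ccontr)
  assume "b k \<noteq> b' k"
  define a where "a k = (2 * of_bool (b k) / 3 ^ Suc k - 2 * of_bool (b' k) / 3 ^ Suc k :: real)" for k
  define j where "j = (LEAST k. b k \<noteq> b' k)"
  have j: "b j \<noteq> b' j" unfolding j_def by (rule LeastI) fact
  have "j \<le> n" using Least_le[of "\<lambda>k. b k \<noteq> b' k" k] \<open>b k \<noteq> b' k\<close> \<open>k \<le> n\<close> by (simp add: j_def)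
  have below: "a i = 0" if "i < j" for i
    using not_less_Least[OF that[unfolded j_def]] by (simp add: a_def)
  have geo: "(\<lambda>k. 2 / 3 ^ Suc (k + m)) sums (1 / 3 ^ m :: real)" for m
    using sums_mult[OF geometric_sums[of "1/3::real"], of "2 / 3 ^ Suc m"]
    by (simp add: power_add power_divide field_simps)
  have summ: "summable (\<lambda>k. 2 * of_bool (c k) / 3 ^ Suc k :: real)" for c :: "nat \<Rightarrow> bool"
    by (rule summable_comparison_test[of _ "\<lambda>k. 2 / 3 ^ Suc k"])
       (use geo[of 0] in \<open>auto simp: sums_iff\<close>)
  have a_sums: "summable a"
    unfolding a_def by (intro summable_diff summ)
  have a_eq: "suminf a = suminf (\<lambda>k. 2 * of_bool (b k) / 3 ^ Suc k) - suminf (\<lambda>k. 2 * of_bool (b' k) / 3 ^ Suc k)"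
    unfolding a_def by (intro suminf_diff[symmetric] summ)
  have abs_a: "\<bar>a k\<bar> \<le> 2 / 3 ^ Suc k" for k
    by (auto simp: a_def)
  have "suminf a = suminf (\<lambda>k. a (k + Suc j)) + (\<Sum>i<Suc j. a i)"
    by (rule suminf_split_initial_segment[OF a_sums])
  also have "(\<Sum>i<Suc j. a i) = a j"
    using below by simp
  finally have "\<bar>suminf a\<bar> \<ge> \<bar>a j\<bar> - \<bar>suminf (\<lambda>k. a (k + Suc j))\<bar>" by linarith
  moreover have "\<bar>a j\<bar> = 2 / 3 ^ Suc j"
    using j by (auto simp: a_def)
  moreover have "\<bar>suminf (\<lambda>k. a (k + Suc j))\<bar> \<le> 1 / 3 ^ Suc j"
  proof -
    have "summable (\<lambda>k. \<bar>a (k + Suc j)\<bar>)"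
      by (rule summable_comparison_test[of _ "\<lambda>k. 2 / 3 ^ Suc (k + Suc j)"])
         (use abs_a geo[of "Suc j"] in \<open>auto simp: sums_iff simp del: power_Suc\<close>)
    then have "\<bar>suminf (\<lambda>k. a (k + Suc j))\<bar> \<le> suminf (\<lambda>k. \<bar>a (k + Suc j)\<bar>)"
      using summable_norm[of "\<lambda>k. a (k + Suc j)"] by simp
    also have "\<dots> \<le> suminf (\<lambda>k. 2 / 3 ^ Suc (k + Suc j))"
      by (intro suminf_le abs_a \<open>summable (\<lambda>k. \<bar>a (k + Suc j)\<bar>)\<close>)
         (use geo[of "Suc j"] in \<open>simp add: sums_iff\<close>)
    also have "\<dots> = 1 / 3 ^ Suc j" using geo[of "Suc j"] by (simp add: sums_iff)
    finally show ?thesis .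
  qed
  ultimately have "\<bar>suminf a\<bar> \<ge> 1 / 3 ^ Suc j" by simp
  moreover have "(1 / 3 ^ Suc j :: real) \<ge> 1 / 3 ^ Suc n"
    using \<open>j \<le> n\<close> by (intro divide_left_mono power_increasing) auto
  ultimately show False using close a_eq by linarith
qed

lemma ternary_series_in_unit_interval:
  "suminf (\<lambda>k. 2 * of_bool (b k) / 3 ^ Suc k) \<in> {0..1::real}"
proof -
  have geo: "(\<lambda>k. 2 / 3 ^ Suc k) sums (1 :: real)"
    using sums_mult[OF geometric_sums[of "1/3::real"], of "2 / 3"]
    by (simp add: power_divide field_simps)
  have summ: "summable (\<lambda>k. 2 * of_bool (b k) / 3 ^ Suc k :: real)"
    by (rule summable_comparison_test[of _ "\<lambda>k. 2 / 3 ^ Suc k"])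
       (use geo in \<open>auto simp: sums_iff\<close>)
  have "suminf (\<lambda>k. 2 * of_bool (b k) / 3 ^ Suc k) \<le> suminf (\<lambda>k. 2 / 3 ^ Suc k :: real)"
    by (intro suminf_le summ) (use geo in \<open>auto simp: sums_iff\<close>)
  moreover have "0 \<le> suminf (\<lambda>k. 2 * of_bool (b k) / 3 ^ Suc k :: real)"
    by (intro suminf_nonneg summ) simp
  ultimately show ?thesis using geo by (simp add: sums_iff)
qed

text \<open>
  The digits of \<open>c x\<close> record on which side of each hyperplane \<open>{y. y \<bullet> b = q}\<close>, with \<open>b\<close> a basis vector
  and \<open>q\<close> rational, the point \<open>x\<close> lies. Close values of \<open>c\<close> share their first digits, and finitely many
  of these digits locate a point of the box up to \<open>\<epsilon>\<close>; so the inverse of \<open>c\<close> is uniformly continuous on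
  the image of the box. It extends to the closure of the image and, the box being convex, by Dugundji's
  theorem to a continuous map from the whole line into the box.
\<close>

theorem Peano_curve:
  fixes a b :: "'a::euclidean_space"
  assumes "cbox a b \<noteq> {}"
  obtains \<phi> :: "real \<Rightarrow> 'a"
    where "continuous_on UNIV \<phi>" "range \<phi> \<subseteq> cbox a b" "cbox a b \<subseteq> \<phi> ` {0..1}"
proof -
  define S where "S = (Basis :: 'a set) \<times> (\<rat> :: real set)"
  have S: "countable S" "S \<noteq> {}"
    unfolding S_def using countable_rat nonempty_Basis Rats_0 countable_finite[OF finite_Basis]
    by (auto intro!: countable_SIGMA)
  define e where "e = from_nat_into S"
  have e: "range e = S" using S by (simp add: e_def range_from_nat_into)
  define B where "B x k \<longleftrightarrow> x \<bullet> fst (e k) < snd (e k)" for x k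
  define c where "c x = suminf (\<lambda>k. 2 * of_bool (B x k) / 3 ^ Suc k :: real)" for x
  have key: "\<exists>\<delta>>0. \<forall>x\<in>cbox a b. \<forall>y\<in>cbox a b. \<bar>c x - c y\<bar> < \<delta> \<longrightarrow> dist x y < \<epsilon>" if \<epsilon>: "\<epsilon> > 0" for \<epsilon>
  proof -
    obtain p :: nat where p: "inverse (real (Suc p)) < \<epsilon> / DIM('a)"
      using reals_Archimedean[of "\<epsilon> / DIM('a)"] \<epsilon> by auto
    define \<eta> where "\<eta> = inverse (real (Suc p))"
    have \<eta>: "\<eta> > 0" "\<eta> \<in> \<rat>" "DIM('a) * \<eta> < \<epsilon>"
      using p by (auto simp: \<eta>_def field_simps)
    obtain M where M: "\<And>x. x \<in> cbox a b \<Longrightarrow> norm x \<le> M" using bounded_cbox[of a b] bounded_iff by blast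
    \<comment> \<open>\<open>Q\<close> separates any two numbers of \<open>[-M, M]\<close> whose distance is at least \<open>\<eta>\<close>.\<close>
    define Q where "Q = (\<lambda>m::int. \<eta> * m) ` {\<lfloor>-M/\<eta>\<rfloor>..\<lfloor>M/\<eta>\<rfloor>}"
    have "finite (Basis \<times> Q)" by (simp add: Q_def)
    moreover have "Basis \<times> Q \<subseteq> range e"
      using \<eta> by (auto simp: e S_def Q_def)
    ultimately obtain N where N: "finite N" "Basis \<times> Q \<subseteq> e ` N"
      by (metis finite_subset_image order_refl)
    define n where "n = Max (insert 0 N)"
    show ?thesis
    proof (intro exI[of _ "1 / 3 ^ Suc n"] conjI ballI impI)
      fix x y assume xy: "x \<in> cbox a b" "y \<in> cbox a b" and cl: "\<bar>c x - c y\<bar> < 1 / 3 ^ Suc n"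
      have same: "(x \<bullet> i < q) = (y \<bullet> i < q)" if iq: "i \<in> Basis" "q \<in> Q" for i q
      proof -
        obtain k where k: "k \<in> N" "e k = (i, q)" using N iq by force
        have "k \<le> n" unfolding n_def using k N by simp
        from ternary_series_close_imp_digits_eq[OF cl[unfolded c_def] this]
        show ?thesis by (simp add: B_def k)
      qed
      have *: "s < t + \<eta>" if "\<And>q. q \<in> Q \<Longrightarrow> (s < q) = (t < q)" "\<bar>s\<bar> \<le> M" for s t
      proof (rule ccontr)
        assume "\<not> s < t + \<eta>"
        define q where "q = \<eta> * \<lfloor>s / \<eta>\<rfloor>"
        have "-M / \<eta> \<le> s / \<eta>" "s / \<eta> \<le> M / \<eta>" using that(2) \<eta>(1) by (auto simp: field_simps abs_le_iff)
        then have "q \<in> Q" unfolding Q_def q_def by (intro imageI) (auto intro: floor_mono)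
        moreover have "q \<le> s" "s < q + \<eta>"
        proof -
          have "\<lfloor>s / \<eta>\<rfloor> \<le> s / \<eta>" "s / \<eta> < \<lfloor>s / \<eta>\<rfloor> + 1" by linarith+
          then have "\<eta> * \<lfloor>s / \<eta>\<rfloor> \<le> \<eta> * (s / \<eta>)" "\<eta> * (s / \<eta>) < \<eta> * (\<lfloor>s / \<eta>\<rfloor> + 1)"
            using \<eta>(1) by (simp_all only: mult_le_cancel_left_pos mult_less_cancel_left_pos)
          then show "q \<le> s" "s < q + \<eta>" using \<eta>(1) by (simp_all add: q_def distrib_left)
        qed
        ultimately show False using that(1)[of q] \<open>\<not> s < t + \<eta>\<close> by linarith
      qed
      have comp: "\<bar>(x - y) \<bullet> i\<bar> < \<eta>" if i: "i \<in> Basis" for i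
      proof -
        have "\<bar>x \<bullet> i\<bar> \<le> M" "\<bar>y \<bullet> i\<bar> \<le> M"
          using Basis_le_norm[OF i] M xy by (meson order_trans)+
        then have "x \<bullet> i < y \<bullet> i + \<eta>" "y \<bullet> i < x \<bullet> i + \<eta>"
          using same[OF i] by (auto intro!: *)
        then show ?thesis by (simp add: inner_diff_left abs_less_iff)
      qed
      have "dist x y \<le> (\<Sum>i\<in>Basis. \<bar>(x - y) \<bullet> i\<bar>)"
        unfolding dist_norm by (rule norm_le_l1)
      also have "\<dots> \<le> (\<Sum>i\<in>(Basis::'a set). \<eta>)"
        using comp by (intro sum_mono) (auto intro: less_imp_le)
      finally show "dist x y < \<epsilon>" using \<eta> by simp
    qed auto
  qed
  have inj: "inj_on c (cbox a b)"
  proof (rule inj_onI, rule ccontr)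
    fix x y assume xy: "x \<in> cbox a b" "y \<in> cbox a b" "c x = c y" "x \<noteq> y"
    then show False using key[of "dist x y"] by force
  qed
  define g where "g = inv_into (cbox a b) c"
  have g: "g (c x) = x" if "x \<in> cbox a b" for x using inj that by (simp add: g_def)
  have "uniformly_continuous_on (c ` cbox a b) g"
    unfolding uniformly_continuous_on_def
  proof (intro allI impI)
    fix \<epsilon> :: real assume "\<epsilon> > 0"
    from key[OF this] show "\<exists>d>0. \<forall>s\<in>c ` cbox a b. \<forall>s'\<in>c ` cbox a b. dist s' s < d \<longrightarrow> dist (g s') (g s) < \<epsilon>"
      by (auto simp: g dist_real_def)
  qed
  then obtain h where h: "uniformly_continuous_on (closure (c ` cbox a b)) h"
     "\<And>s. s \<in> c ` cbox a b \<Longrightarrow> g s = h s"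
    by (rule uniformly_continuous_on_extension_on_closure) blast
  have cont: "continuous_on (closure (c ` cbox a b)) h"
    using h(1) by (rule uniformly_continuous_imp_continuous)
  have "h ` closure (c ` cbox a b) \<subseteq> cbox a b"
  proof (rule image_closure_subset[OF cont closed_cbox])
    show "h ` c ` cbox a b \<subseteq> cbox a b" using h(2) g by force
  qed
  with cont obtain \<phi> where \<phi>: "continuous_on UNIV \<phi>" "\<phi> ` UNIV \<subseteq> cbox a b"
      "\<And>s. s \<in> closure (c ` cbox a b) \<Longrightarrow> \<phi> s = h s"
    using Dugundji[OF convex_box(1) assms, of UNIV "closure (c ` cbox a b)" h]
    by auto
  have "cbox a b \<subseteq> \<phi> ` {0..1}"
  proof
    fix x assume x: "x \<in> cbox a b"
    then have "\<phi> (c x) = x"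
      using \<phi>(3)[of "c x"] h(2)[of "c x"] g[OF x] closure_subset[of "c ` cbox a b"] by auto
    moreover have "c x \<in> {0..1}" unfolding c_def by (rule ternary_series_in_unit_interval)
    ultimately show "x \<in> \<phi> ` {0..1}" by force
  qed
  with \<phi> that show ?thesis by blast
qed

section \<open>Positive functionals of exponential growth\<close>

text \<open>
  The growth condition is the trace that a support inside \<open>[-R, R]\<close> in each variable leaves on the
  moments. Together with positivity on squares it is stable under multiplication by \<open>R \<plusminus> x_i\<close>, which
  positivity on squares alone is not.
\<close>

definition psd_bounded :: "real \<Rightarrow> ('n::finite expo \<Rightarrow> real) \<Rightarrow> bool" where
  "psd_bounded R w \<longleftrightarrow> (\<forall>q. 0 \<le> riesz w (q * q)) \<and> (\<exists>C. \<forall>\<beta>. \<bar>w \<beta>\<bar> \<le> C * R ^ expo_deg \<beta>)"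

lemma monomial_poly_add: "monomial_poly (\<alpha> + \<beta>) = monomial_poly \<alpha> * monomial_poly \<beta>"
  by (simp add: monomial_poly_def mult_single)

lemma monomial_poly_0 [simp]: "monomial_poly 0 = 1"
  by (simp add: monomial_poly_def)

lemma riesz_one [simp]: "riesz w 1 = w 0"
  using riesz_monomial_poly[of w 0] by simp

lemma riesz_monomial_mult_bound:
  fixes w :: "'n::finite expo \<Rightarrow> real"
  assumes "\<exists>C. \<forall>\<beta>. \<bar>w \<beta>\<bar> \<le> C * R ^ expo_deg \<beta>"
  shows "\<exists>C. \<forall>\<beta>. \<bar>riesz w (q * monomial_poly \<beta>)\<bar> \<le> C * R ^ expo_deg \<beta>"
proof (induction q rule: rpoly_induct)
  case (single \<alpha> c)
  from assms obtain C where C: "\<And>\<beta>. \<bar>w \<beta>\<bar> \<le> C * R ^ expo_deg \<beta>" by blast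
  have "\<bar>riesz w (Poly_Mapping.single \<alpha> c * monomial_poly \<beta>)\<bar> \<le> (\<bar>c\<bar> * C * R ^ expo_deg \<alpha>) * R ^ expo_deg \<beta>" for \<beta>
    using mult_left_mono[OF C[of "\<alpha> + \<beta>"], of "\<bar>c\<bar>"]
    by (simp add: monomial_poly_def mult_single abs_mult power_add mult_ac)
  then show ?case by blast
next
  case (add p q)
  then obtain C D where CD: "\<And>\<beta>. \<bar>riesz w (p * monomial_poly \<beta>)\<bar> \<le> C * R ^ expo_deg \<beta>"
    "\<And>\<beta>. \<bar>riesz w (q * monomial_poly \<beta>)\<bar> \<le> D * R ^ expo_deg \<beta>" by blast
  have "\<bar>riesz w ((p + q) * monomial_poly \<beta>)\<bar> \<le> (C + D) * R ^ expo_deg \<beta>" for \<beta>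
    using CD[of \<beta>] by (simp add: distrib_right)
  then show ?case by blast
qed

lemma riesz_Cauchy_Schwarz:
  assumes psd: "\<And>q. 0 \<le> riesz w (q * q)"
  shows "(riesz w (p * q))\<^sup>2 \<le> riesz w (p * p) * riesz w (q * q)"
proof -
  let ?a = "riesz w (p * p)" and ?b = "riesz w (p * q)" and ?c = "riesz w (q * q)"
  have quad: "0 \<le> s\<^sup>2 * ?a + 2 * s * t * ?b + t\<^sup>2 * ?c" for s t
  proof -
    let ?r = "Poly_Mapping.single 0 s * p + Poly_Mapping.single 0 t * q"
    have "?r * ?r = Poly_Mapping.single 0 s * (Poly_Mapping.single 0 s * (p * p))
        + Poly_Mapping.single 0 s * (Poly_Mapping.single 0 t * (p * q))
        + Poly_Mapping.single 0 s * (Poly_Mapping.single 0 t * (p * q))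
        + Poly_Mapping.single 0 t * (Poly_Mapping.single 0 t * (q * q))"
      by (simp add: algebra_simps)
    then have "riesz w (?r * ?r) = s\<^sup>2 * ?a + 2 * s * t * ?b + t\<^sup>2 * ?c"
      by (simp only: riesz_add riesz_scale) (simp add: power2_eq_square)
    then show ?thesis using psd[of ?r] by simp
  qed
  show ?thesis
  proof (cases "?a = 0")
    case True
    have "?b = 0"
    proof (rule ccontr)
      assume "?b \<noteq> 0"
      then show False
        using quad[of "- (?c + 1) / (2 * ?b)" 1] True by (simp add: field_simps)
    qed
    then show ?thesis using True by simp
  next
    case False
    then have "?a > 0" using psd[of p] by simp
    have "0 \<le> ?a * (?a * ?c - ?b\<^sup>2)"
      using quad[of "- ?b" ?a] by (simp add: power2_eq_square algebra_simps)
    then show ?thesis using \<open>?a > 0\<close> by (simp add: zero_le_mult_iff)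
  qed
qed

definition var :: "'n::finite option \<Rightarrow> 'n rpoly" where
  "var i = monomial_poly (unit_expo i)"

lemma peval_var [simp]: "peval (var i) p = coord i p"
  by (simp add: var_def)

lemma var_power: "\<exists>\<gamma>. var i ^ k = monomial_poly \<gamma> \<and> expo_deg \<gamma> = k"
proof (induction k)
  case 0
  show ?case by (intro exI[of _ 0]) simp
next
  case (Suc k)
  then obtain \<gamma> where "var i ^ k = monomial_poly \<gamma>" "expo_deg \<gamma> = k" by blast
  then show ?case
    by (intro exI[of _ "unit_expo i + \<gamma>"]) (simp add: monomial_poly_add var_def)
qed

text \<open>
  Put \<open>s k = L(x_i ^ k q\<^sup>2)\<close>. Cauchy-Schwarz gives \<open>(s k)\<^sup>2 \<le> s (2 k) s 0\<close>; iterating along the powers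
  of two, \<open>(\<bar>s 1\<bar> / s 0) ^ N \<le> \<bar>s N\<bar> / s 0 \<le> C R ^ N / s 0\<close> for \<open>N = 2 ^ n\<close>. As N grows, the constant
  \<open>C / s 0\<close> becomes irrelevant and \<open>\<bar>s 1\<bar> \<le> R s 0\<close> remains.
\<close>

lemma abs_riesz_var_square_le:
  assumes w: "psd_bounded R w" and R: "R > 0"
  shows "\<bar>riesz w (var i * (q * q))\<bar> \<le> R * riesz w (q * q)"
proof -
  define s where "s k = riesz w (var i ^ k * (q * q))" for k
  have psd: "\<And>q. 0 \<le> riesz w (q * q)" using w by (simp add: psd_bounded_def)
  have s0: "s 0 \<ge> 0" using psd by (simp add: s_def)
  have CS: "(s k)\<^sup>2 \<le> s (2 * k) * s 0" for k
  proof -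
    have "var i ^ (2 * k) = var i ^ k * var i ^ k"
      unfolding mult_2 by (rule power_add)
    then have "var i ^ (2 * k) * (q * q) = (var i ^ k * q) * (var i ^ k * q)"
      by (simp only: mult_ac)
    then show ?thesis
      using riesz_Cauchy_Schwarz[OF psd, of "var i ^ k * q" q] by (simp add: s_def mult.assoc)
  qed
  show ?thesis
  proof (cases "s 0 = 0")
    case True
    then show ?thesis using CS[of 1] by (simp add: s_def)
  next
    case False
    with s0 have pos: "s 0 > 0" by simp
    obtain C where C: "\<And>\<beta>. \<bar>riesz w (q * q * monomial_poly \<beta>)\<bar> \<le> C * R ^ expo_deg \<beta>"
      using riesz_monomial_mult_bound[of w R "q * q"] w by (auto simp: psd_bounded_def)
    have growth: "\<bar>s k\<bar> \<le> C * R ^ k" for k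
    proof -
      obtain \<gamma> where "var i ^ k = monomial_poly \<gamma>" "expo_deg \<gamma> = k" using var_power by blast
      then show ?thesis using C[of \<gamma>] by (simp add: s_def mult_ac)
    qed
    have iter: "\<bar>s 1\<bar> ^ (2 ^ n) * s 0 \<le> s 0 ^ (2 ^ n) * \<bar>s (2 ^ n)\<bar>" for n
    proof (induction n)
      case (Suc n)
      have "(\<bar>s 1\<bar> ^ (2 ^ Suc n) * s 0) * s 0 = (\<bar>s 1\<bar> ^ (2 ^ n) * s 0)\<^sup>2"
        by (simp add: power2_eq_square mult_ac flip: power_mult power_add mult_2)
      also have "\<dots> \<le> (s 0 ^ (2 ^ n) * \<bar>s (2 ^ n)\<bar>)\<^sup>2"
        using Suc s0 by (intro power_mono) auto
      also have "\<dots> = s 0 ^ (2 ^ Suc n) * (s (2 ^ n))\<^sup>2"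
        by (simp add: power_mult_distrib mult.commute flip: power_mult)
      also have "\<dots> \<le> s 0 ^ (2 ^ Suc n) * (\<bar>s (2 ^ Suc n)\<bar> * s 0)"
        using CS[of "2 ^ n"] s0 mult_right_mono[OF abs_ge_self s0, of "s (2 ^ Suc n)"]
        by (intro mult_left_mono) auto
      finally show ?case using pos by (simp add: mult_ac)
    qed simp
    have "\<bar>s 1\<bar> \<le> R * s 0"
    proof (rule ccontr)
      assume "\<not> \<bar>s 1\<bar> \<le> R * s 0"
      define \<rho> where "\<rho> = \<bar>s 1\<bar> / (R * s 0)"
      have \<rho>: "\<rho> > 1" using \<open>\<not> \<bar>s 1\<bar> \<le> R * s 0\<close> R pos by (simp add: \<rho>_def)
      then obtain n where n: "C / s 0 < \<rho> ^ n" using real_arch_pow by blast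
      have "\<rho> ^ n \<le> \<rho> ^ (2 ^ n)"
        using \<rho> by (intro power_increasing) (auto intro: less_imp_le)
      also have "\<dots> \<le> C / s 0"
      proof -
        have "\<bar>s 1\<bar> ^ (2 ^ n) * s 0 \<le> s 0 ^ (2 ^ n) * (C * R ^ (2 ^ n))"
          using iter[of n] growth[of "2 ^ n"] s0 by (meson mult_left_mono order_trans zero_le_power)
        then show ?thesis
          using pos R by (simp add: \<rho>_def power_divide power_mult_distrib field_simps)
      qed
      finally show False using n by simp
    qed
    then show ?thesis by (simp add: s_def)
  qed
qed

text \<open>
  The multipliers \<open>s\<close> for which \<open>q \<mapsto> L(s q)\<close> stays in the class of \<open>L\<close>. They are closed under products,
  so that nonnegativity of \<open>L\<close> on products of several factors can be obtained one factor at a time.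
\<close>

definition preserves_psd :: "real \<Rightarrow> 'n::finite rpoly \<Rightarrow> bool" where
  "preserves_psd R s \<longleftrightarrow> (\<forall>w. psd_bounded R w \<longrightarrow> psd_bounded R (shift_seq w s))"

lemma preserves_psd_imp_riesz_nonneg:
  assumes "preserves_psd R s" "psd_bounded R w"
  shows "0 \<le> riesz w s"
proof -
  have "psd_bounded R (shift_seq w s)" using assms by (simp add: preserves_psd_def)
  then have "0 \<le> riesz (shift_seq w s) (1 * 1)" unfolding psd_bounded_def by blast
  then show ?thesis by (simp add: riesz_shift_seq del: riesz_one)
qed

text \<open>
  The growth condition survives every multiplier, so only positivity on squares has to be checked.
\<close>

lemma preserves_psdI:
  fixes s :: "'n::finite rpoly"
  assumes "\<And>w q. psd_bounded R w \<Longrightarrow> 0 \<le> riesz w (s * (q * q))"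
  shows "preserves_psd R s"
  unfolding preserves_psd_def psd_bounded_def[of R "shift_seq _ _"]
proof (intro allI impI conjI)
  fix w :: "'n expo \<Rightarrow> real" assume w: "psd_bounded R w"
  then show "0 \<le> riesz (shift_seq w s) (q * q)" for q by (simp add: riesz_shift_seq assms)
  show "\<exists>C. \<forall>\<beta>. \<bar>shift_seq w s \<beta>\<bar> \<le> C * R ^ expo_deg \<beta>"
    unfolding shift_seq_def using w by (intro riesz_monomial_mult_bound) (simp add: psd_bounded_def)
qed

lemma preserves_psd_mult:
  "preserves_psd R s \<Longrightarrow> preserves_psd R s' \<Longrightarrow> preserves_psd R (s * s')"
  by (simp add: preserves_psd_def flip: shift_seq_shift_seq)

lemma preserves_psd_const: "c \<ge> 0 \<Longrightarrow> preserves_psd R (Poly_Mapping.single 0 c)"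
  by (rule preserves_psdI) (simp add: psd_bounded_def)

lemma preserves_psd_1: "preserves_psd R 1"
  using preserves_psd_const[of 1] by simp

lemma preserves_psd_of_nat: "preserves_psd R (of_nat k)"
  by (metis of_nat_0_le_iff preserves_psd_const single_of_nat)

lemma preserves_psd_power: "preserves_psd R s \<Longrightarrow> preserves_psd R (s ^ k)"
  by (induction k) (auto intro: preserves_psd_mult preserves_psd_1)

lemma preserves_psd_prod: "(\<And>i. i \<in> I \<Longrightarrow> preserves_psd R (s i)) \<Longrightarrow> preserves_psd R (prod s I)"
  by (induction I rule: infinite_finite_induct) (auto intro: preserves_psd_mult preserves_psd_1)

section \<open>Bernstein weights\<close>

text \<open>
  The barycentric coordinate \<open>(R + x_i) / (2 R)\<close> of the interval \<open>[-R, R]\<close>; its complement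
  \<open>1 - upper_weight R i\<close> is \<open>(R - x_i) / (2 R)\<close>.
\<close>

definition upper_weight :: "real \<Rightarrow> 'n::finite option \<Rightarrow> 'n rpoly" where
  "upper_weight R i = Poly_Mapping.single 0 (1 / 2) + Poly_Mapping.single 0 (1 / (2 * R)) * var i"

lemma preserves_psd_half_plus:
  fixes i :: "'n::finite option"
  assumes R: "R > 0" and \<sigma>: "\<bar>\<sigma>\<bar> \<le> 1 / (2 * R)"
  shows "preserves_psd R (Poly_Mapping.single 0 (1 / 2) + Poly_Mapping.single 0 \<sigma> * var i)"
proof (rule preserves_psdI)
  fix w :: "'n expo \<Rightarrow> real" and q assume w: "psd_bounded R w"
  have "\<bar>\<sigma>\<bar> * \<bar>riesz w (var i * (q * q))\<bar> \<le> 1 / (2 * R) * (R * riesz w (q * q))"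
    using abs_riesz_var_square_le[OF w R] \<sigma> R by (intro mult_mono) auto
  then have "\<bar>\<sigma> * riesz w (var i * (q * q))\<bar> \<le> riesz w (q * q) / 2"
    using R by (simp add: abs_mult)
  then show "0 \<le> riesz w ((Poly_Mapping.single 0 (1 / 2) + Poly_Mapping.single 0 \<sigma> * var i) * (q * q))"
    by (simp add: distrib_right mult.assoc)
qed

lemma preserves_psd_upper_weight: "R > 0 \<Longrightarrow> preserves_psd R (upper_weight R i)"
  unfolding upper_weight_def by (rule preserves_psd_half_plus) auto

lemma preserves_psd_lower_weight:
  assumes "R > 0"
  shows "preserves_psd R (1 - upper_weight R i)"
proof -
  have "1 - upper_weight R i = Poly_Mapping.single 0 (1 / 2) + Poly_Mapping.single 0 (- (1 / (2 * R))) * var i"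
  proof -
    have "(1 :: 'a rpoly) = Poly_Mapping.single 0 (1/2) + Poly_Mapping.single 0 (1/2)"
      by (simp flip: single_add)
    then show ?thesis
      by (simp add: upper_weight_def single_uminus)
  qed
  then show ?thesis using preserves_psd_half_plus[of R "- (1 / (2 * R))"] assms by simp
qed

text \<open>
  The tensor product Bernstein basis of degree k on the box where every variable ranges over \<open>[-R, R]\<close>.
\<close>

definition bernstein_poly :: "real \<Rightarrow> nat \<Rightarrow> ('n::finite option \<Rightarrow> nat) \<Rightarrow> 'n rpoly" where
  "bernstein_poly R k j =
     (\<Prod>i\<in>UNIV. of_nat (k choose j i) * (upper_weight R i ^ j i * (1 - upper_weight R i) ^ (k - j i)))"

lemma riesz_bernstein_poly_nonneg:
  assumes "R > 0" "psd_bounded R w"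
  shows "0 \<le> riesz w (bernstein_poly R k j)"
  unfolding bernstein_poly_def
  by (intro preserves_psd_imp_riesz_nonneg[OF _ assms(2)] preserves_psd_prod preserves_psd_mult
        preserves_psd_of_nat preserves_psd_power preserves_psd_upper_weight
        preserves_psd_lower_weight assms(1))

lemma riesz_of_nat_mult: "riesz w (of_nat k * q) = real k * riesz w q"
  by (metis riesz_scale single_of_nat)

text \<open>
  The identity \<open>(k choose j) (j choose a) = (k choose a) (k - a choose (j - a))\<close> reduces this to the
  binomial theorem. Bernstein sums reproduce the factorial moments of the nodes exactly, but their power
  moments only in the limit.
\<close>

lemma factorial_moment_bernstein:
  fixes u v :: "'a::comm_ring_1"
  assumes uv: "u + v = 1" and "a \<le> k"
  shows "(\<Sum>j\<le>k. of_nat (j choose a) * (of_nat (k choose j) * (u ^ j * v ^ (k - j)))) = of_nat (k choose a) * u ^ a"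
proof -
  have "(\<Sum>j\<le>k. of_nat (j choose a) * (of_nat (k choose j) * (u ^ j * v ^ (k - j))))
      = (\<Sum>j\<in>{a..k}. of_nat (j choose a) * (of_nat (k choose j) * (u ^ j * v ^ (k - j))))"
    by (rule sum.mono_neutral_right) (auto simp: not_le binomial_eq_0)
  also have "\<dots> = (\<Sum>j\<in>{a..k}. of_nat (k choose a) * u ^ a * (of_nat (k - a choose (j - a)) * u ^ (j - a) * v ^ (k - a - (j - a))))"
  proof (intro sum.cong refl)
    fix j assume j: "j \<in> {a..k}"
    have "of_nat (j choose a) * of_nat (k choose j) = (of_nat (k choose a) * of_nat (k - a choose (j - a)) :: 'a)"
      using choose_mult[of a j k] j by (simp flip: of_nat_mult add: mult.commute)
    moreover have "u ^ j = u ^ a * u ^ (j - a)" using j by (simp flip: power_add)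
    moreover have "k - a - (j - a) = k - j" using j by simp
    ultimately show "of_nat (j choose a) * (of_nat (k choose j) * (u ^ j * v ^ (k - j)))
        = of_nat (k choose a) * u ^ a * (of_nat (k - a choose (j - a)) * u ^ (j - a) * v ^ (k - a - (j - a)))"
      by (simp add: mult_ac) (simp flip: mult.assoc)
  qed
  also have "\<dots> = of_nat (k choose a) * u ^ a * (\<Sum>j\<in>{a..k}. of_nat (k - a choose (j - a)) * u ^ (j - a) * v ^ (k - a - (j - a)))"
    by (simp add: sum_distrib_left)
  also have "(\<Sum>j\<in>{a..k}. of_nat (k - a choose (j - a)) * u ^ (j - a) * v ^ (k - a - (j - a)))
     = (\<Sum>i\<le>k - a. of_nat (k - a choose i) * u ^ i * v ^ (k - a - i))"
    by (rule sum.reindex_bij_witness[of _ "\<lambda>i. i + a" "\<lambda>j. j - a"]) (use assms(2) in auto)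
  also have "\<dots> = 1" using binomial_ring[of u v "k - a"] uv by simp
  finally show ?thesis by simp
qed

text \<open>
  The case \<open>a = 0\<close> says that the weights \<open>L(bernstein_poly R k j)\<close> add up to \<open>L(1)\<close>.
\<close>

lemma factorial_moments_bernstein_weights:
  fixes w :: "'n::finite expo \<Rightarrow> real"
  assumes "\<And>i. a i \<le> k"
  shows "(\<Sum>j\<in>UNIV \<rightarrow>\<^sub>E {..k}. (\<Prod>i\<in>UNIV. real (j i choose a i)) * riesz w (bernstein_poly R k j))
     = (\<Prod>i\<in>UNIV. real (k choose a i)) * riesz w (\<Prod>i\<in>UNIV. upper_weight R i ^ a i)"
proof -
  have "(\<Sum>j\<in>UNIV \<rightarrow>\<^sub>E {..k}. (\<Prod>i\<in>UNIV. real (j i choose a i)) * riesz w (bernstein_poly R k j))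
    = riesz w (\<Sum>j\<in>UNIV \<rightarrow>\<^sub>E {..k}. of_nat (\<Prod>i\<in>UNIV. (j i choose a i)) * bernstein_poly R k j)"
    by (simp only: riesz_sum riesz_of_nat_mult) simp
  also have "(\<Sum>j\<in>UNIV \<rightarrow>\<^sub>E {..k}. of_nat (\<Prod>i\<in>UNIV. (j i choose a i)) * bernstein_poly R k j)
     = (\<Sum>j\<in>UNIV \<rightarrow>\<^sub>E {..k}. \<Prod>i\<in>UNIV. of_nat (j i choose a i) *
          (of_nat (k choose j i) * (upper_weight R i ^ j i * (1 - upper_weight R i) ^ (k - j i))))"
    by (simp add: bernstein_poly_def of_nat_prod flip: prod.distrib)
  also have "\<dots> = (\<Prod>i\<in>UNIV. \<Sum>j\<le>k. of_nat (j choose a i) *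
          (of_nat (k choose j) * (upper_weight R i ^ j * (1 - upper_weight R i) ^ (k - j))))"
    by (rule prod_sum_PiE[symmetric]) auto
  also have "\<dots> = (\<Prod>i\<in>UNIV. of_nat (k choose a i) * upper_weight R i ^ a i)"
    by (intro prod.cong refl factorial_moment_bernstein) (use assms in auto)
  also have "\<dots> = of_nat (\<Prod>i\<in>UNIV. (k choose a i)) * (\<Prod>i\<in>UNIV. upper_weight R i ^ a i)"
    by (simp add: prod.distrib of_nat_prod)
  finally show ?thesis by (simp only: riesz_of_nat_mult) simp
qed

text \<open>
  The ratio of binomial coefficients is the product of \<open>(j - i) / (k - i)\<close> over \<open>i < a\<close>, and each factor
  is within \<open>i / k\<close> of \<open>j / k\<close>. This compares factorial moments with power moments uniformly in the node.
\<close>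

lemma binomial_ratio_close:
  assumes "j \<le> k" "a \<le> k" "k > 0"
  shows "\<bar>real (j choose a) / real (k choose a) - (real j / real k) ^ a\<bar> \<le> (real a)\<^sup>2 / real k
    \<and> real (j choose a) / real (k choose a) \<le> 1"
  using assms(2)
proof (induction a)
  case (Suc a)
  let ?b = "real (j choose a) / real (k choose a)" and ?u = "real j / real k"
  let ?r = "real (j - a) / real (k - a)"
  have absorb: "real (n choose Suc a) = real (n - a) * real (n choose a) / real (Suc a)" for n
  proof -
    have "Suc a * (n choose Suc a) = (n - a) * (n choose a)"
      by (simp only: binomial_absorption binomial_absorb_comp)
    then show ?thesis by (metis nonzero_mult_div_cancel_left of_nat_mult of_nat_eq_0_iff nat.distinct(1))
  qed
  have eq: "real (j choose Suc a) / real (k choose Suc a) = ?b * ?r"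
    by (simp only: absorb) (simp add: mult.commute)
  have ka: "k - a > 0" using Suc.prems by simp
  have r: "0 \<le> ?r" "?r \<le> 1" using assms(1) ka by (auto simp: divide_le_eq_1)
  have u: "0 \<le> ?u" "?u \<le> 1" using assms by auto
  have b: "0 \<le> ?b" "?b \<le> 1" using Suc.IH Suc.prems by auto
  have ru: "\<bar>?r - ?u\<bar> \<le> real a / real k"
  proof (cases "a \<le> j")
    case True
    have h: "?u - ?r = (real a / real k) * (real (k - j) / real (k - a))"
      using True assms ka by (simp add: field_simps of_nat_diff)
    have "real (k - j) / real (k - a) \<le> 1" using True ka by auto
    then have "(real a / real k) * (real (k - j) / real (k - a)) \<le> real a / real k"
      by (intro mult_left_le) auto
    moreover have "0 \<le> (real a / real k) * (real (k - j) / real (k - a))" by simp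
    ultimately show ?thesis
      unfolding abs_minus_commute[of ?r] h by (simp only: abs_of_nonneg)
  next
    case False
    then show ?thesis using assms by (simp add: divide_right_mono)
  qed
  have "\<bar>?b * ?r - ?u ^ Suc a\<bar> = \<bar>(?b - ?u ^ a) * ?r + ?u ^ a * (?r - ?u)\<bar>"
    by (simp add: algebra_simps)
  also have "\<dots> \<le> \<bar>?b - ?u ^ a\<bar> * ?r + ?u ^ a * \<bar>?r - ?u\<bar>"
    using r u by (intro order.trans[OF abs_triangle_ineq]) (simp add: abs_mult)
  also have "\<dots> \<le> (real a)\<^sup>2 / real k * 1 + 1 * (real a / real k)"
    using Suc.IH Suc.prems ru r u by (intro add_mono mult_mono) (auto intro: power_le_one)
  also have "\<dots> \<le> (real (Suc a))\<^sup>2 / real k"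
    using assms by (simp add: field_simps power2_eq_square)
  finally show ?case
    unfolding eq using mult_le_one[OF b(2) r] by (intro conjI)
qed auto

section \<open>Representing measures on a box\<close>

definition grid_point :: "real \<Rightarrow> nat \<Rightarrow> ('n::finite option \<Rightarrow> nat) \<Rightarrow> real \<times> (real^'n)" where
  "grid_point R k j = (2 * R * (j None / k) - R, \<chi> l. 2 * R * (j (Some l) / k) - R)"

lemma coord_grid_point: "coord i (grid_point R k j) = 2 * R * (j i / k) - R"
  by (cases i) (simp_all add: coord_def grid_point_def)

lemma peval_upper_weight: "R > 0 \<Longrightarrow> peval (upper_weight R i) p = (R + coord i p) / (2 * R)"
  by (simp add: upper_weight_def field_simps)

lemma peval_upper_weight_grid_point:
  "R > 0 \<Longrightarrow> peval (upper_weight R i) (grid_point R k j) = j i / k"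
  by (simp add: peval_upper_weight coord_grid_point)

text \<open>
  Integration against the discrete measure that puts the mass \<open>L(bernstein_poly R k j)\<close> at the node with
  index \<open>j\<close>.
\<close>

definition bernstein_functional :: "real \<Rightarrow> ('n::finite expo \<Rightarrow> real) \<Rightarrow> nat \<Rightarrow> (real \<times> (real^'n) \<Rightarrow> real) \<Rightarrow> real" where
  "bernstein_functional R w k F = (\<Sum>j\<in>UNIV \<rightarrow>\<^sub>E {..k}. riesz w (bernstein_poly R k j) * F (grid_point R k j))"

text \<open>
  The factorial moments are exact, and passing to the power moments costs at most the total mass \<open>L(1)\<close>
  times a multiple of \<open>1 / k\<close>.
\<close>

lemma bernstein_functional_upper_weights_tendsto:
  fixes w :: "'n::finite expo \<Rightarrow> real"
  assumes R: "R > 0" and w: "psd_bounded R w"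
  shows "(\<lambda>k. bernstein_functional R w k (peval (\<Prod>i\<in>UNIV. upper_weight R i ^ a i)))
     \<longlonglongrightarrow> riesz w (\<Prod>i\<in>UNIV. upper_weight R i ^ a i)" (is "?E \<longlonglongrightarrow> ?L")
proof (rule LIM_zero_cancel, rule Lim_null_comparison)
  let ?J = "\<lambda>k. (UNIV :: 'n option set) \<rightarrow>\<^sub>E {..k}"
  let ?W = "\<lambda>k j. riesz w (bernstein_poly R k j)"
  define B where "B = riesz w 1 * (\<Sum>i\<in>UNIV. (real (a i))\<^sup>2)"
  have W: "0 \<le> ?W k j" for k j by (rule riesz_bernstein_poly_nonneg[OF R w])
  have total: "(\<Sum>j\<in>?J k. ?W k j) = riesz w 1" for k
    using factorial_moments_bernstein_weights[of "\<lambda>_. 0" k w R] by simp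
  have "norm (?E k - ?L) \<le> B * inverse (real k)" if k: "k \<ge> Max (range a)" "k > 0" for k
  proof -
    have ak: "a i \<le> k" for i using k(1) Max_ge[of "range a" "a i"] by (meson finite_class.finite_UNIV finite_imageI order_trans rangeI)
    let ?b = "\<lambda>j i. real (j i choose a i) / real (k choose a i)"
    let ?u = "\<lambda>j i. (real (j i) / real k) ^ a i"
    have L: "?L = (\<Sum>j\<in>?J k. ?W k j * (\<Prod>i\<in>UNIV. ?b j i))"
    proof -
      have "(\<Prod>i\<in>UNIV. real (k choose a i)) \<noteq> 0" using ak by (simp add: prod_zero_iff not_less)
      then have "?L = (\<Sum>j\<in>?J k. (\<Prod>i\<in>UNIV. real (j i choose a i)) * ?W k j) / (\<Prod>i\<in>UNIV. real (k choose a i))"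
        using factorial_moments_bernstein_weights[of a k w R] ak by simp
      then show ?thesis by (simp add: sum_divide_distrib prod_dividef mult.commute)
    qed
    have E: "?E k = (\<Sum>j\<in>?J k. ?W k j * (\<Prod>i\<in>UNIV. ?u j i))"
      using R by (simp add: bernstein_functional_def peval_prod peval_upper_weight_grid_point)
    have "\<bar>(\<Prod>i\<in>UNIV. ?u j i) - (\<Prod>i\<in>UNIV. ?b j i)\<bar> \<le> (\<Sum>i\<in>UNIV. (real (a i))\<^sup>2 / real k)" if j: "j \<in> ?J k" for j
    proof -
      have jk: "j i \<le> k" for i using j by auto
      have "\<bar>(\<Prod>i\<in>UNIV. ?u j i) - (\<Prod>i\<in>UNIV. ?b j i)\<bar> \<le> (\<Sum>i\<in>UNIV. \<bar>?u j i - ?b j i\<bar>)"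
        using norm_prod_diff[of UNIV "?u j" "?b j"] binomial_ratio_close[OF jk ak k(2)] jk k(2)
        by (simp add: power_le_one)
      also have "\<dots> \<le> (\<Sum>i\<in>UNIV. (real (a i))\<^sup>2 / real k)"
        using binomial_ratio_close[OF jk ak k(2)] by (intro sum_mono) (simp add: abs_minus_commute)
      finally show ?thesis .
    qed
    then have "norm (?W k j * ((\<Prod>i\<in>UNIV. ?u j i) - (\<Prod>i\<in>UNIV. ?b j i))) \<le> ?W k j * (\<Sum>i\<in>UNIV. (real (a i))\<^sup>2 / real k)" if "j \<in> ?J k" for j
      using that W by (simp add: abs_mult mult_left_mono)
    note termwise = this
    have "?E k - ?L = (\<Sum>j\<in>?J k. ?W k j * ((\<Prod>i\<in>UNIV. ?u j i) - (\<Prod>i\<in>UNIV. ?b j i)))"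
      unfolding E L right_diff_distrib by (rule sum_subtractf[symmetric])
    also have "norm \<dots> \<le> (\<Sum>j\<in>?J k. ?W k j * (\<Sum>i\<in>UNIV. (real (a i))\<^sup>2 / real k))"
      by (rule sum_norm_le) (rule termwise)
    also have "\<dots> = riesz w 1 * (\<Sum>i\<in>UNIV. (real (a i))\<^sup>2 / real k)"
      by (simp add: total flip: sum_distrib_right)
    also have "\<dots> = B * inverse (real k)"
      by (simp add: B_def divide_inverse sum_distrib_right)
    finally show ?thesis .
  qed
  then show "\<forall>\<^sub>F k in sequentially. norm (?E k - ?L) \<le> B * inverse (real k)"
    by (intro eventually_sequentiallyI[of "max 1 (Max (range a))"]) simp
  show "(\<lambda>k. B * inverse (real k)) \<longlonglongrightarrow> 0"
    using tendsto_mult_right_zero[OF lim_inverse_n, of B] .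
qed

lemma var_conv_upper_weight:
  "R > 0 \<Longrightarrow> var i = Poly_Mapping.single 0 (2 * R) * upper_weight R i - Poly_Mapping.single 0 R"
  by (simp add: upper_weight_def distrib_left mult_single flip: mult.assoc)

lemma bernstein_functional_add:
  "bernstein_functional R w k (peval (p + q)) = bernstein_functional R w k (peval p) + bernstein_functional R w k (peval q)"
  by (simp add: bernstein_functional_def distrib_left sum.distrib)

lemma bernstein_functional_scale:
  "bernstein_functional R w k (peval (Poly_Mapping.single 0 c * q)) = c * bernstein_functional R w k (peval q)"
  by (simp add: bernstein_functional_def sum_distrib_left mult_ac)

text \<open>
  Since \<open>x_i = 2 R U_i - R\<close> with \<open>U_i = upper_weight R i\<close>, convergence spreads from the products of the
  \<open>U_i\<close> to those products times a monomial, by induction on the monomial.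
\<close>

lemma bernstein_functional_tendsto:
  fixes w :: "'n::finite expo \<Rightarrow> real"
  assumes R: "R > 0" and w: "psd_bounded R w"
  shows "(\<lambda>k. bernstein_functional R w k (peval q)) \<longlonglongrightarrow> riesz w q"
proof -
  let ?conv = "\<lambda>q. (\<lambda>k. bernstein_functional R w k (peval q)) \<longlonglongrightarrow> riesz w q"
  have add: "?conv (p + q)" if "?conv p" "?conv q" for p q
    unfolding bernstein_functional_add riesz_add using that by (rule tendsto_add)
  have scale: "?conv (Poly_Mapping.single 0 c * q)" if "?conv q" for c q
    unfolding bernstein_functional_scale riesz_scale using that by (intro tendsto_intros)
  have "?conv ((\<Prod>i\<in>UNIV. upper_weight R i ^ a i) * monomial_poly \<beta>)" for a \<beta>
  proof (induction \<beta> arbitrary: a rule: expo_induct)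
    case zero
    show ?case using bernstein_functional_upper_weights_tendsto[OF R w] by simp
  next
    case (add_unit \<beta> i)
    let ?U = "\<lambda>a. (\<Prod>i\<in>UNIV. upper_weight R i ^ a i) * monomial_poly \<beta>"
    have "(\<Prod>l\<in>UNIV. upper_weight R l ^ (a(i := Suc (a i))) l)
        = upper_weight R i * (\<Prod>l\<in>UNIV. upper_weight R l ^ a l)"
      by (simp add: prod.remove[of UNIV i] mult.assoc)
    then have "(\<Prod>l\<in>UNIV. upper_weight R l ^ a l) * monomial_poly (\<beta> + unit_expo i)
       = Poly_Mapping.single 0 (2 * R) * ?U (a(i := Suc (a i))) + Poly_Mapping.single 0 (- R) * ?U a"
      unfolding monomial_poly_add var_def[symmetric] var_conv_upper_weight[OF R, of i]
      by (simp add: algebra_simps single_uminus)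
    then show ?case
      by (simp only:) (intro add scale add_unit)
  qed
  from this[of "\<lambda>_. 0"] have mono: "?conv (monomial_poly \<beta>)" for \<beta> by simp
  show ?thesis
  proof (induction q rule: rpoly_induct)
    case (single \<beta> c)
    show ?case unfolding single_conv_monomial_poly[of \<beta> c] by (intro scale mono)
  qed (rule add)
qed

definition sym_box :: "real \<Rightarrow> (real \<times> (real^'n::finite)) set" where
  "sym_box R = cbox (- R, \<chi> l. - R) (R, \<chi> l. R)"

lemma mem_sym_box: "p \<in> sym_box R \<longleftrightarrow> (\<forall>i. \<bar>coord i p\<bar> \<le> R)"
proof -
  have "p \<in> sym_box R \<longleftrightarrow> \<bar>fst p\<bar> \<le> R \<and> (\<forall>l. \<bar>snd p $ l\<bar> \<le> R)"
  proof -
    have "- R \<le> a \<and> a \<le> R \<longleftrightarrow> \<bar>a\<bar> \<le> R" for a by linarith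
    then show ?thesis
      unfolding sym_box_def by (cases p) (simp add: cbox_Pair_eq mem_box_cart)
  qed
  also have "\<dots> \<longleftrightarrow> (\<forall>i. \<bar>coord i p\<bar> \<le> R)"
    by (auto simp: coord_def split: option.splits)
  finally show ?thesis .
qed

lemma compact_sym_box: "compact (sym_box R)"
  by (simp add: sym_box_def compact_cbox)

lemma grid_point_in_sym_box:
  assumes "R > 0" "j \<in> UNIV \<rightarrow>\<^sub>E {..k}"
  shows "grid_point R k j \<in> sym_box R"
proof -
  have "\<bar>2 * R * (j i / k) - R\<bar> \<le> R" for i
  proof -
    have "j i \<le> k" using assms(2) by auto
    then have u: "0 \<le> real (j i) / k" "real (j i) / k \<le> 1" by (auto simp: divide_le_eq_1)
    have "R * (j i / k) \<le> R * 1" "0 \<le> R * (j i / k)"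
      using u assms(1) by (auto intro!: mult_left_mono simp del: times_divide_eq_right)
    then show ?thesis by (simp add: abs_le_iff)
  qed
  then show ?thesis by (simp add: mem_sym_box coord_grid_point)
qed

lemma borel_measurable_peval [measurable]: "peval q \<in> borel_measurable borel"
  by (intro borel_measurable_continuous_onI continuous_on_peval)

lemma continuous_bounded_on_compact:
  fixes F :: "'a::euclidean_space \<Rightarrow> real"
  assumes "continuous_on UNIV F" "compact S"
  obtains B where "B \<ge> 0" "\<And>x. x \<in> S \<Longrightarrow> \<bar>F x\<bar> \<le> B"
proof -
  have "bounded (F ` S)"
    using assms by (intro compact_imp_bounded compact_continuous_image) (auto intro: continuous_on_subset)
  then obtain B where "B > 0" "\<And>x. x \<in> S \<Longrightarrow> \<bar>F x\<bar> \<le> B"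
    unfolding bounded_pos by auto
  then show ?thesis using that[of B] by simp
qed

text \<open>
  The discrete measures of the Bernstein weights are lifted to the unit interval by choosing, for every
  node, a preimage under a Peano curve \<open>\<phi>\<close> of the box. On the line Helly's selection theorem provides a
  weakly convergent subsequence. A polynomial composed with \<open>\<phi>\<close> is bounded and continuous, so the image
  under \<open>\<phi>\<close> of the weak limit has the limits of the discrete moments, that is \<open>w\<close>, as its moments.
\<close>

theorem representing_measure_on_box:
  fixes w :: "'n::finite expo \<Rightarrow> real"
  assumes R: "R > 0" and w: "psd_bounded R w"
  obtains \<mu> where "finite_measure \<mu>" "sets \<mu> = sets borel" "AE p in \<mu>. p \<in> sym_box R"
    "\<And>q. riesz w q = (\<integral>p. peval q p \<partial>\<mu>)"
proof (cases "riesz w 1 = 0")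
  case True
  \<comment> \<open>Without mass the functional vanishes, by Cauchy-Schwarz against 1.\<close>
  have "riesz w q = 0" for q
    using riesz_Cauchy_Schwarz[of w q 1] True w by (simp add: psd_bounded_def)
  then show ?thesis
    by (intro that[of "null_measure borel"]) (auto intro!: finite_measureI AE_I'[of UNIV] simp: null_sets_def)
next
  case False
  define c where "c = riesz w 1"
  have "0 \<le> riesz w (1 * 1)" using w unfolding psd_bounded_def by blast
  with False have c: "c > 0" by (simp add: c_def)
  let ?J = "\<lambda>k::nat. (UNIV :: 'n option set) \<rightarrow>\<^sub>E {..k}"
  define W where "W k j = riesz w (bernstein_poly R k j) / c" for k j
  have W: "0 \<le> W k j" for k j
    using riesz_bernstein_poly_nonneg[OF R w] c by (simp add: W_def)
  have finJ: "finite (?J k)" for k by (intro finite_PiE) auto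
  have total: "(\<Sum>j\<in>?J k. W k j) = 1" for k
    using factorial_moments_bernstein_weights[of "\<lambda>_. 0" k w R] c
    by (simp add: W_def c_def flip: sum_divide_distrib)
  obtain \<phi> :: "real \<Rightarrow> real \<times> (real^'n)" where
    \<phi>: "continuous_on UNIV \<phi>" "range \<phi> \<subseteq> sym_box R" "sym_box R \<subseteq> \<phi> ` {0..1}"
  proof -
    have "(0 :: real \<times> (real^'n)) \<in> sym_box R" using R by (auto simp: mem_sym_box coord_def split: option.splits)
    then show ?thesis using Peano_curve that unfolding sym_box_def by blast
  qed
  define \<tau> where "\<tau> p = (SOME s. s \<in> {0..1} \<and> \<phi> s = p)" for p
  have \<tau>: "\<tau> p \<in> {0..1}" "\<phi> (\<tau> p) = p" if "p \<in> sym_box R" for p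
    using someI_ex[of "\<lambda>s. s \<in> {0..1} \<and> \<phi> s = p"] that \<phi>(3) unfolding \<tau>_def by blast+
  define P where "P k = point_measure (?J k) (\<lambda>j. ennreal (W k j))" for k
  define \<nu> where "\<nu> k = distr (P k) borel (\<lambda>j. \<tau> (grid_point R k j))" for k
  have space_P: "space (P k) = ?J k" for k by (simp add: P_def space_point_measure)
  have prob_P: "prob_space (P k)" for k
  proof
    show "emeasure (P k) (space (P k)) = 1"
      unfolding space_P unfolding P_def
      using W total[of k] finJ by (simp add: emeasure_point_measure_finite sum_ennreal)
  qed
  have meas: "(\<lambda>j. \<tau> (grid_point R k j)) \<in> measurable (P k) borel" for k
    unfolding P_def by simp
  have real_dist: "real_distribution (\<nu> k)" for k
    unfolding \<nu>_def by (intro prob_space.real_distribution_distr prob_P meas)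
  have "tight \<nu>"
    unfolding tight_def
  proof (intro conjI allI impI)
    fix \<epsilon> :: real assume \<epsilon>: "\<epsilon> > 0"
    have "measure (\<nu> k) {-1<..1} = 1" for k
    proof -
      have "measure (\<nu> k) {-1<..1} = measure (P k) ((\<lambda>j. \<tau> (grid_point R k j)) -` {-1<..1} \<inter> space (P k))"
        unfolding \<nu>_def by (intro measure_distr meas) simp
      also have "(\<lambda>j. \<tau> (grid_point R k j)) -` {-1<..1} \<inter> space (P k) = space (P k)"
      proof -
        have "\<tau> (grid_point R k j) \<in> {-1<..1}" if "j \<in> space (P k)" for j
          using \<tau>(1)[OF grid_point_in_sym_box[OF R that[unfolded space_P]]] by simp
        then show ?thesis by blast
      qed
      finally show ?thesis using prob_space.prob_space[OF prob_P] by simp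
    qed
    with \<epsilon> show "\<exists>a b. a < b \<and> (\<forall>n. 1 - \<epsilon> < measure (\<nu> n) {a<..b})"
      by (intro exI[of _ "-1"] exI[of _ 1]) simp
  qed (rule real_dist)
  from tight_imp_convergent_subsubsequence[OF this strict_mono_id]
  obtain r M where r: "strict_mono r" and M: "real_distribution M" and conv: "weak_conv_m (\<nu> \<circ> r) M"
    by auto
  interpret M: real_distribution M by fact
  have [measurable]: "\<phi> \<in> borel_measurable borel"
    by (intro borel_measurable_continuous_onI \<phi>)
  have int_\<nu>: "(\<integral>s. peval q (\<phi> s) \<partial>\<nu> k) = bernstein_functional R w k (peval q) / c" for q k
  proof -
    have "(\<integral>s. peval q (\<phi> s) \<partial>\<nu> k) = (\<integral>j. peval q (\<phi> (\<tau> (grid_point R k j))) \<partial>P k)"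
      unfolding \<nu>_def by (rule integral_distr[OF meas]) measurable
    also have "\<dots> = (\<Sum>j\<in>?J k. W k j * peval q (\<phi> (\<tau> (grid_point R k j))))"
      unfolding P_def using W finJ by (subst lebesgue_integral_point_measure_finite) auto
    also have "\<dots> = (\<Sum>j\<in>?J k. W k j * peval q (grid_point R k j))"
      by (intro sum.cong refl) (simp add: \<tau>(2)[OF grid_point_in_sym_box[OF R]])
    finally show ?thesis by (simp add: bernstein_functional_def W_def sum_divide_distrib)
  qed
  have riesz_M: "riesz w q / c = (\<integral>s. peval q (\<phi> s) \<partial>M)" for q
  proof (rule LIMSEQ_unique)
    show "(\<lambda>k. bernstein_functional R w (r k) (peval q) / c) \<longlonglongrightarrow> riesz w q / c"
      using LIMSEQ_subseq_LIMSEQ[OF bernstein_functional_tendsto[OF R w] r] c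
      by (intro tendsto_divide tendsto_const) (auto simp: o_def)
    obtain B where B: "\<And>p. p \<in> sym_box R \<Longrightarrow> \<bar>peval q p\<bar> \<le> B"
      using continuous_bounded_on_compact[OF continuous_on_peval[of UNIV q] compact_sym_box[of R]] by blast
    have "(\<lambda>k. \<integral>s. peval q (\<phi> s) \<partial>(\<nu> \<circ> r) k) \<longlonglongrightarrow> (\<integral>s. peval q (\<phi> s) \<partial>M)"
    proof (rule weak_conv_imp_integral_bdd_continuous_conv[OF _ M conv])
      show "norm (peval q (\<phi> s)) \<le> B" for s using B[OF range_subsetD[OF \<phi>(2)]] by simp
      have "continuous_on UNIV (\<lambda>s. peval q (\<phi> s))"
        by (rule continuous_on_compose2[OF continuous_on_peval[of UNIV] \<phi>(1)]) auto
      then show "isCont (\<lambda>s. peval q (\<phi> s)) s" for s by (simp add: continuous_on_eq_continuous_at)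
    qed (simp add: real_dist)
    then show "(\<lambda>k. bernstein_functional R w (r k) (peval q) / c) \<longlonglongrightarrow> (\<integral>s. peval q (\<phi> s) \<partial>M)"
      by (simp add: int_\<nu>)
  qed
  define \<mu> where "\<mu> = density (distr M borel \<phi>) (\<lambda>_. ennreal c)"
  show ?thesis
  proof (rule that[of \<mu>])
    show "sets \<mu> = sets borel" by (simp add: \<mu>_def)
    show "finite_measure \<mu>"
      by (rule finite_measureI)
         (simp add: \<mu>_def emeasure_density_const emeasure_distr M.emeasure_space_1 ennreal_mult_eq_top_iff)
    show "AE p in \<mu>. p \<in> sym_box R"
    proof -
      have "AE p in distr M borel \<phi>. p \<in> sym_box R"
        using \<phi>(2) by (subst AE_distr_iff) (auto simp: sym_box_def)
      then show ?thesis unfolding \<mu>_def by (subst AE_density) auto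
    qed
    fix q
    have "(\<integral>p. peval q p \<partial>\<mu>) = (\<integral>p. c *\<^sub>R peval q p \<partial>distr M borel \<phi>)"
      unfolding \<mu>_def using c by (subst integral_density) auto
    also have "\<dots> = c * (\<integral>s. peval q (\<phi> s) \<partial>M)"
      by (subst integral_distr) auto
    finally show "riesz w q = (\<integral>p. peval q p \<partial>\<mu>)"
      using riesz_M[of q] c by (simp add: field_simps)
  qed
qed

section \<open>Bernstein sums with a parameter\<close>

text \<open>
  Bernstein's proof of the Weierstrass theorem, run with a bound and a modulus of continuity that the
  whole family shares: the degree that it yields does not depend on the parameter \<open>x\<close>.
\<close>

lemma Bernstein_approximation_uniform:
  fixes F :: "'x \<Rightarrow> real \<Rightarrow> real"
  assumes bdd: "\<And>x t. x \<in> X \<Longrightarrow> t \<in> {0..1} \<Longrightarrow> \<bar>F x t\<bar> \<le> M"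
    and equi: "\<And>\<epsilon>. \<epsilon> > 0 \<Longrightarrow> \<exists>\<delta>>0. \<forall>x\<in>X. \<forall>s\<in>{0..1}. \<forall>t\<in>{0..1}. \<bar>s - t\<bar> < \<delta> \<longrightarrow> \<bar>F x s - F x t\<bar> < \<epsilon>"
    and \<epsilon>: "\<epsilon> > 0"
  shows "\<exists>N. \<forall>k\<ge>N. \<forall>x\<in>X. \<forall>u\<in>{0..1}. \<bar>(\<Sum>j\<le>k. F x (j / k) * Bernstein k j u) - F x u\<bar> \<le> \<epsilon>"
proof -
  define M' where "M' = max M 0"
  have M': "M' \<ge> 0" "\<And>x t. x \<in> X \<Longrightarrow> t \<in> {0..1} \<Longrightarrow> \<bar>F x t\<bar> \<le> M'"
    using bdd by (auto simp: M'_def le_max_iff_disj)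
  obtain \<delta> where \<delta>: "\<delta> > 0" "\<And>x s t. x \<in> X \<Longrightarrow> s \<in> {0..1} \<Longrightarrow> t \<in> {0..1} \<Longrightarrow> \<bar>s - t\<bar> < \<delta> \<Longrightarrow> \<bar>F x s - F x t\<bar> < \<epsilon> / 2"
    using equi[of "\<epsilon> / 2"] \<epsilon> by (meson half_gt_zero)
  define c where "c = 2 * M' / \<delta>\<^sup>2"
  have c: "c \<ge> 0" using M' by (simp add: c_def)
  obtain N :: nat where N: "2 * c / \<epsilon> < N" using reals_Archimedean2 by blast
  show ?thesis
  proof (intro exI[of _ "Suc N"] allI impI ballI)
    fix k x and u :: real assume k: "k \<ge> Suc N" and x: "x \<in> X" and u: "u \<in> {0..1}"
    have k0: "real k > 0" using k by simp
    have variance: "(\<Sum>j\<le>k. (j / k - u)\<^sup>2 * Bernstein k j u) = u * (1 - u) / k"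
    proof -
      have *: "(a - b)\<^sup>2 * x = a * (a - 1) * x + (1 - 2 * b) * (a * x) + b\<^sup>2 * x" for a b x :: real
        by (simp add: algebra_simps power2_eq_square)
      have "(\<Sum>j\<le>k. (real j - k * u)\<^sup>2 * Bernstein k j u)
          = (\<Sum>j\<le>k. real j * (real j - 1) * Bernstein k j u) + (1 - 2 * (k * u)) * (\<Sum>j\<le>k. real j * Bernstein k j u)
            + (k * u)\<^sup>2 * (\<Sum>j\<le>k. Bernstein k j u)"
        by (simp only: * sum.distrib sum_distrib_left)
      also have "\<dots> = k * u * (1 - u)"
        by simp (simp add: algebra_simps power2_eq_square)
      finally have "(\<Sum>j\<le>k. (real j - k * u)\<^sup>2 * Bernstein k j u) / k\<^sup>2 = u * (1 - u) / k"
        using k0 by (simp add: power2_eq_square)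
      moreover have "(j / k - u)\<^sup>2 = (real j - k * u)\<^sup>2 / k\<^sup>2" for j
        using k0 by (simp add: field_simps flip: power_divide)
      ultimately show ?thesis by (simp add: sum_divide_distrib)
    qed
    have B: "0 \<le> Bernstein k j u" for j using u by (simp add: Bernstein_nonneg)
    have pointwise: "\<bar>F x (j / k) - F x u\<bar> \<le> \<epsilon> / 2 + c * (j / k - u)\<^sup>2" if j: "j \<le> k" for j
    proof (cases "\<bar>j / k - u\<bar> < \<delta>")
      case True
      have "\<bar>F x (j / k) - F x u\<bar> \<le> \<epsilon> / 2"
        using \<delta>(2)[OF x _ u True] j k0 by auto
      then show ?thesis using c by (smt (verit) mult_nonneg_nonneg zero_le_power2)
    next
      case False
      then have "\<delta>\<^sup>2 \<le> (j / k - u)\<^sup>2"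
        using \<delta>(1) by (metis less_eq_real_def not_le power2_abs power_mono)
      then have "c * \<delta>\<^sup>2 \<le> c * (j / k - u)\<^sup>2" using c by (rule mult_left_mono)
      moreover have "c * \<delta>\<^sup>2 = 2 * M'" using \<delta>(1) by (simp add: c_def)
      moreover have "\<bar>F x (j / k)\<bar> \<le> M'" "\<bar>F x u\<bar> \<le> M'" using M' x u j k0 by auto
      ultimately show ?thesis using \<epsilon> by linarith
    qed
    have "(\<Sum>j\<le>k. F x (j / k) * Bernstein k j u) - F x u = (\<Sum>j\<le>k. (F x (j / k) - F x u) * Bernstein k j u)"
      by (simp add: left_diff_distrib sum_subtractf flip: sum_distrib_left)
    also have "\<bar>\<dots>\<bar> \<le> (\<Sum>j\<le>k. (\<epsilon> / 2 + c * (j / k - u)\<^sup>2) * Bernstein k j u)"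
      using pointwise B by (intro order.trans[OF sum_abs] sum_mono) (auto simp: abs_mult intro: mult_right_mono)
    also have "\<dots> = \<epsilon> / 2 + c * (u * (1 - u) / k)"
      by (simp only: distrib_right sum.distrib mult.assoc variance sum_distrib_left[symmetric]) simp
    also have "\<dots> \<le> \<epsilon> / 2 + c * (1 / k)"
      using u c k0 by (intro add_left_mono mult_left_mono divide_right_mono) (auto intro: mult_le_one)
    also have "\<dots> \<le> \<epsilon>"
    proof -
      have "2 * c / \<epsilon> < k" using N k by linarith
      then show ?thesis using \<epsilon> k0 by (simp add: field_simps)
    qed
    finally show "\<bar>(\<Sum>j\<le>k. F x (j / k) * Bernstein k j u) - F x u\<bar> \<le> \<epsilon>" .
  qed
qed

text \<open>
  The exponents \<open>j - 1\<close> and \<open>k - j - 1\<close> are truncated only where the factor in front of them is 0.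
\<close>

definition Bernstein_deriv :: "nat \<Rightarrow> nat \<Rightarrow> real \<Rightarrow> real" where
  "Bernstein_deriv k j u = (k choose j) * (real j * u ^ (j - 1) * (1 - u) ^ (k - j) - u ^ j * (real (k - j) * (1 - u) ^ (k - j - 1)))"

lemma has_field_derivative_Bernstein:
  "(Bernstein k j has_field_derivative Bernstein_deriv k j u) (at u)"
  unfolding Bernstein_def Bernstein_deriv_def
  by (auto intro!: derivative_eq_intros simp: algebra_simps)

text \<open>
  Summation by parts: the derivative of a Bernstein sum is a Bernstein sum of one degree less over the
  forward differences.
\<close>

lemma sum_Bernstein_deriv:
  "(\<Sum>j\<le>Suc n. c j * Bernstein_deriv (Suc n) j u) = (\<Sum>j\<le>n. real (Suc n) * (c (Suc j) - c j) * Bernstein n j u)"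
proof -
  have 1: "real (Suc n choose Suc j) * real (Suc j) = real (Suc n) * real (n choose j)" for j
    by (metis binomial_absorption diff_Suc_1 mult.commute of_nat_mult)
  have 2: "real (Suc n choose j) * real (Suc n - j) = real (Suc n) * real (n choose j)" for j
    by (metis binomial_absorb_comp diff_Suc_1 mult.commute of_nat_mult)
  have "(\<Sum>j\<le>Suc n. c j * Bernstein_deriv (Suc n) j u)
     = (\<Sum>j\<le>Suc n. c j * (real (Suc n choose j) * real j) * u ^ (j - 1) * (1 - u) ^ (Suc n - j))
     - (\<Sum>j\<le>Suc n. c j * (real (Suc n choose j) * real (Suc n - j)) * u ^ j * (1 - u) ^ (Suc n - j - 1))"
    by (simp only: Bernstein_deriv_def sum_subtractf[symmetric]) (intro sum.cong refl, simp add: algebra_simps)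
  also have "(\<Sum>j\<le>Suc n. c j * (real (Suc n choose j) * real j) * u ^ (j - 1) * (1 - u) ^ (Suc n - j))
     = (\<Sum>j\<le>n. real (Suc n) * c (Suc j) * Bernstein n j u)"
    by (subst sum.atMost_Suc_shift) (simp only: 1 Bernstein_def diff_Suc_1 diff_Suc_Suc, simp add: algebra_simps)
  also have "(\<Sum>j\<le>Suc n. c j * (real (Suc n choose j) * real (Suc n - j)) * u ^ j * (1 - u) ^ (Suc n - j - 1))
     = (\<Sum>j\<le>n. real (Suc n) * c j * Bernstein n j u)"
    unfolding 2 by (simp add: Bernstein_def mult_ac)
  finally show ?thesis
    by (simp add: algebra_simps flip: sum_subtractf)
qed

section \<open>Continuously differentiable functions and their distance\<close>

text \<open>
  The notion \<^const>\<open>C1_fun\<close>, over an arbitrary Euclidean space.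
\<close>

definition C1_real :: "('a::euclidean_space \<Rightarrow> real) \<Rightarrow> bool" where
  "C1_real v \<longleftrightarrow> v differentiable_on UNIV \<and> (\<forall>h. continuous_on UNIV (\<lambda>p. frechet_derivative v (at p) h))"

lemma C1_real_has_derivative:
  "C1_real v \<Longrightarrow> (v has_derivative frechet_derivative v (at x)) (at x)"
  by (simp add: C1_real_def differentiable_on_def frechet_derivative_works)

lemma C1_realI:
  assumes "\<And>x. (v has_derivative v' x) (at x)" "\<And>h. continuous_on UNIV (\<lambda>x. v' x h)"
  shows "C1_real v"
proof -
  have "frechet_derivative v (at x) = v' x" for x
    using frechet_derivative_at[OF assms(1)] by simp
  then show ?thesis
    using assms by (auto simp: C1_real_def differentiable_on_def differentiable_def)
qed

definition C1_close :: "'a::euclidean_space set \<Rightarrow> real \<Rightarrow> ('a \<Rightarrow> real) \<Rightarrow> ('a \<Rightarrow> real) \<Rightarrow> bool" where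
  "C1_close S \<epsilon> v w \<longleftrightarrow> (\<forall>x\<in>S. \<bar>v x - w x\<bar> \<le> \<epsilon>
      \<and> (\<forall>b\<in>Basis. \<bar>frechet_derivative v (at x) b - frechet_derivative w (at x) b\<bar> \<le> \<epsilon>))"

lemma C1_real_imp_continuous: "C1_real v \<Longrightarrow> continuous_on UNIV v"
  by (simp add: C1_real_def differentiable_imp_continuous_on)

lemma C1_real_polynomial:
  fixes p :: "'a::euclidean_space \<Rightarrow> real"
  assumes "real_polynomial_function p"
  shows "C1_real p"
proof -
  have "\<exists>p'. (\<forall>x. (p has_derivative p' x) (at x)) \<and> (\<forall>h. continuous_on UNIV (\<lambda>x. p' x h))"
    using assms
  proof (induction p rule: real_polynomial_function.induct)
    case (linear f)
    then show ?case
      by (intro exI[of _ "\<lambda>_. f"]) (auto simp: bounded_linear_imp_has_derivative)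
  next
    case (const c)
    show ?case by (intro exI[of _ "\<lambda>_ _. 0"]) auto
  next
    case (add f g)
    then obtain f' g' where "\<And>x. (f has_derivative f' x) (at x)" "\<And>h. continuous_on UNIV (\<lambda>x. f' x h)"
      "\<And>x. (g has_derivative g' x) (at x)" "\<And>h. continuous_on UNIV (\<lambda>x. g' x h)" by blast
    then show ?case
      by (intro exI[of _ "\<lambda>x h. f' x h + g' x h"]) (auto intro!: derivative_intros continuous_intros)
  next
    case (mult f g)
    then obtain f' g' where fg: "\<And>x. (f has_derivative f' x) (at x)" "\<And>h. continuous_on UNIV (\<lambda>x. f' x h)"
      "\<And>x. (g has_derivative g' x) (at x)" "\<And>h. continuous_on UNIV (\<lambda>x. g' x h)" by blast
    have cont: "continuous_on UNIV f" "continuous_on UNIV g"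
      by (rule has_derivative_continuous_on, rule has_derivative_at_withinI, rule fg)+
    show ?case
      by (intro exI[of _ "\<lambda>x h. f x * g' x h + f' x h * g x"] conjI allI has_derivative_mult fg
         continuous_on_add continuous_on_mult cont)
  qed
  then show ?thesis using C1_realI by blast
qed

lemma frechet_derivative_eqI: "(v has_derivative v') (at x) \<Longrightarrow> frechet_derivative v (at x) = v'"
  using frechet_derivative_at by metis

lemma C1_real_mult:
  assumes "C1_real v" "C1_real w"
  shows "C1_real (\<lambda>x. v x * w x)"
    and "frechet_derivative (\<lambda>x. v x * w x) (at x) h
       = v x * frechet_derivative w (at x) h + frechet_derivative v (at x) h * w x"
proof -
  have d: "((\<lambda>x. v x * w x) has_derivative (\<lambda>h. v x * frechet_derivative w (at x) h + frechet_derivative v (at x) h * w x)) (at x)" for x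
    by (intro has_derivative_mult C1_real_has_derivative assms)
  show "C1_real (\<lambda>x. v x * w x)"
  proof (rule C1_realI[OF d])
    show "continuous_on UNIV (\<lambda>x. v x * frechet_derivative w (at x) h + frechet_derivative v (at x) h * w x)" for h
      using assms C1_real_imp_continuous[OF assms(1)] C1_real_imp_continuous[OF assms(2)]
      unfolding C1_real_def by (intro continuous_on_add continuous_on_mult) blast+
  qed
  show "frechet_derivative (\<lambda>x. v x * w x) (at x) h
       = v x * frechet_derivative w (at x) h + frechet_derivative v (at x) h * w x"
    by (simp add: frechet_derivative_eqI[OF d])
qed

lemma C1_real_sum:
  assumes "finite J" "\<And>j. j \<in> J \<Longrightarrow> C1_real (v j)"
  shows "C1_real (\<lambda>x. \<Sum>j\<in>J. v j x)"
    and "frechet_derivative (\<lambda>x. \<Sum>j\<in>J. v j x) (at x) h = (\<Sum>j\<in>J. frechet_derivative (v j) (at x) h)"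
proof -
  have d: "((\<lambda>x. \<Sum>j\<in>J. v j x) has_derivative (\<lambda>h. \<Sum>j\<in>J. frechet_derivative (v j) (at x) h)) (at x)" for x
    by (intro has_derivative_sum C1_real_has_derivative assms)
  show "C1_real (\<lambda>x. \<Sum>j\<in>J. v j x)"
  proof (rule C1_realI[OF d])
    show "continuous_on UNIV (\<lambda>x. \<Sum>j\<in>J. frechet_derivative (v j) (at x) h)" for h
      using assms unfolding C1_real_def by (intro continuous_on_sum) blast
  qed
  show "frechet_derivative (\<lambda>x. \<Sum>j\<in>J. v j x) (at x) h = (\<Sum>j\<in>J. frechet_derivative (v j) (at x) h)"
    by (simp add: frechet_derivative_eqI[OF d])
qed

lemma C1_close_sum:
  fixes \<epsilon> :: real
  assumes "finite J" "\<And>j. j \<in> J \<Longrightarrow> C1_real (v j)" "\<And>j. j \<in> J \<Longrightarrow> C1_real (w j)"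
    and close: "\<And>j. j \<in> J \<Longrightarrow> C1_close S \<epsilon> (v j) (w j)"
  shows "C1_close S (card J * \<epsilon>) (\<lambda>x. \<Sum>j\<in>J. v j x) (\<lambda>x. \<Sum>j\<in>J. w j x)"
proof -
  have est: "\<bar>(\<Sum>j\<in>J. a j) - (\<Sum>j\<in>J. b j)\<bar> \<le> card J * \<epsilon>" if "\<And>j. j \<in> J \<Longrightarrow> \<bar>a j - b j\<bar> \<le> \<epsilon>" for a b :: "_ \<Rightarrow> real"
    using sum_norm_bound[of J "\<lambda>j. a j - b j" \<epsilon>] that by (simp add: sum_subtractf)
  have "frechet_derivative (\<lambda>x. \<Sum>j\<in>J. v j x) (at x) b = (\<Sum>j\<in>J. frechet_derivative (v j) (at x) b)"
    "frechet_derivative (\<lambda>x. \<Sum>j\<in>J. w j x) (at x) b = (\<Sum>j\<in>J. frechet_derivative (w j) (at x) b)" for x b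
    by (rule C1_real_sum(2)[OF assms(1)]; fact)+
  moreover have "\<bar>v j x - w j x\<bar> \<le> \<epsilon>"
    "b \<in> Basis \<Longrightarrow> \<bar>frechet_derivative (v j) (at x) b - frechet_derivative (w j) (at x) b\<bar> \<le> \<epsilon>"
    if "j \<in> J" "x \<in> S" for j x b
    using close[OF that(1)] that(2) unfolding C1_close_def by blast+
  ultimately show ?thesis
    unfolding C1_close_def by (simp add: est)
qed

lemma C1_close_trans:
  assumes "C1_close S \<epsilon> u v" "C1_close S \<epsilon>' v w"
  shows "C1_close S (\<epsilon> + \<epsilon>') u w"
  unfolding C1_close_def
proof (intro ballI conjI)
  fix x assume x: "x \<in> S"
  have "\<bar>u x - v x\<bar> \<le> \<epsilon>" "\<bar>v x - w x\<bar> \<le> \<epsilon>'"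
    using assms x by (simp_all add: C1_close_def)
  then show "\<bar>u x - w x\<bar> \<le> \<epsilon> + \<epsilon>'" by linarith
  fix b :: 'a assume b: "b \<in> Basis"
  have "\<bar>frechet_derivative u (at x) b - frechet_derivative v (at x) b\<bar> \<le> \<epsilon>"
    "\<bar>frechet_derivative v (at x) b - frechet_derivative w (at x) b\<bar> \<le> \<epsilon>'"
    using assms x b unfolding C1_close_def by blast+
  then show "\<bar>frechet_derivative u (at x) b - frechet_derivative w (at x) b\<bar> \<le> \<epsilon> + \<epsilon>'" by linarith
qed

text \<open>
  The constant depends on \<open>r\<close> and \<open>S\<close> only, so that it can be fixed before the approximation \<open>w\<close> of \<open>v\<close>
  is chosen.
\<close>

lemma C1_close_mult:
  assumes r: "C1_real r" and S: "compact S"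
  obtains B where "B \<ge> 0"
    "\<And>v w \<epsilon>. C1_real v \<Longrightarrow> C1_real w \<Longrightarrow> C1_close S \<epsilon> v w \<Longrightarrow> \<epsilon> \<ge> 0 \<Longrightarrow> C1_close S (B * \<epsilon>) (\<lambda>x. v x * r x) (\<lambda>x. w x * r x)"
proof -
  obtain B0 where B0: "B0 \<ge> 0" "\<And>x. x \<in> S \<Longrightarrow> \<bar>r x\<bar> \<le> B0"
    using continuous_bounded_on_compact[OF C1_real_imp_continuous[OF r] S] by blast
  have "\<exists>B. B \<ge> 0 \<and> (\<forall>x\<in>S. \<bar>frechet_derivative r (at x) b\<bar> \<le> B)" for b
    using continuous_bounded_on_compact[OF _ S, of "\<lambda>x. frechet_derivative r (at x) b"] r
    unfolding C1_real_def by metis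
  then obtain D where D: "\<And>b. D b \<ge> 0" "\<And>b x. x \<in> S \<Longrightarrow> \<bar>frechet_derivative r (at x) b\<bar> \<le> D b"
    by metis
  define B where "B = B0 + (\<Sum>b\<in>Basis. D b)"
  have DB: "D b \<le> (\<Sum>b\<in>Basis. D b)" if "b \<in> Basis" for b
    using that D by (intro member_le_sum) auto
  have sumD: "(\<Sum>b\<in>Basis. D b) \<ge> 0" using D by (intro sum_nonneg) auto
  show ?thesis
  proof
    show "B \<ge> 0" using B0 sumD by (simp add: B_def)
    fix v w :: "'a \<Rightarrow> real" and \<epsilon> :: real
    assume vw: "C1_real v" "C1_real w" and cl: "C1_close S \<epsilon> v w" and \<epsilon>: "\<epsilon> \<ge> 0"
    show "C1_close S (B * \<epsilon>) (\<lambda>x. v x * r x) (\<lambda>x. w x * r x)"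
      unfolding C1_close_def C1_real_mult(2)[OF vw(1) r] C1_real_mult(2)[OF vw(2) r]
    proof (intro ballI conjI)
      fix x assume x: "x \<in> S"
      have v: "\<bar>v x - w x\<bar> \<le> \<epsilon>" using cl x by (simp add: C1_close_def)
      have "\<bar>v x - w x\<bar> * \<bar>r x\<bar> \<le> \<epsilon> * B0"
        using v B0(2)[OF x] \<epsilon> by (intro mult_mono) auto
      also have "\<dots> \<le> B * \<epsilon>" using sumD \<epsilon> by (simp add: B_def algebra_simps)
      finally show "\<bar>v x * r x - w x * r x\<bar> \<le> B * \<epsilon>"
        by (simp only: left_diff_distrib[symmetric] abs_mult)
      fix b :: 'a assume b: "b \<in> Basis"
      let ?d = "\<lambda>f. frechet_derivative f (at x) b"
      have "\<bar>?d v - ?d w\<bar> \<le> \<epsilon>" using cl x b by (simp add: C1_close_def)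
      then have "\<bar>?d v - ?d w\<bar> * \<bar>r x\<bar> \<le> \<epsilon> * B0"
        using B0(2)[OF x] \<epsilon> by (intro mult_mono) auto
      moreover have "\<bar>v x - w x\<bar> * \<bar>?d r\<bar> \<le> \<epsilon> * (\<Sum>b\<in>Basis. D b)"
        using v D(2)[OF x, of b] DB[OF b] \<epsilon> by (intro mult_mono) auto
      moreover have "\<bar>(v x * ?d r + ?d v * r x) - (w x * ?d r + ?d w * r x)\<bar>
         \<le> \<bar>v x - w x\<bar> * \<bar>?d r\<bar> + \<bar>?d v - ?d w\<bar> * \<bar>r x\<bar>"
      proof -
        have "(v x * ?d r + ?d v * r x) - (w x * ?d r + ?d w * r x) = (v x - w x) * ?d r + (?d v - ?d w) * r x"
          by (simp add: algebra_simps)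
        then show ?thesis
          using abs_triangle_ineq[of "(v x - w x) * ?d r" "(?d v - ?d w) * r x"] by (simp only: abs_mult)
      qed
      moreover have "B * \<epsilon> = \<epsilon> * (\<Sum>b\<in>Basis. D b) + \<epsilon> * B0"
        unfolding B_def by (simp only: algebra_simps)
      ultimately show "\<bar>(v x * ?d r + ?d v * r x) - (w x * ?d r + ?d w * r x)\<bar> \<le> B * \<epsilon>"
        by linarith
    qed
  qed
qed

section \<open>Density of polynomials among continuously differentiable functions\<close>

text \<open>
  The point \<open>x\<close> with its coordinate along the basis vector \<open>i\<close> replaced by \<open>t\<close>.
\<close>

definition slice :: "'a::euclidean_space \<Rightarrow> real \<Rightarrow> 'a \<Rightarrow> 'a" where
  "slice i t x = x + (t - x \<bullet> i) *\<^sub>R i"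

lemma slice_self [simp]: "slice i (x \<bullet> i) x = x"
  by (simp add: slice_def)

lemma inner_slice: "i \<in> Basis \<Longrightarrow> b \<in> Basis \<Longrightarrow> slice i t x \<bullet> b = (if b = i then t else x \<bullet> b)"
  by (auto simp: slice_def inner_add_left inner_Basis)

lemma slice_in_unit_cube:
  "i \<in> Basis \<Longrightarrow> x \<in> cbox 0 One \<Longrightarrow> t \<in> {0..1} \<Longrightarrow> slice i t x \<in> cbox 0 One"
  by (auto simp: mem_box inner_slice)

lemma dist_slice: "i \<in> Basis \<Longrightarrow> dist (slice i s x) (slice i t x) = \<bar>s - t\<bar>"
  by (simp add: slice_def dist_norm flip: scaleR_diff_left)

lemma C1_real_slice:
  assumes "C1_real v"
  shows "C1_real (\<lambda>x. v (slice i t x))"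
    and "frechet_derivative (\<lambda>x. v (slice i t x)) (at x) h = frechet_derivative v (at (slice i t x)) (h - (h \<bullet> i) *\<^sub>R i)"
proof -
  have s: "(slice i t has_derivative (\<lambda>h. h - (h \<bullet> i) *\<^sub>R i)) (at x)" for x
    unfolding slice_def by (auto intro!: derivative_eq_intros)
  have d: "((\<lambda>x. v (slice i t x)) has_derivative (\<lambda>h. frechet_derivative v (at (slice i t x)) (h - (h \<bullet> i) *\<^sub>R i))) (at x)" for x
    by (rule has_derivative_compose[OF s C1_real_has_derivative[OF assms]])
  have cs: "continuous_on UNIV (slice i t)"
    unfolding slice_def by (intro continuous_intros)
  show "C1_real (\<lambda>x. v (slice i t x))"
  proof (rule C1_realI[OF d])
    show "continuous_on UNIV (\<lambda>x. frechet_derivative v (at (slice i t x)) (h - (h \<bullet> i) *\<^sub>R i))" for h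
      using continuous_on_compose2[OF _ cs, of UNIV "\<lambda>p. frechet_derivative v (at p) (h - (h \<bullet> i) *\<^sub>R i)"] assms
      by (simp add: C1_real_def)
  qed
  show "frechet_derivative (\<lambda>x. v (slice i t x)) (at x) h = frechet_derivative v (at (slice i t x)) (h - (h \<bullet> i) *\<^sub>R i)"
    by (simp add: frechet_derivative_eqI[OF d])
qed

lemma real_polynomial_function_Bernstein:
  fixes i :: "'a::euclidean_space"
  shows "real_polynomial_function (\<lambda>x. Bernstein k j (x \<bullet> i))"
  unfolding Bernstein_def
  by (intro real_polynomial_function.intros(4) real_polynomial_function.intros(2) real_polynomial_function_power
      real_polynomial_function_diff real_polynomial_function.intros(1) bounded_linear_inner_left)

lemma frechet_derivative_Bernstein:
  "frechet_derivative (\<lambda>x. Bernstein k j (x \<bullet> i)) (at x) h = Bernstein_deriv k j (x \<bullet> i) * (h \<bullet> i)"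
proof -
  have "((\<lambda>x. Bernstein k j (x \<bullet> i)) has_derivative (\<lambda>h. Bernstein_deriv k j (x \<bullet> i) * (h \<bullet> i))) (at x)"
    using has_derivative_compose[OF bounded_linear_imp_has_derivative[OF bounded_linear_inner_left[of i], of "at x"]
        has_field_derivative_Bernstein[unfolded has_field_derivative_def, of k j "x \<bullet> i"]] by simp
  from frechet_derivative_eqI[OF this] show ?thesis by simp
qed

text \<open>
  The Bernstein operator in the coordinate along \<open>i\<close>, with the other coordinates as parameters.
\<close>

definition Bernstein_slice :: "'a::euclidean_space \<Rightarrow> nat \<Rightarrow> ('a \<Rightarrow> real) \<Rightarrow> 'a \<Rightarrow> real" where
  "Bernstein_slice i k v x = (\<Sum>j\<le>k. v (slice i (j / k) x) * Bernstein k j (x \<bullet> i))"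

text \<open>
  Derivatives in the other basis directions commute with the operator; the derivative along \<open>i\<close> falls on
  the Bernstein polynomials.
\<close>

lemma C1_real_Bernstein_slice:
  fixes i :: "'a::euclidean_space"
  assumes v: "C1_real v" and i: "i \<in> Basis"
  shows "C1_real (Bernstein_slice i k v)"
    and "b \<in> Basis \<Longrightarrow> b \<noteq> i \<Longrightarrow>
      frechet_derivative (Bernstein_slice i k v) (at x) b
        = Bernstein_slice i k (\<lambda>x. frechet_derivative v (at x) b) x"
    and "frechet_derivative (Bernstein_slice i k v) (at x) i
        = (\<Sum>j\<le>k. v (slice i (j / k) x) * Bernstein_deriv k j (x \<bullet> i))"
proof -
  have c: "C1_real (\<lambda>x. v (slice i (j / k) x) * Bernstein k j (x \<bullet> i))" for j
    by (intro C1_real_mult C1_real_slice v C1_real_polynomial real_polynomial_function_Bernstein)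
  have eq: "Bernstein_slice i k v = (\<lambda>x. \<Sum>j\<le>k. v (slice i (j / k) x) * Bernstein k j (x \<bullet> i))"
    by (rule ext) (simp add: Bernstein_slice_def)
  show "C1_real (Bernstein_slice i k v)"
    unfolding eq by (intro C1_real_sum c) simp
  have D: "frechet_derivative (Bernstein_slice i k v) (at x) h
    = (\<Sum>j\<le>k. v (slice i (j / k) x) * (Bernstein_deriv k j (x \<bullet> i) * (h \<bullet> i))
        + frechet_derivative v (at (slice i (j / k) x)) (h - (h \<bullet> i) *\<^sub>R i) * Bernstein k j (x \<bullet> i))" for h
    unfolding eq
    by (subst C1_real_sum(2)[OF _ c], simp,
        subst C1_real_mult(2)[OF C1_real_slice(1)[OF v] C1_real_polynomial[OF real_polynomial_function_Bernstein]])
       (simp add: C1_real_slice(2)[OF v] frechet_derivative_Bernstein)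
  show "frechet_derivative (Bernstein_slice i k v) (at x) b
        = Bernstein_slice i k (\<lambda>x. frechet_derivative v (at x) b) x" if "b \<in> Basis" "b \<noteq> i"
    using that i by (simp add: D Bernstein_slice_def inner_Basis)
  have "frechet_derivative v (at y) 0 = 0" for y
    using has_derivative_bounded_linear[OF C1_real_has_derivative[OF v]] linear_0 bounded_linear.linear by blast
  then show "frechet_derivative (Bernstein_slice i k v) (at x) i
        = (\<Sum>j\<le>k. v (slice i (j / k) x) * Bernstein_deriv k j (x \<bullet> i))"
    using i by (simp add: D)
qed

lemma slice_equicontinuous:
  fixes G :: "'a::euclidean_space \<Rightarrow> real"
  assumes G: "continuous_on UNIV G" and i: "i \<in> Basis" and "\<epsilon> > 0"
  shows "\<exists>\<delta>>0. \<forall>x\<in>cbox 0 One. \<forall>s\<in>{0..1}. \<forall>t\<in>{0..1}. \<bar>s - t\<bar> < \<delta> \<longrightarrow> \<bar>G (slice i s x) - G (slice i t x)\<bar> < \<epsilon>"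
proof -
  have "uniformly_continuous_on (cbox 0 One) G"
    by (rule compact_uniformly_continuous[OF continuous_on_subset[OF G] compact_cbox]) simp
  then obtain \<delta> where "\<delta> > 0" "\<And>y z. y \<in> cbox 0 One \<Longrightarrow> z \<in> cbox 0 One \<Longrightarrow> dist z y < \<delta> \<Longrightarrow> dist (G z) (G y) < \<epsilon>"
    using \<open>\<epsilon> > 0\<close> by (rule uniformly_continuous_onE) blast
  then show ?thesis
    by (intro exI[of _ \<delta>]) (simp add: slice_in_unit_cube[OF i] dist_slice[OF i] flip: dist_real_def)
qed

lemma Bernstein_slice_approximation:
  fixes G :: "'a::euclidean_space \<Rightarrow> real"
  assumes G: "continuous_on UNIV G" and i: "i \<in> Basis" and "\<epsilon> > 0"
  shows "\<exists>N. \<forall>k\<ge>N. \<forall>x\<in>cbox 0 One. \<bar>Bernstein_slice i k G x - G x\<bar> \<le> \<epsilon>"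
proof -
  obtain M where M: "\<And>x. x \<in> cbox 0 One \<Longrightarrow> \<bar>G x\<bar> \<le> M"
    using continuous_bounded_on_compact[OF G compact_cbox] by metis
  have "\<exists>N. \<forall>k\<ge>N. \<forall>x\<in>cbox 0 One. \<forall>u\<in>{0..1}.
     \<bar>(\<Sum>j\<le>k. G (slice i (j / k) x) * Bernstein k j u) - G (slice i u x)\<bar> \<le> \<epsilon>"
    by (rule Bernstein_approximation_uniform[where F="\<lambda>x t. G (slice i t x)" and M=M,
          OF _ slice_equicontinuous[OF G i] \<open>\<epsilon> > 0\<close>])
       (rule M[OF slice_in_unit_cube[OF i]])
  then obtain N where N: "\<And>k x u. k \<ge> N \<Longrightarrow> x \<in> cbox 0 One \<Longrightarrow> u \<in> {0..1} \<Longrightarrow>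
     \<bar>(\<Sum>j\<le>k. G (slice i (j / k) x) * Bernstein k j u) - G (slice i u x)\<bar> \<le> \<epsilon>" by blast
  have "\<bar>Bernstein_slice i k G x - G x\<bar> \<le> \<epsilon>" if "k \<ge> N" "x \<in> cbox 0 One" for k x
    using N[OF that, of "x \<bullet> i"] that(2) i by (simp add: Bernstein_slice_def mem_box)
  then show ?thesis by blast
qed

lemma slice_mean_value:
  assumes v: "C1_real v" and "s < t"
  obtains \<xi> where "s < \<xi>" "\<xi> < t" "v (slice i t x) - v (slice i s x) = (t - s) * frechet_derivative v (at (slice i \<xi> x)) i"
proof -
  have d: "((\<lambda>t. v (slice i t x)) has_derivative (\<lambda>h. frechet_derivative v (at (slice i t x)) (h *\<^sub>R i))) (at t within {s..t'})" for t t'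
  proof -
    have "((\<lambda>t. slice i t x) has_derivative (\<lambda>h. h *\<^sub>R i)) (at t within {s..t'})"
      unfolding slice_def by (auto intro!: derivative_eq_intros)
    from has_derivative_compose[OF this C1_real_has_derivative[OF v]] show ?thesis .
  qed
  obtain \<xi> where "\<xi> \<in> {s<..<t}" "v (slice i t x) - v (slice i s x) = frechet_derivative v (at (slice i \<xi> x)) ((t - s) *\<^sub>R i)"
    using mvt_simple[OF \<open>s < t\<close> d] by blast
  moreover have "frechet_derivative v (at (slice i \<xi> x)) ((t - s) *\<^sub>R i) = (t - s) * frechet_derivative v (at (slice i \<xi> x)) i"
    using linear_scale[OF bounded_linear.linear[OF has_derivative_bounded_linear[OF C1_real_has_derivative[OF v]]]] by simp
  ultimately show ?thesis using that by auto
qed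

text \<open>
  Summation by parts turns the derivative along \<open>i\<close> of the operator of degree \<open>n + 1\<close> into a Bernstein sum of
  degree \<open>n\<close> over difference quotients of \<open>v\<close>. The quotient with index \<open>j\<close> is a value of the partial
  derivative \<open>G\<close> between \<open>j / (n + 1)\<close> and \<open>(j + 1) / (n + 1)\<close>, an interval that also contains the node
  \<open>j / n\<close>. By equicontinuity it may be replaced by the value of \<open>G\<close> there, which leaves the Bernstein
  operator applied to \<open>G\<close>.
\<close>

lemma Bernstein_slice_derivative_approximation:
  fixes v :: "'a::euclidean_space \<Rightarrow> real"
  assumes v: "C1_real v" and i: "i \<in> Basis" and \<epsilon>: "\<epsilon> > 0"
  shows "\<exists>N. \<forall>k\<ge>N. \<forall>x\<in>cbox 0 One. \<bar>frechet_derivative (Bernstein_slice i k v) (at x) i - frechet_derivative v (at x) i\<bar> \<le> \<epsilon>"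
proof -
  define G where "G x = frechet_derivative v (at x) i" for x
  have G: "continuous_on UNIV G" using v unfolding C1_real_def G_def by blast
  obtain N where N: "\<And>k x. k \<ge> N \<Longrightarrow> x \<in> cbox 0 One \<Longrightarrow> \<bar>Bernstein_slice i k G x - G x\<bar> \<le> \<epsilon> / 2"
    using Bernstein_slice_approximation[OF G i, of "\<epsilon> / 2"] \<epsilon> by auto
  obtain \<delta> where \<delta>: "\<delta> > 0" "\<And>x s t. x \<in> cbox 0 One \<Longrightarrow> s \<in> {0..1} \<Longrightarrow> t \<in> {0..1} \<Longrightarrow> \<bar>s - t\<bar> < \<delta> \<Longrightarrow>
      \<bar>G (slice i s x) - G (slice i t x)\<bar> < \<epsilon> / 2"
    using slice_equicontinuous[OF G i, of "\<epsilon> / 2"] \<epsilon> by (meson half_gt_zero)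
  obtain N' :: nat where N': "1 / \<delta> < N'" using reals_Archimedean2 by blast
  have "\<bar>frechet_derivative (Bernstein_slice i k v) (at x) i - G x\<bar> \<le> \<epsilon>"
    if k: "k \<ge> Suc (Suc (max N N'))" and x: "x \<in> cbox 0 One" for k x
  proof -
    obtain n where n: "k = Suc n" "n \<ge> N" "n \<ge> N'" "n > 0" using k by (cases k) auto
    have u: "x \<bullet> i \<in> {0..1}" using x i by (simp add: mem_box)
    have small: "1 / real (Suc n) < \<delta>"
    proof -
      have "1 / \<delta> < Suc n" using N' n(3) by linarith
      then show ?thesis using \<delta>(1) by (simp add: field_simps)
    qed
    let ?q = "\<lambda>j. real (Suc n) * (v (slice i (Suc j / Suc n) x) - v (slice i (j / Suc n) x))"
    have q: "\<bar>?q j - G (slice i (j / n) x)\<bar> \<le> \<epsilon> / 2" if j: "j \<le> n" for j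
    proof -
      have lt: "real j / Suc n < Suc j / Suc n" by (simp add: divide_strict_right_mono)
      obtain \<xi> where \<xi>: "j / Suc n < \<xi>" "\<xi> < Suc j / Suc n"
        "v (slice i (Suc j / Suc n) x) - v (slice i (j / Suc n) x) = (Suc j / Suc n - j / Suc n) * G (slice i \<xi> x)"
        using slice_mean_value[OF v lt, of i x] unfolding G_def by blast
      have step: "real (Suc j) / Suc n - j / Suc n = 1 / Suc n"
        by (simp flip: diff_divide_distrib)
      have "?q j = G (slice i \<xi> x)" unfolding \<xi>(3) step by simp
      moreover have "\<xi> \<in> {0..1}"
      proof -
        have "0 \<le> real j / Suc n" "real (Suc j) / Suc n \<le> 1" using j by simp_all
        then show ?thesis using \<xi>(1,2) by (simp only: atLeastAtMost_iff) linarith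
      qed
      moreover have "real j / n \<in> {0..1}" using j n(4) by simp
      moreover have "\<bar>\<xi> - j / n\<bar> < \<delta>"
      proof -
        have "j / Suc n \<le> real j / n" using n(4) by (intro divide_left_mono) auto
        moreover have "real j / n \<le> Suc j / Suc n" using j n(4) by (simp add: field_simps)
        ultimately have "\<bar>\<xi> - j / n\<bar> \<le> Suc j / Suc n - j / Suc n" using \<xi>(1,2) by linarith
        then show ?thesis using small step by linarith
      qed
      ultimately show ?thesis using \<delta>(2)[OF x, of \<xi> "j / n"] by simp
    qed
    have B: "0 \<le> Bernstein n j (x \<bullet> i)" for j using u by (simp add: Bernstein_nonneg)
    have "frechet_derivative (Bernstein_slice i k v) (at x) i = (\<Sum>j\<le>n. ?q j * Bernstein n j (x \<bullet> i))"
      unfolding C1_real_Bernstein_slice(3)[OF v i] n(1) by (rule sum_Bernstein_deriv)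
    then have "frechet_derivative (Bernstein_slice i k v) (at x) i - Bernstein_slice i n G x
        = (\<Sum>j\<le>n. (?q j - G (slice i (j / n) x)) * Bernstein n j (x \<bullet> i))"
      by (simp only: Bernstein_slice_def left_diff_distrib sum_subtractf)
    also have "\<bar>\<dots>\<bar> \<le> (\<Sum>j\<le>n. \<epsilon> / 2 * Bernstein n j (x \<bullet> i))"
    proof (intro order.trans[OF sum_abs] sum_mono)
      \<comment> \<open>The Bernstein weights add up to 1, so the bound for one quotient carries over to the sum.\<close>
      fix j assume "j \<in> {..n}"
      then have "\<bar>?q j - G (slice i (j / n) x)\<bar> * Bernstein n j (x \<bullet> i) \<le> \<epsilon> / 2 * Bernstein n j (x \<bullet> i)"
        using q B by (intro mult_right_mono) auto
      then show "\<bar>(?q j - G (slice i (j / n) x)) * Bernstein n j (x \<bullet> i)\<bar> \<le> \<epsilon> / 2 * Bernstein n j (x \<bullet> i)"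
        by (simp only: abs_mult abs_of_nonneg[OF B])
    qed
    also have "\<dots> = \<epsilon> / 2" by (simp only: sum_distrib_left[symmetric]) simp
    finally show ?thesis using N[OF n(2) x] by linarith
  qed
  then show ?thesis unfolding G_def by blast
qed

lemma Bernstein_slice_C1_close:
  fixes v :: "'a::euclidean_space \<Rightarrow> real"
  assumes v: "C1_real v" and i: "i \<in> Basis" and \<epsilon>: "\<epsilon> > 0"
  shows "\<exists>k. C1_close (cbox 0 One) \<epsilon> v (Bernstein_slice i k v)"
proof -
  obtain N where N: "\<And>k x. k \<ge> N \<Longrightarrow> x \<in> cbox 0 One \<Longrightarrow> \<bar>Bernstein_slice i k v x - v x\<bar> \<le> \<epsilon>"
    using Bernstein_slice_approximation[OF C1_real_imp_continuous[OF v] i \<epsilon>] by blast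
  have "\<exists>N. \<forall>k\<ge>N. \<forall>x\<in>cbox 0 One. \<bar>frechet_derivative (Bernstein_slice i k v) (at x) b - frechet_derivative v (at x) b\<bar> \<le> \<epsilon>"
    if b: "b \<in> Basis" for b
  proof (cases "b = i")
    case True
    then show ?thesis using Bernstein_slice_derivative_approximation[OF v i \<epsilon>] by simp
  next
    case False
    have "continuous_on UNIV (\<lambda>x. frechet_derivative v (at x) b)" using v by (simp add: C1_real_def)
    from Bernstein_slice_approximation[OF this i \<epsilon>] show ?thesis
      using C1_real_Bernstein_slice(2)[OF v i b False] by simp
  qed
  then obtain N' where N': "\<And>b k x. b \<in> Basis \<Longrightarrow> k \<ge> N' b \<Longrightarrow> x \<in> cbox 0 One \<Longrightarrow>
     \<bar>frechet_derivative (Bernstein_slice i k v) (at x) b - frechet_derivative v (at x) b\<bar> \<le> \<epsilon>" by metis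
  define k where "k = Max (insert N (N' ` Basis))"
  have "k \<ge> N" "\<And>b. b \<in> Basis \<Longrightarrow> k \<ge> N' b" unfolding k_def by (rule Max_ge; simp)+
  then show ?thesis
    using N N' unfolding C1_close_def by (intro exI[of _ k]) (auto simp: abs_minus_commute)
qed

lemma C1_close_mono: "C1_close S \<epsilon> v w \<Longrightarrow> \<epsilon> \<le> \<epsilon>' \<Longrightarrow> C1_close S \<epsilon>' v w"
  unfolding C1_close_def by (meson order.trans)

text \<open>
  Induction on the set \<open>I\<close> of coordinates on which \<open>v\<close> depends. The Bernstein operator in a coordinate \<open>i\<close>
  replaces \<open>v\<close> by a finite sum of polynomials in that coordinate times slices of \<open>v\<close>; the slices do not
  depend on the coordinate \<open>i\<close> any more, so the induction hypothesis approximates them.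
\<close>

lemma C1_polynomial_approximation_unit_cube:
  fixes v :: "'a::euclidean_space \<Rightarrow> real"
  assumes "finite I" "I \<subseteq> Basis" "C1_real v"
    and "\<And>x y. (\<And>b. b \<in> I \<Longrightarrow> x \<bullet> b = y \<bullet> b) \<Longrightarrow> v x = v y" and "\<epsilon> > 0"
  shows "\<exists>q. real_polynomial_function q \<and> C1_close (cbox 0 One) \<epsilon> v q"
  using assms
proof (induction I arbitrary: v \<epsilon> rule: finite_induct)
  case empty
  have "v x = v 0" for x by (rule empty.prems(3)) simp
  then have c: "v = (\<lambda>x. v 0)" by (rule ext)
  have "real_polynomial_function v" by (subst c) (rule real_polynomial_function.intros(2))
  then show ?case using empty.prems(4) by (intro exI[of _ v]) (simp add: C1_close_def)
next
  case (insert i I)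
  note v = insert.prems(2)
  have i: "i \<in> Basis" using insert.prems(1) by simp
  obtain k where k: "C1_close (cbox 0 One) (\<epsilon> / 2) v (Bernstein_slice i k v)"
    using Bernstein_slice_C1_close[OF v i, of "\<epsilon> / 2"] insert.prems(4) by auto
  let ?r = "\<lambda>j x. Bernstein k j (x \<bullet> i)" and ?v = "\<lambda>j x. v (slice i (j / k) x)"
  have "\<exists>q. real_polynomial_function q \<and> C1_close (cbox 0 One) (\<epsilon> / (2 * Suc k)) (\<lambda>x. ?v j x * ?r j x) (\<lambda>x. q x * ?r j x)" for j :: nat
  proof -
    obtain B where B: "B \<ge> 0" "\<And>v w \<epsilon>. C1_real v \<Longrightarrow> C1_real w \<Longrightarrow> C1_close (cbox 0 One) \<epsilon> v w \<Longrightarrow> \<epsilon> \<ge> 0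
        \<Longrightarrow> C1_close (cbox 0 One) (B * \<epsilon>) (\<lambda>x. v x * ?r j x) (\<lambda>x. w x * ?r j x)"
      by (rule C1_close_mult[OF C1_real_polynomial[OF real_polynomial_function_Bernstein[of k j i]] compact_cbox[of 0 One]]) blast
    \<comment> \<open>Half of \<open>\<epsilon>\<close> is spread over the \<open>k + 1\<close> terms; \<open>B + 1\<close> is positive even when \<open>B\<close> is 0.\<close>
    define \<eta> where "\<eta> = \<epsilon> / (2 * Suc k) / (B + 1)"
    have \<eta>: "\<eta> > 0" using B(1) insert.prems(4) by (simp add: \<eta>_def)
    have B\<eta>: "B * \<eta> \<le> \<epsilon> / (2 * Suc k)"
    proof -
      have "B * \<eta> \<le> (B + 1) * \<eta>" using \<eta> by (simp add: distrib_right)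
      then show ?thesis using B(1) by (simp add: \<eta>_def)
    qed
    have dep: "?v j x = ?v j y" if "\<And>b. b \<in> I \<Longrightarrow> x \<bullet> b = y \<bullet> b" for x y
    proof (rule insert.prems(3))
      fix b assume "b \<in> insert i I"
      then show "slice i (j / k) x \<bullet> b = slice i (j / k) y \<bullet> b"
        using that insert.prems(1) by (auto simp: inner_slice)
    qed
    have "I \<subseteq> Basis" using insert.prems(1) by simp
    from insert.IH[OF this C1_real_slice(1)[OF v] dep \<eta>]
    obtain q where q: "real_polynomial_function q" "C1_close (cbox 0 One) \<eta> (?v j) q" by blast
    have "C1_close (cbox 0 One) (B * \<eta>) (\<lambda>x. ?v j x * ?r j x) (\<lambda>x. q x * ?r j x)"
      using B(2)[OF C1_real_slice(1)[OF v] C1_real_polynomial[OF q(1)] q(2)] \<eta> by simp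
    from C1_close_mono[OF this B\<eta>] q(1) show ?thesis by (intro exI[of _ q] conjI)
  qed
  from choice[OF allI[OF this]]
  obtain q where qj: "\<forall>j. real_polynomial_function (q j)
    \<and> C1_close (cbox 0 One) (\<epsilon> / (2 * Suc k)) (\<lambda>x. ?v j x * ?r j x) (\<lambda>x. q j x * ?r j x)" ..
  have q: "real_polynomial_function (q j)"
    "C1_close (cbox 0 One) (\<epsilon> / (2 * Suc k)) (\<lambda>x. ?v j x * ?r j x) (\<lambda>x. q j x * ?r j x)" for j
    by (rule conjunct1[OF spec[OF qj]], rule conjunct2[OF spec[OF qj]])
  have poly: "real_polynomial_function (\<lambda>x. q j x * ?r j x)" for j
    by (intro real_polynomial_function.intros(4) q real_polynomial_function_Bernstein)
  define p where "p x = (\<Sum>j\<le>k. q j x * ?r j x)" for x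
  have "C1_close (cbox 0 One) (card {..k} * (\<epsilon> / (2 * Suc k))) (\<lambda>x. \<Sum>j\<le>k. ?v j x * ?r j x) p"
    unfolding p_def
    by (rule C1_close_sum[OF finite_atMost _ C1_real_polynomial[OF poly] q(2)])
       (intro C1_real_mult(1) C1_real_slice(1) v C1_real_polynomial real_polynomial_function_Bernstein)
  moreover have "card {..k} * (\<epsilon> / (2 * Suc k)) = \<epsilon> / 2" by (simp add: field_simps)
  moreover have "(\<lambda>x. \<Sum>j\<le>k. ?v j x * ?r j x) = Bernstein_slice i k v" by (rule ext) (simp add: Bernstein_slice_def)
  ultimately have "C1_close (cbox 0 One) (\<epsilon> / 2) (Bernstein_slice i k v) p" by (simp only:)
  from C1_close_trans[OF k this] have "C1_close (cbox 0 One) \<epsilon> v p" by simp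
  moreover have "real_polynomial_function p"
    unfolding p_def by (intro real_polynomial_function_sum poly) simp
  ultimately show ?case by blast
qed

text \<open>
  An affine map \<open>A\<close> brings \<open>S\<close> into the unit cube. Its linear part is a contraction because \<open>R \<ge> 1\<close>, so the
  estimate for the derivatives in the cube carries over to \<open>S\<close> without loss.
\<close>

theorem C1_polynomial_approximation:
  fixes v :: "'a::euclidean_space \<Rightarrow> real"
  assumes v: "C1_real v" and S: "bounded S" and \<epsilon>: "\<epsilon> > 0"
  obtains q where "real_polynomial_function q" "C1_close S \<epsilon> v q"
proof -
  obtain R' where R': "\<And>x. x \<in> S \<Longrightarrow> norm x \<le> R'" using S by (auto simp: bounded_iff)
  define R where "R = max 1 R'"
  have R: "R \<ge> 1" by (simp add: R_def)
  define A where "A x = (1 / (2 * R)) *\<^sub>R (x + R *\<^sub>R One)" for x :: 'a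
  define A' where "A' y = (2 * R) *\<^sub>R y - R *\<^sub>R One" for y :: 'a
  have A'A: "A' (A x) = x" for x using R by (simp add: A_def A'_def)
  have A_in: "A x \<in> cbox 0 One" if "x \<in> S" for x
  proof -
    have "\<bar>x \<bullet> b\<bar> \<le> R" if b: "b \<in> Basis" for b
      using Basis_le_norm[OF b, of x] R'[OF \<open>x \<in> S\<close>] by (simp add: R_def)
    then have "x \<bullet> b \<le> R" "0 \<le> R + x \<bullet> b" if "b \<in> Basis" for b
      using that by (smt (verit))+
    then show ?thesis
      using R by (auto simp: A_def mem_box inner_add_left abs_le_iff divide_le_eq_1 field_simps)
  qed
  have dA: "(A has_derivative (\<lambda>h. (1 / (2 * R)) *\<^sub>R h)) (at x)" for x
    unfolding A_def by (auto intro!: derivative_eq_intros)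
  have dA': "(A' has_derivative (\<lambda>h. (2 * R) *\<^sub>R h)) (at x)" for x
    unfolding A'_def by (auto intro!: derivative_eq_intros)
  have cA': "continuous_on UNIV A'" unfolding A'_def by (intro continuous_intros)
  have v': "C1_real (\<lambda>y. v (A' y))"
  proof (rule C1_realI)
    show "((\<lambda>y. v (A' y)) has_derivative (\<lambda>h. frechet_derivative v (at (A' y)) ((2 * R) *\<^sub>R h))) (at y)" for y
      by (rule has_derivative_compose[OF dA' C1_real_has_derivative[OF v]])
    show "continuous_on UNIV (\<lambda>y. frechet_derivative v (at (A' y)) ((2 * R) *\<^sub>R h))" for h
      using continuous_on_compose2[OF _ cA', of UNIV "\<lambda>p. frechet_derivative v (at p) ((2 * R) *\<^sub>R h)"] v
      by (simp add: C1_real_def)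
  qed
  have "v (A' y) = v (A' z)" if "\<And>b. b \<in> Basis \<Longrightarrow> y \<bullet> b = z \<bullet> b" for y z
    using euclidean_eqI[OF that] by simp
  from C1_polynomial_approximation_unit_cube[OF finite_Basis order_refl v' this \<epsilon>]
  obtain q where q: "real_polynomial_function q" "C1_close (cbox 0 One) \<epsilon> (\<lambda>y. v (A' y)) q" by blast
  have comp: "frechet_derivative (\<lambda>x. f (A x)) (at x) b = frechet_derivative f (at (A x)) b / (2 * R)"
    if "C1_real f" for f x b
  proof -
    have "frechet_derivative (\<lambda>x. f (A x)) (at x) = (\<lambda>h. frechet_derivative f (at (A x)) ((1 / (2 * R)) *\<^sub>R h))"
      by (rule frechet_derivative_eqI[OF has_derivative_compose[OF dA C1_real_has_derivative[OF that]]])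
    then show ?thesis
      using linear_scale[OF bounded_linear.linear[OF has_derivative_bounded_linear[OF C1_real_has_derivative[OF that]]]]
      by simp
  qed
  show ?thesis
  proof
    have "polynomial_function A"
      unfolding A_def by (intro polynomial_function_cmul polynomial_function_add polynomial_function_id polynomial_function_const)
    from real_polynomial_function_compose[OF this q(1)]
    show "real_polynomial_function (\<lambda>x. q (A x))" by (simp add: o_def)
    show "C1_close S \<epsilon> v (\<lambda>x. q (A x))"
      unfolding C1_close_def
    proof (intro ballI conjI)
      fix x assume x: "x \<in> S"
      from q(2) A_in[OF x] show "\<bar>v x - q (A x)\<bar> \<le> \<epsilon>"
        unfolding C1_close_def by (auto simp: A'A)
      fix b :: 'a assume b: "b \<in> Basis"
      have "\<bar>frechet_derivative (\<lambda>y. v (A' y)) (at (A x)) b - frechet_derivative q (at (A x)) b\<bar> \<le> \<epsilon>"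
        using q(2) A_in[OF x] b unfolding C1_close_def by blast
      then have "\<bar>frechet_derivative (\<lambda>y. v (A' y)) (at (A x)) b - frechet_derivative q (at (A x)) b\<bar> / (2 * R) \<le> \<epsilon> / 1"
        using R \<epsilon> by (intro frac_le) auto
      moreover have "frechet_derivative v (at x) b = frechet_derivative (\<lambda>y. v (A' y)) (at (A x)) b / (2 * R)"
        using comp[OF v', of x b] by (simp add: A'A)
      ultimately show "\<bar>frechet_derivative v (at x) b - frechet_derivative (\<lambda>x. q (A x)) (at x) b\<bar> \<le> \<epsilon>"
        using R by (simp add: comp[OF C1_real_polynomial[OF q(1)]] abs_divide flip: diff_divide_distrib)
    qed
  qed
qed

section \<open>Polynomial functions and the transport operator\<close>

lemma real_polynomial_function_monom_val: "real_polynomial_function (monom_val \<beta>)"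
  unfolding monom_val_def
proof (intro real_polynomial_function.intros(4) real_polynomial_function_power real_polynomial_function_prod)
  show "real_polynomial_function fst"
    by (intro real_polynomial_function.intros(1) bounded_linear_fst)
  show "real_polynomial_function (\<lambda>p. snd p $ k)" for k
    by (intro real_polynomial_function.intros(1) bounded_linear_compose[OF bounded_linear_vec_nth bounded_linear_snd])
qed auto

lemma real_polynomial_function_peval: "real_polynomial_function (peval q)"
  unfolding peval_def
  by (intro real_polynomial_function_sum real_polynomial_function.intros(4) real_polynomial_function.intros(2)
      real_polynomial_function_monom_val) auto

lemma ex_peval_of_linear:
  fixes f :: "real \<times> (real^'n::finite) \<Rightarrow> real"
  assumes "linear f"
  shows "\<exists>q. f = peval q"
proof -
  define q where "q = Poly_Mapping.single 0 (f (1, 0)) * var None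
     + (\<Sum>k\<in>UNIV. Poly_Mapping.single 0 (f (0, axis k 1)) * var (Some k))"
  have "f p = peval q p" for p
  proof -
    have s: "snd p = (\<Sum>k\<in>UNIV. (snd p $ k) *\<^sub>R axis k 1)"
      using basis_expansion[of "snd p"] by (simp add: scalar_mult_eq_scaleR)
    have "p = fst p *\<^sub>R (1, 0) + (0, snd p)" by (simp add: prod_eq_iff)
    also have "(0, snd p) = (\<Sum>k\<in>UNIV. (snd p $ k) *\<^sub>R (0 :: real, axis k 1))"
      by (subst s) (simp add: prod_eq_iff fst_sum snd_sum)
    finally have "f p = f (fst p *\<^sub>R (1, 0) + (\<Sum>k\<in>UNIV. (snd p $ k) *\<^sub>R (0, axis k 1)))" by simp
    also have "\<dots> = fst p * f (1, 0) + (\<Sum>k\<in>UNIV. (snd p $ k) * f (0, axis k 1))"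
      by (simp only: linear_add[OF assms] linear_sum[OF assms] linear_scale[OF assms] real_scaleR_def)
    also have "\<dots> = peval q p"
      by (simp add: q_def peval_sum coord_def mult.commute)
    finally show ?thesis .
  qed
  then show ?thesis by blast
qed

lemma real_polynomial_function_imp_peval:
  fixes f :: "real \<times> (real^'n::finite) \<Rightarrow> real"
  assumes "real_polynomial_function f"
  shows "\<exists>q. f = peval q"
  using assms
proof (induction f rule: real_polynomial_function.induct)
  case (linear f)
  then show ?case by (intro ex_peval_of_linear bounded_linear.linear)
next
  case (const c)
  show ?case by (intro exI[of _ "Poly_Mapping.single 0 c"]) (simp add: fun_eq_iff)
next
  case (add f g)
  then obtain p q where "f = peval p" "g = peval q" by blast
  then show ?case by (intro exI[of _ "p + q"]) (simp add: fun_eq_iff)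
next
  case (mult f g)
  then obtain p q where "f = peval p" "g = peval q" by blast
  then show ?case by (intro exI[of _ "p * q"]) (simp add: fun_eq_iff)
qed

lemma C1_fun_iff_C1_real: "C1_fun v \<longleftrightarrow> C1_real v"
  by (simp add: C1_fun_def C1_real_def)

lemma C1_real_peval: "C1_real (peval q)"
  by (rule C1_real_polynomial[OF real_polynomial_function_peval])

lemma C1_real_monom_val: "C1_real (monom_val \<beta>)"
  by (rule C1_real_polynomial[OF real_polynomial_function_monom_val])

lemma frechet_derivative_eq_line_derivative:
  fixes v :: "'a::euclidean_space \<Rightarrow> real"
  assumes v: "C1_real v" and d: "((\<lambda>s. v (p + s *\<^sub>R h)) has_real_derivative d) (at 0)"
  shows "frechet_derivative v (at p) h = d"
proof -
  have "((\<lambda>s. p + s *\<^sub>R h) has_derivative (\<lambda>s. s *\<^sub>R h)) (at 0)"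
    by (auto intro!: derivative_eq_intros)
  from has_derivative_compose[OF this, of v "frechet_derivative v (at p)"] C1_real_has_derivative[OF v]
  have "((\<lambda>s. v (p + s *\<^sub>R h)) has_derivative (\<lambda>s. frechet_derivative v (at p) (s *\<^sub>R h))) (at 0)" by simp
  from has_derivative_unique[OF this d[unfolded has_field_derivative_def]]
  have "frechet_derivative v (at p) (1 *\<^sub>R h) = d * 1" by (rule fun_cong)
  then show ?thesis by simp
qed

lemma frechet_derivative_monom_val_t:
  "frechet_derivative (monom_val \<alpha>) (at p) (1, 0) = real (fst \<alpha>) * monom_val (\<alpha> - (1, 0)) p"
proof (rule frechet_derivative_eq_line_derivative[OF C1_real_monom_val])
  show "((\<lambda>s. monom_val \<alpha> (p + s *\<^sub>R (1, 0))) has_real_derivative real (fst \<alpha>) * monom_val (\<alpha> - (1, 0)) p) (at 0)"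
    unfolding monom_val_def by (auto intro!: derivative_eq_intros)
qed

lemma frechet_derivative_monom_val_x:
  "frechet_derivative (monom_val \<alpha>) (at p) (0, axis k 1) = real (snd \<alpha> $ k) * monom_val (\<alpha> - (0, axis k 1)) p"
proof (rule frechet_derivative_eq_line_derivative[OF C1_real_monom_val])
  let ?P = "\<Prod>l\<in>UNIV - {k}. (snd p $ l) ^ (snd \<alpha> $ l)"
  have split: "(\<Prod>l\<in>UNIV. F l) = F k * (\<Prod>l\<in>UNIV - {k}. F l)" for F :: "_ \<Rightarrow> real"
    by (rule prod.remove) auto
  have 1: "monom_val \<alpha> (p + s *\<^sub>R (0, axis k 1)) = fst p ^ fst \<alpha> * ((snd p $ k + s) ^ (snd \<alpha> $ k) * ?P)" for s
    unfolding monom_val_def by (subst split) (simp add: axis_def)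
  have 2: "monom_val (\<alpha> - (0, axis k 1)) p = fst p ^ fst \<alpha> * ((snd p $ k) ^ (snd \<alpha> $ k - 1) * ?P)"
    unfolding monom_val_def by (subst split) (simp add: axis_def)
  show "((\<lambda>s. monom_val \<alpha> (p + s *\<^sub>R (0, axis k 1))) has_real_derivative real (snd \<alpha> $ k) * monom_val (\<alpha> - (0, axis k 1)) p) (at 0)"
    unfolding 1 2 by (auto intro!: derivative_eq_intros)
qed

text \<open>
  The formal operator, which defines the moment constraints, and the analytic one, which defines the
  measure constraints, agree on monomials.
\<close>

lemma transport_fun_monom_val:
  "transport_fun F (monom_val \<alpha>) p = peval (transport_poly F (monomial_poly \<alpha>)) p"
  by (simp add: transport_fun_def transport_poly_def pderiv_t_def pderiv_x_def peval_sum
      frechet_derivative_monom_val_t frechet_derivative_monom_val_x)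
     (simp add: monomial_poly_def)

lemma transport_fun_add:
  assumes "C1_real v" "C1_real w"
  shows "transport_fun F (\<lambda>p. v p + w p) p = transport_fun F v p + transport_fun F w p"
proof -
  have "frechet_derivative (\<lambda>p. v p + w p) (at p) h = frechet_derivative v (at p) h + frechet_derivative w (at p) h" for h
    by (simp add: frechet_derivative_eqI[OF has_derivative_add[OF C1_real_has_derivative[OF assms(1)] C1_real_has_derivative[OF assms(2)]]])
  then show ?thesis by (simp add: transport_fun_def distrib_right sum.distrib)
qed

lemma transport_fun_scale:
  assumes "C1_real v"
  shows "transport_fun F (\<lambda>p. c * v p) p = c * transport_fun F v p"
proof -
  have "frechet_derivative (\<lambda>p. c * v p) (at p) h = c * frechet_derivative v (at p) h" for h
    by (simp add: frechet_derivative_eqI[OF has_derivative_mult_right[OF C1_real_has_derivative[OF assms]]])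
  then show ?thesis by (simp add: transport_fun_def distrib_left sum_distrib_left mult_ac)
qed

lemma continuous_on_transport_fun: "C1_real v \<Longrightarrow> continuous_on UNIV (transport_fun F v)"
  unfolding transport_fun_def C1_real_def
  by (intro continuous_on_add continuous_on_sum continuous_on_mult continuous_on_peval) blast+

section \<open>Finite measures on compact sets\<close>

lemma integrable_continuous_finite_borel_measures:
  fixes F :: "'a::{t2_space} \<Rightarrow> real"
  assumes \<mu>: "\<mu> \<in> finite_borel_measures K" and K: "compact K" and F: "continuous_on UNIV F"
  shows "integrable \<mu> F"
proof -
  have \<mu>_sets: "sets \<mu> = sets (restrict_space borel K)" and fin: "finite_measure \<mu>"
    using \<mu> by (auto simp: finite_borel_measures_def)
  have space: "space \<mu> = K" using sets_eq_imp_space_eq[OF \<mu>_sets] by (simp add: space_restrict_space)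
  have "F \<in> borel_measurable (restrict_space borel K)"
    using F by (intro measurable_restrict_space1 borel_measurable_continuous_onI)
  then have meas: "F \<in> borel_measurable \<mu>" by (simp add: measurable_cong_sets[OF \<mu>_sets refl])
  have "bounded (F ` K)"
    using F K by (intro compact_imp_bounded compact_continuous_image) (auto intro: continuous_on_subset)
  then obtain B where "\<And>x. x \<in> K \<Longrightarrow> norm (F x) \<le> B" by (auto simp: bounded_iff)
  then have "AE x in \<mu>. norm (F x) \<le> B" using space by (intro AE_I2) simp
  from finite_measure.integrable_const_bound[OF fin this meas] show ?thesis .
qed

lemma integral_close_finite_borel_measures:
  fixes F G :: "'a::{t2_space} \<Rightarrow> real"
  assumes \<mu>: "\<mu> \<in> finite_borel_measures K" and K: "compact K"
    and F: "continuous_on UNIV F" and G: "continuous_on UNIV G" and "\<And>p. p \<in> K \<Longrightarrow> \<bar>F p - G p\<bar> \<le> \<epsilon>"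
  shows "\<bar>(\<integral>p. F p \<partial>\<mu>) - (\<integral>p. G p \<partial>\<mu>)\<bar> \<le> \<epsilon> * measure \<mu> (space \<mu>)"
proof -
  have \<mu>_sets: "sets \<mu> = sets (restrict_space borel K)" and fin: "finite_measure \<mu>"
    using \<mu> by (auto simp: finite_borel_measures_def)
  have space: "space \<mu> = K" using sets_eq_imp_space_eq[OF \<mu>_sets] by (simp add: space_restrict_space)
  note int = integrable_continuous_finite_borel_measures[OF \<mu> K]
  have "\<bar>(\<integral>p. F p \<partial>\<mu>) - (\<integral>p. G p \<partial>\<mu>)\<bar> = \<bar>\<integral>p. F p - G p \<partial>\<mu>\<bar>"
    using int[OF F] int[OF G] by simp
  also have "\<dots> \<le> (\<integral>p. \<bar>F p - G p\<bar> \<partial>\<mu>)" by (rule integral_abs_bound)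
  also have "\<dots> \<le> (\<integral>p. \<epsilon> \<partial>\<mu>)"
    using int[OF F] int[OF G] assms(5) space
    by (intro integral_mono integrable_abs Bochner_Integration.integrable_diff finite_measure.integrable_const[OF fin]) auto
  finally show ?thesis by (simp add: mult.commute)
qed

section \<open>Representing measures on basic semialgebraic sets\<close>

text \<open>
  Let \<open>\<phi> = max 0 (- g)\<close>. Approximating \<open>\<phi>\<close> uniformly on the box by polynomials \<open>q\<close> in the hypothesis gives
  \<open>\<integral> g \<phi>\<^sup>2 \<ge> 0\<close>. But \<open>g \<phi>\<^sup>2 = - \<phi>\<^sup>3 \<le> 0\<close>, hence \<open>\<phi>\<close> vanishes almost everywhere.
\<close>

lemma AE_nonneg_of_localizing:
  assumes fin: "finite_measure \<mu>" and sets: "sets \<mu> = sets borel"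
    and box: "AE p in \<mu>. p \<in> sym_box R"
    and loc: "\<And>q. 0 \<le> (\<integral>p. peval g p * (peval q p)\<^sup>2 \<partial>\<mu>)"
  shows "AE p in \<mu>. 0 \<le> peval g p"
proof -
  interpret finite_measure \<mu> by fact
  define \<phi> where "\<phi> p = max 0 (- peval g p)" for p
  have cont: "continuous_on UNIV \<phi>" unfolding \<phi>_def by (intro continuous_intros)
  have meas: "peval q \<in> borel_measurable \<mu>" "\<phi> \<in> borel_measurable \<mu>" for q
    using sets borel_measurable_peval borel_measurable_continuous_onI[OF cont]
    by (auto simp: measurable_cong_sets[OF sets refl])
  obtain G where G: "G \<ge> 0" "\<And>p. p \<in> sym_box R \<Longrightarrow> \<bar>peval g p\<bar> \<le> G"
    using continuous_bounded_on_compact[OF continuous_on_peval compact_sym_box] by metis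
  have "\<exists>q. \<forall>p\<in>sym_box R. \<bar>\<phi> p - peval q p\<bar> < 1 / Suc n" for n
  proof -
    obtain r where "real_polynomial_function r" "\<And>p. p \<in> sym_box R \<Longrightarrow> \<bar>\<phi> p - r p\<bar> < 1 / Suc n"
      using Stone_Weierstrass_real_polynomial_function[OF compact_sym_box continuous_on_subset[OF cont subset_UNIV], of "1 / Suc n"]
      by auto
    then show ?thesis using real_polynomial_function_imp_peval by metis
  qed
  then obtain q where q: "\<And>n p. p \<in> sym_box R \<Longrightarrow> \<bar>\<phi> p - peval (q n) p\<bar> < 1 / Suc n" by metis
  have q_bound: "\<bar>peval (q n) p\<bar> \<le> G + 1" if "p \<in> sym_box R" for n p
  proof -
    have "1 / real (Suc n) \<le> 1" by simp
    moreover have "\<bar>\<phi> p\<bar> \<le> G" using G(2)[OF that] by (auto simp: \<phi>_def)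
    ultimately show ?thesis using q[OF that, of n] by linarith
  qed
  have q_lim: "(\<lambda>n. peval (q n) p) \<longlonglongrightarrow> \<phi> p" if p: "p \<in> sym_box R" for p
  proof (rule LIM_zero_cancel, rule Lim_null_comparison[of _ "\<lambda>n. 1 / Suc n"])
    show "\<forall>\<^sub>F n in sequentially. norm (peval (q n) p - \<phi> p) \<le> 1 / real (Suc n)"
      using q[OF p] by (intro always_eventually allI) (simp add: abs_minus_commute less_imp_le)
    show "(\<lambda>n. 1 / real (Suc n)) \<longlonglongrightarrow> 0" using LIMSEQ_inverse_real_of_nat by (simp add: inverse_eq_divide)
  qed
  have "(\<lambda>n. \<integral>p. peval g p * (peval (q n) p)\<^sup>2 \<partial>\<mu>) \<longlonglongrightarrow> (\<integral>p. peval g p * (\<phi> p)\<^sup>2 \<partial>\<mu>)"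
  proof (rule integral_dominated_convergence[where w="\<lambda>_. G * (G + 1)\<^sup>2"])
    show "AE p in \<mu>. (\<lambda>n. peval g p * (peval (q n) p)\<^sup>2) \<longlonglongrightarrow> peval g p * (\<phi> p)\<^sup>2"
      using box by eventually_elim (intro tendsto_intros q_lim)
    show "AE p in \<mu>. norm (peval g p * (peval (q n) p)\<^sup>2) \<le> G * (G + 1)\<^sup>2" for n
      using box
    proof eventually_elim
      case (elim p)
      have "(peval (q n) p)\<^sup>2 \<le> (G + 1)\<^sup>2" using q_bound[OF elim, of n] G(1) by (simp add: abs_le_square_iff[symmetric])
      then have "\<bar>peval g p\<bar> * (peval (q n) p)\<^sup>2 \<le> G * (G + 1)\<^sup>2"
        using G(1) G(2)[OF elim] by (intro mult_mono) auto
      then show ?case by (simp add: abs_mult)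
    qed
    show "(\<lambda>p. peval g p * (\<phi> p)\<^sup>2) \<in> borel_measurable \<mu>"
      "(\<lambda>p. peval g p * (peval (q n) p)\<^sup>2) \<in> borel_measurable \<mu>" for n
      by (intro borel_measurable_times borel_measurable_power meas)+
  qed (rule integrable_const)
  then have "0 \<le> (\<integral>p. peval g p * (\<phi> p)\<^sup>2 \<partial>\<mu>)"
    using loc by (intro LIMSEQ_le_const) auto
  moreover have "peval g p * (\<phi> p)\<^sup>2 = - ((\<phi> p) ^ 3)" for p
    by (auto simp: \<phi>_def max_def power2_eq_square power3_eq_cube)
  ultimately have le: "(\<integral>p. (\<phi> p) ^ 3 \<partial>\<mu>) \<le> 0" by simp
  have int: "integrable \<mu> (\<lambda>p. (\<phi> p) ^ 3)"
  proof (rule integrable_const_bound[where B="G ^ 3"])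
    show "AE p in \<mu>. norm ((\<phi> p) ^ 3) \<le> G ^ 3"
      using box
    proof eventually_elim
      case (elim p)
      have "\<bar>\<phi> p\<bar> \<le> G" using G(2)[OF elim] by (auto simp: \<phi>_def)
      then show ?case by (simp add: power_abs power_mono)
    qed
  qed (intro borel_measurable_power meas)
  have nonneg: "0 \<le> (\<phi> p) ^ 3" for p by (simp add: \<phi>_def)
  have "0 \<le> (\<integral>p. (\<phi> p) ^ 3 \<partial>\<mu>)" using nonneg by simp
  with le have "(\<integral>p. (\<phi> p) ^ 3 \<partial>\<mu>) = 0" by simp
  then have "AE p in \<mu>. (\<phi> p) ^ 3 = 0"
    using integral_nonneg_eq_0_iff_AE[OF int] nonneg by simp
  then show ?thesis
    by eventually_elim (auto simp: \<phi>_def max_def split: if_splits)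
qed

text \<open>
  The measure on the box obtained from positivity and growth is concentrated on \<open>K\<close> by the localizing
  conditions, so restricting it to \<open>K\<close> changes no moment.
\<close>

theorem representing_measure_semialgebraic:
  fixes w :: "'n::finite expo \<Rightarrow> real" and g :: "nat \<Rightarrow> 'n rpoly"
  assumes R: "R > 0" and w: "psd_bounded R w"
    and loc: "\<And>i q. i \<in> I \<Longrightarrow> 0 \<le> riesz w (g i * (q * q))"
    and K: "K = {p. \<forall>i\<in>I. 0 \<le> peval (g i) p}" and I: "finite I"
  obtains \<mu> where "\<mu> \<in> finite_borel_measures K" "\<And>q. riesz w q = (\<integral>p. peval q p \<partial>\<mu>)"
proof -
  obtain \<nu> where \<nu>: "finite_measure \<nu>" "sets \<nu> = sets borel" "AE p in \<nu>. p \<in> sym_box R"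
    "\<And>q. riesz w q = (\<integral>p. peval q p \<partial>\<nu>)"
    using representing_measure_on_box[OF R w] by metis
  have meas: "peval q \<in> borel_measurable \<nu>" for q
    using \<nu>(2) borel_measurable_peval by (simp add: measurable_cong_sets[OF \<nu>(2) refl])
  have AE1: "AE p in \<nu>. 0 \<le> peval (g i) p" if "i \<in> I" for i
    using AE_nonneg_of_localizing[OF \<nu>(1-3)] loc[OF that] by (simp add: \<nu>(4) power2_eq_square)
  have AE_K: "AE p in \<nu>. p \<in> K"
    using AE_finite_allI[OF I AE1] unfolding K by simp
  have "closed K"
  proof -
    have "K = (\<Inter>i\<in>I. {p. 0 \<le> peval (g i) p})" using K by auto
    then show ?thesis by (auto intro!: closed_INT closed_Collect_le continuous_on_peval)
  qed
  then have K_sets: "K \<in> sets \<nu>" by (simp add: \<nu>(2))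
  show ?thesis
  proof
    have "sets (restrict_space \<nu> K) = sets (restrict_space borel K)"
      by (rule sets_restrict_space_cong) (rule \<nu>(2))
    moreover have "finite_measure (restrict_space \<nu> K)"
      using \<nu>(1) K_sets by (intro finite_measure_restrict_space) auto
    ultimately show "restrict_space \<nu> K \<in> finite_borel_measures K"
      by (simp add: finite_borel_measures_def)
    fix q
    have "(\<integral>p. peval q p \<partial>restrict_space \<nu> K) = (\<integral>p. indicator K p *\<^sub>R peval q p \<partial>\<nu>)"
      using K_sets by (intro integral_restrict_space) (auto simp: sets.Int_space_eq2)
    also have "\<dots> = (\<integral>p. peval q p \<partial>\<nu>)"
      using AE_K K_sets meas by (intro integral_cong_AE) (auto simp: indicator_def)
    finally show "riesz w q = (\<integral>p. peval q p \<partial>restrict_space \<nu> K)" by (simp add: \<nu>(4))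
  qed
qed

section \<open>Localizing matrices\<close>

lemma finite_expos_upto: "finite (expos_upto d :: 'n::finite expo set)"
proof -
  let ?h = "\<lambda>\<beta> :: 'n expo. (fst \<beta>, ($) (snd \<beta>))"
  have le: "snd \<beta> $ k \<le> d" if "expo_deg \<beta> \<le> d" for \<beta> :: "'n expo" and k
  proof -
    have "snd \<beta> $ k \<le> (\<Sum>k\<in>UNIV. snd \<beta> $ k)" by (rule member_le_sum) auto
    then show ?thesis using that by (simp add: expo_deg_def)
  qed
  have "?h ` expos_upto d \<subseteq> {..d} \<times> (UNIV \<rightarrow>\<^sub>E {..d})"
  proof (rule image_subsetI)
    fix \<beta> :: "'n expo" assume \<beta>: "\<beta> \<in> expos_upto d"
    then have "fst \<beta> \<le> d" by (simp add: expos_upto_def expo_deg_def)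
    then show "?h \<beta> \<in> {..d} \<times> (UNIV \<rightarrow>\<^sub>E {..d})"
      using le \<beta> by (simp add: expos_upto_def PiE_iff)
  qed
  moreover have "finite ({..d} \<times> ((UNIV :: 'n set) \<rightarrow>\<^sub>E {..d}))"
    by (intro finite_cartesian_product finite_PiE) auto
  ultimately have "finite (?h ` expos_upto d)" by (rule finite_subset)
  moreover have "inj_on ?h (expos_upto d)" by (rule inj_onI) (simp add: prod_eq_iff vec_eq_iff fun_eq_iff)
  ultimately show ?thesis by (rule finite_imageD)
qed

lemma expos_upto_mono: "d \<le> d' \<Longrightarrow> expos_upto d \<subseteq> expos_upto d'"
  by (auto simp: expos_upto_def)

lemma keys_subset_expos_upto_pdeg: "Poly_Mapping.keys q \<subseteq> expos_upto (pdeg q)"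
  by (auto simp: expos_upto_def pdeg_def intro: Max_ge)

lemma pdeg_le_iff: "pdeg q \<le> d \<longleftrightarrow> Poly_Mapping.keys q \<subseteq> expos_upto d"
  by (auto simp: expos_upto_def pdeg_def)

lemma keys_mult_monomial_poly:
  "Poly_Mapping.keys q \<subseteq> expos_upto d \<Longrightarrow> expo_deg \<gamma> \<le> k \<Longrightarrow> Poly_Mapping.keys (q * monomial_poly \<gamma>) \<subseteq> expos_upto (d + k)"
proof
  fix \<beta> assume q: "Poly_Mapping.keys q \<subseteq> expos_upto d" "expo_deg \<gamma> \<le> k"
  assume "\<beta> \<in> Poly_Mapping.keys (q * monomial_poly \<gamma>)"
  then obtain \<alpha> where "\<alpha> \<in> Poly_Mapping.keys q" "\<beta> = \<alpha> + \<gamma>"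
    using keys_mult[of q "monomial_poly \<gamma>"] by (auto simp: monomial_poly_def)
  with q show "\<beta> \<in> expos_upto (d + k)" by (auto simp: expos_upto_def intro: add_mono)
qed

lemma riesz_cong:
  "(\<And>\<beta>. \<beta> \<in> Poly_Mapping.keys q \<Longrightarrow> w \<beta> = w' \<beta>) \<Longrightarrow> riesz w q = riesz w' q"
  unfolding riesz_def by (intro sum.cong) auto

text \<open>
  A localizing matrix evaluated at the coefficient vector of a polynomial \<open>q\<close> is \<open>L(g q\<^sup>2)\<close>.
\<close>

lemma localizing_quadratic_form:
  "(\<Sum>a\<in>I. \<Sum>b\<in>I. c a * localizing g w a b * c b)
     = riesz w (g * ((\<Sum>a\<in>I. Poly_Mapping.single a (c a)) * (\<Sum>b\<in>I. Poly_Mapping.single b (c b))))"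
proof -
  have "riesz w (g * ((\<Sum>a\<in>I. Poly_Mapping.single a (c a)) * (\<Sum>b\<in>I. Poly_Mapping.single b (c b))))
    = (\<Sum>a\<in>I. \<Sum>b\<in>I. riesz w (g * Poly_Mapping.single (a + b) (c a * c b)))"
    by (simp only: sum_product) (simp only: mult_single sum_distrib_left riesz_sum)
  also have "\<dots> = (\<Sum>a\<in>I. \<Sum>b\<in>I. c a * localizing g w a b * c b)"
  proof (intro sum.cong refl)
    fix a b
    have eq: "g * Poly_Mapping.single (a + b) (c a * c b) = Poly_Mapping.single 0 (c a * c b) * (g * monomial_poly (a + b))"
      by (subst single_conv_monomial_poly) (simp add: mult_ac)
    show "riesz w (g * Poly_Mapping.single (a + b) (c a * c b)) = c a * localizing g w a b * c b"
      unfolding eq riesz_scale localizing_def by (simp only: mult_ac)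
  qed
  finally show ?thesis by simp
qed

lemma psd_on_localizingI:
  "(\<And>q. 0 \<le> riesz w (g * (q * q))) \<Longrightarrow> psd_on I (localizing g w)"
  unfolding psd_on_def localizing_quadratic_form
  by (simp add: localizing_def add.commute)

lemma psd_on_localizingD:
  assumes "psd_on (expos_upto d) (localizing g w)" "Poly_Mapping.keys q \<subseteq> expos_upto d"
  shows "0 \<le> riesz w (g * (q * q))"
proof -
  have "q = (\<Sum>\<beta>\<in>Poly_Mapping.keys q. Poly_Mapping.single \<beta> (Poly_Mapping.lookup q \<beta>))"
    by (rule rpoly_eq_sum_singles)
  also have "\<dots> = (\<Sum>\<beta>\<in>expos_upto d. Poly_Mapping.single \<beta> (Poly_Mapping.lookup q \<beta>))"
    by (rule sum.mono_neutral_left[OF finite_expos_upto assms(2)]) (simp add: in_keys_iff)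
  finally have q: "q = (\<Sum>\<beta>\<in>expos_upto d. Poly_Mapping.single \<beta> (Poly_Mapping.lookup q \<beta>))" .
  have "riesz w (g * (q * q)) = (\<Sum>a\<in>expos_upto d. \<Sum>b\<in>expos_upto d.
      Poly_Mapping.lookup q a * localizing g w a b * Poly_Mapping.lookup q b)"
    unfolding localizing_quadratic_form q[symmetric] ..
  then show ?thesis
    using assms(1) unfolding psd_on_def by presburger
qed

lemma psd_on_localizing_diag:
  assumes "psd_on (expos_upto d) (localizing g w)" "expo_deg \<alpha> \<le> d"
  shows "0 \<le> riesz w (g * monomial_poly (\<alpha> + \<alpha>))"
  using psd_on_localizingD[OF assms(1), of "monomial_poly \<alpha>"] assms(2)
  by (simp add: monomial_poly_add) (simp add: monomial_poly_def expos_upto_def)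

lemma psd_on_localizing_subset:
  fixes g :: "'n::finite rpoly"
  assumes "psd_on (expos_upto d) (localizing g w)" "k \<le> d"
  shows "psd_on (expos_upto k) (localizing g w)"
  unfolding psd_on_def localizing_quadratic_form
proof (intro conjI ballI allI)
  fix c :: "'n expo \<Rightarrow> real"
  have "Poly_Mapping.keys (\<Sum>a\<in>expos_upto k. Poly_Mapping.single a (c a)) \<subseteq> expos_upto k"
    by (rule order.trans[OF keys_sum]) (auto split: if_splits)
  also have "\<dots> \<subseteq> expos_upto d" by (rule expos_upto_mono[OF assms(2)])
  finally show "0 \<le> riesz w (g * ((\<Sum>a\<in>expos_upto k. Poly_Mapping.single a (c a)) * (\<Sum>a\<in>expos_upto k. Poly_Mapping.single a (c a))))"
    by (rule psd_on_localizingD[OF assms(1)])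
qed (simp add: localizing_def add.commute)

section \<open>Bounds and subsequences for moment sequences\<close>

lemma ball_poly_mult_monomial:
  "riesz w (ball_poly R * monomial_poly (\<alpha> + \<alpha>))
     = R\<^sup>2 * w (\<alpha> + \<alpha>) - (\<Sum>i\<in>UNIV. w ((\<alpha> + unit_expo i) + (\<alpha> + unit_expo i)))"
proof -
  have t: "(2, 0) + (\<alpha> + \<alpha>) = (\<alpha> + unit_expo None) + (\<alpha> + unit_expo None)"
    by (simp add: unit_expo_def prod_eq_iff)
  have x: "(0, axis k 2) + (\<alpha> + \<alpha>) = (\<alpha> + unit_expo (Some k)) + (\<alpha> + unit_expo (Some k))" for k
    by (simp add: unit_expo_def prod_eq_iff vec_eq_iff axis_def)
  show ?thesis
    unfolding ball_poly_def
    by (simp add: left_diff_distrib sum_distrib_right riesz_sum UNIV_option_conv sum.reindex t x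
        flip: monomial_poly_add)
qed

text \<open>
  The diagonal of the localizing matrix of the ball constraint bounds the moment of \<open>2 (\<alpha> + e_i)\<close> by \<open>R\<^sup>2\<close>
  times that of \<open>2 \<alpha>\<close>, which controls the even moments inductively. An exponent of degree at most \<open>2 d\<close> is
  a sum \<open>\<alpha> + \<beta>\<close> of two halves of degree at most \<open>d\<close>, and positivity at \<open>v_\<alpha> \<plusminus> v_\<beta>\<close> bounds its moment by the
  mean of those of \<open>2 \<alpha>\<close> and \<open>2 \<beta>\<close>. The larger half may have degree \<open>(\<bar>\<gamma>\<bar> + 1) / 2\<close>, whence the exponent
  in the bound. The bound does not involve \<open>d\<close>: this makes the relaxations compact uniformly in the order
  and gives full moment sequences exponential growth.
\<close>

lemma truncated_moment_bound:
  fixes w :: "'n::finite expo \<Rightarrow> real"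
  assumes psd: "psd_on (expos_upto d) (localizing 1 w)"
    and ball: "psd_on (expos_upto (d - 1)) (localizing (ball_poly R) w)"
    and \<gamma>: "expo_deg \<gamma> \<le> 2 * d"
  shows "\<bar>w \<gamma>\<bar> \<le> max 1 \<bar>R\<bar> ^ Suc (expo_deg \<gamma>) * w 0"
proof -
  define \<rho> where "\<rho> = max 1 \<bar>R\<bar>"
  have \<rho>: "\<rho> \<ge> 1" "R\<^sup>2 \<le> \<rho>\<^sup>2"
    by (auto simp: \<rho>_def abs_le_square_iff[symmetric])
  have diag: "0 \<le> w (\<alpha> + \<alpha>)" if "expo_deg \<alpha> \<le> d" for \<alpha>
    using psd_on_localizing_diag[OF psd that] by simp
  have w0: "0 \<le> w 0" using diag[of 0] by simp
  have even: "w (\<alpha> + \<alpha>) \<le> \<rho> ^ (2 * expo_deg \<alpha>) * w 0" if "expo_deg \<alpha> \<le> d" for \<alpha>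
    using that
  proof (induction \<alpha> rule: expo_induct)
    case (add_unit \<alpha> i)
    have le: "expo_deg \<alpha> \<le> d - 1" "Suc (expo_deg \<alpha>) \<le> d" using add_unit.prems by auto
    have "w ((\<alpha> + unit_expo i) + (\<alpha> + unit_expo i)) \<le> (\<Sum>i\<in>UNIV. w ((\<alpha> + unit_expo i) + (\<alpha> + unit_expo i)))"
      by (rule member_le_sum) (use le in \<open>auto intro!: diag\<close>)
    also have "\<dots> \<le> R\<^sup>2 * w (\<alpha> + \<alpha>)"
      using psd_on_localizing_diag[OF ball le(1)] by (simp only: ball_poly_mult_monomial)
    also have "\<dots> \<le> \<rho>\<^sup>2 * (\<rho> ^ (2 * expo_deg \<alpha>) * w 0)"
      using add_unit.IH le(2) \<rho> diag[of \<alpha>] by (intro mult_mono) auto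
    also have "\<dots> = \<rho> ^ (2 * expo_deg (\<alpha> + unit_expo i)) * w 0"
      by (simp add: power2_eq_square)
    finally show ?case .
  qed simp
  have half: "expo_deg \<gamma> div 2 \<le> expo_deg \<gamma>" by simp
  obtain \<alpha> \<beta> where \<alpha>\<beta>: "\<gamma> = \<alpha> + \<beta>" "expo_deg \<alpha> = expo_deg \<gamma> div 2"
    by (rule expo_split[OF half]) (rule that)
  have degs: "expo_deg \<alpha> \<le> d" "expo_deg \<beta> \<le> d" "2 * expo_deg \<alpha> \<le> Suc (expo_deg \<gamma>)" "2 * expo_deg \<beta> \<le> Suc (expo_deg \<gamma>)"
  proof -
    have "expo_deg \<gamma> = expo_deg \<alpha> + expo_deg \<beta>" using \<alpha>\<beta>(1) by simp
    then show "expo_deg \<alpha> \<le> d" "expo_deg \<beta> \<le> d" "2 * expo_deg \<alpha> \<le> Suc (expo_deg \<gamma>)" "2 * expo_deg \<beta> \<le> Suc (expo_deg \<gamma>)"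
      using \<gamma> \<alpha>\<beta>(2) by linarith+
  qed
  have bound: "w (\<delta> + \<delta>) \<le> \<rho> ^ Suc (expo_deg \<gamma>) * w 0" if "expo_deg \<delta> \<le> d" "2 * expo_deg \<delta> \<le> Suc (expo_deg \<gamma>)" for \<delta>
    by (rule order.trans[OF even[OF that(1)] mult_right_mono[OF power_increasing[OF that(2) \<rho>(1)] w0]])
  have key: "0 \<le> w (\<alpha> + \<alpha>) + 2 * s * w (\<alpha> + \<beta>) + w (\<beta> + \<beta>)" if "s\<^sup>2 = 1" for s
  proof -
    let ?q = "monomial_poly \<alpha> + Poly_Mapping.single 0 s * monomial_poly \<beta>"
    have "Poly_Mapping.keys ?q \<subseteq> expos_upto d"
      using degs by (intro order.trans[OF keys_add]) (auto simp: monomial_poly_def mult_single expos_upto_def)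
    from psd_on_localizingD[OF psd this] have "0 \<le> riesz w (?q * ?q)" by simp
    also have "?q * ?q = monomial_poly (\<alpha> + \<alpha>) + Poly_Mapping.single 0 s * monomial_poly (\<alpha> + \<beta>)
        + Poly_Mapping.single 0 s * monomial_poly (\<alpha> + \<beta>)
        + Poly_Mapping.single 0 s * (Poly_Mapping.single 0 s * monomial_poly (\<beta> + \<beta>))"
      by (simp add: monomial_poly_add algebra_simps)
    finally have "0 \<le> w (\<alpha> + \<alpha>) + s * w (\<alpha> + \<beta>) + s * w (\<alpha> + \<beta>) + s * (s * w (\<beta> + \<beta>))"
      by (simp only: riesz_add riesz_scale riesz_monomial_poly)
    also have "s * (s * w (\<beta> + \<beta>)) = w (\<beta> + \<beta>)"
      using that by (simp add: power2_eq_square flip: mult.assoc)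
    finally show ?thesis by simp
  qed
  have "2 * \<bar>w (\<alpha> + \<beta>)\<bar> \<le> w (\<alpha> + \<alpha>) + w (\<beta> + \<beta>)"
    using key[of 1] key[of "-1"] by simp
  also have "\<dots> \<le> 2 * (\<rho> ^ Suc (expo_deg \<gamma>) * w 0)"
    using bound[of \<alpha>] bound[of \<beta>] degs by simp
  finally show ?thesis by (simp add: \<alpha>\<beta>(1) \<rho>_def)
qed

lemma riesz_tendsto:
  "(\<And>\<beta>. (\<lambda>n. w n \<beta>) \<longlonglongrightarrow> w' \<beta>) \<Longrightarrow> (\<lambda>n. riesz (w n) q) \<longlonglongrightarrow> riesz w' q"
  unfolding riesz_def by (intro tendsto_intros)

lemma countable_expo: "countable (A :: 'n::finite expo set)"
proof -
  have "A \<subseteq> (\<Union>d. expos_upto d)" by (auto simp: expos_upto_def)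
  moreover have "countable (\<Union>d. expos_upto d :: 'n expo set)"
    by (rule countable_UN) (auto intro: countable_finite finite_expos_upto)
  ultimately show ?thesis by (rule countable_subset)
qed

text \<open>
  Bolzano-Weierstrass at every point of \<open>S\<close>, followed by a diagonal choice.
\<close>

lemma pointwise_convergent_subsequence:
  fixes f :: "nat \<Rightarrow> 'a \<Rightarrow> real"
  assumes S: "countable S" and bound: "\<And>n x. x \<in> S \<Longrightarrow> \<bar>f n x\<bar> \<le> M x"
  shows "\<exists>r. strict_mono r \<and> (\<forall>x\<in>S. convergent (\<lambda>n. f (r n) x))"
proof (cases "S = {}")
  case True
  then show ?thesis using strict_mono_id by blast
next
  case False
  define e where "e = from_nat_into S"
  have e: "range e = S" using S False by (simp add: e_def range_from_nat_into)
  interpret subseqs "\<lambda>k s. convergent (\<lambda>n. f (s n) (e k))"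
  proof
    fix k and s :: "nat \<Rightarrow> nat"
    have "\<bar>f (s n) (e k)\<bar> \<le> M (e k)" for n using e by (intro bound) blast
    then have "bounded (range (\<lambda>n. f (s n) (e k)))" by (auto simp: bounded_iff)
    from bounded_imp_convergent_subsequence[OF this]
    show "\<exists>r'. strict_mono r' \<and> convergent (\<lambda>n. f ((s \<circ> r') n) (e k))"
      by (auto simp: convergent_def o_def)
  qed
  have stable: "convergent (\<lambda>i. f ((s \<circ> r) i) (e k))"
    if "strict_mono r" "convergent (\<lambda>i. f (s i) (e k))" for r s :: "nat \<Rightarrow> nat" and k
    using convergent_subseq_convergent[OF that(2,1)] by (simp add: o_def)
  have "convergent (\<lambda>n. f (diagseq n) (e k))" for k
  proof -
    have "convergent (\<lambda>n. f (diagseq (n + Suc k)) (e k))"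
      using diagseq_holds[OF stable, of k] by (simp add: o_def add.commute)
    then show ?thesis
      using convergent_ignore_initial_segment[of "\<lambda>n. f (diagseq n) (e k)" "Suc k"] by blast
  qed
  then show ?thesis using subseq_diagseq e by blast
qed

section \<open>Measures and moment sequences\<close>

lemma transport_fun_close:
  assumes "C1_close S \<epsilon> v w" "p \<in> S"
  shows "\<bar>transport_fun F v p - transport_fun F w p\<bar> \<le> \<epsilon> * (1 + (\<Sum>k\<in>UNIV. \<bar>peval (F $ k) p\<bar>))"
proof -
  let ?d = "\<lambda>h. frechet_derivative v (at p) h - frechet_derivative w (at p) h"
  have t: "\<bar>?d (1, 0)\<bar> \<le> \<epsilon>" and x: "\<bar>?d (0, axis k 1)\<bar> \<le> \<epsilon>" for k
    using assms unfolding C1_close_def by (auto simp: Basis_prod_def axis_in_Basis_iff)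
  have "transport_fun F v p - transport_fun F w p = ?d (1, 0) + (\<Sum>k\<in>UNIV. ?d (0, axis k 1) * peval (F $ k) p)"
    by (simp add: transport_fun_def sum_subtractf left_diff_distrib)
  also have "\<bar>\<dots>\<bar> \<le> \<bar>?d (1, 0)\<bar> + (\<Sum>k\<in>UNIV. \<bar>?d (0, axis k 1) * peval (F $ k) p\<bar>)"
    by (intro order.trans[OF abs_triangle_ineq] add_left_mono sum_abs)
  also have "\<dots> \<le> \<epsilon> + (\<Sum>k\<in>UNIV. \<epsilon> * \<bar>peval (F $ k) p\<bar>)"
    using t x by (intro add_mono sum_mono) (auto simp: abs_mult intro: mult_right_mono)
  finally show ?thesis by (simp add: distrib_left sum_distrib_left)
qed

text \<open>
  The defect \<open>D v\<close> of the equation is linear in \<open>v\<close> and vanishes on monomials, hence on polynomials. It is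
  continuous for the C1 distance on \<open>K\<close> enlarged by \<open>a\<close> and \<open>b\<close>, and polynomials are dense for this
  distance. The two points are added because they may lie outside \<open>K\<close>.
\<close>

lemma liouville_monomials_imp_C1:
  fixes \<mu> :: "'j \<Rightarrow> (real \<times> (real^'n::finite)) measure"
  assumes J: "finite J" and \<mu>: "\<And>j. j \<in> J \<Longrightarrow> \<mu> j \<in> finite_borel_measures K" and K: "compact K"
    and mono: "\<And>\<alpha>. (\<Sum>j\<in>J. \<integral>p. transport_fun (f j) (monom_val \<alpha>) p \<partial>\<mu> j) = monom_val \<alpha> b - monom_val \<alpha> a"
    and v: "C1_real v"
  shows "(\<Sum>j\<in>J. \<integral>p. transport_fun (f j) v p \<partial>\<mu> j) = v b - v a"
proof -
  define D where "D v = (\<Sum>j\<in>J. \<integral>p. transport_fun (f j) v p \<partial>\<mu> j) - (v b - v a)" for v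
  have int: "integrable (\<mu> j) (transport_fun (f j) v)" if "C1_real v" "j \<in> J" for v j
    by (rule integrable_continuous_finite_borel_measures[OF \<mu>[OF that(2)] K continuous_on_transport_fun[OF that(1)]])
  have D_poly: "D (peval q) = 0" for q
  proof (induction q rule: rpoly_induct)
    case (single \<beta> c)
    have "peval (Poly_Mapping.single \<beta> c) = (\<lambda>p. c * monom_val \<beta> p)" by (rule ext) simp
    then have "D (peval (Poly_Mapping.single \<beta> c)) = c * D (monom_val \<beta>)"
      by (simp add: D_def transport_fun_scale[OF C1_real_monom_val] right_diff_distrib sum_distrib_left)
    moreover have "D (monom_val \<beta>) = 0" using mono by (simp add: D_def)
    ultimately show ?case by (simp only: mult_zero_right)
  next
    case (add q r)
    have "peval (q + r) = (\<lambda>p. peval q p + peval r p)" by (rule ext) simp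
    then have "D (peval (q + r)) = D (peval q) + D (peval r)"
      using int[OF C1_real_peval]
      by (simp add: D_def transport_fun_add[OF C1_real_peval C1_real_peval] sum.distrib)
    then show ?case using add by (simp only: add_0_left)
  qed
  have "\<exists>B. \<forall>p\<in>K. 1 + (\<Sum>k\<in>UNIV. \<bar>peval (f j $ k) p\<bar>) \<le> B" for j
  proof -
    have "continuous_on UNIV (\<lambda>p. 1 + (\<Sum>k\<in>UNIV. \<bar>peval (f j $ k) p\<bar>))" by (intro continuous_intros)
    from continuous_bounded_on_compact[OF this K] show ?thesis by (metis abs_le_D1)
  qed
  then obtain B where B: "\<And>j p. p \<in> K \<Longrightarrow> 1 + (\<Sum>k\<in>UNIV. \<bar>peval (f j $ k) p\<bar>) \<le> B j" by metis
  define C where "C = (\<Sum>j\<in>J. \<bar>B j\<bar> * measure (\<mu> j) (space (\<mu> j))) + 2"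
  have C: "C > 0" unfolding C_def by (intro add_nonneg_pos sum_nonneg) auto
  have "\<bar>D v\<bar> \<le> \<epsilon> * C" if \<epsilon>: "\<epsilon> > 0" for \<epsilon>
  proof -
    have "bounded (insert a (insert b K))" using compact_imp_bounded[OF K] by simp
    then obtain r where r: "real_polynomial_function r" "C1_close (insert a (insert b K)) \<epsilon> v r"
      using C1_polynomial_approximation[OF v _ \<epsilon>] by blast
    obtain q where q: "r = peval q" using real_polynomial_function_imp_peval[OF r(1)] by blast
    note close = r(2)[unfolded q]
    have "\<bar>(\<integral>p. transport_fun (f j) v p \<partial>\<mu> j) - (\<integral>p. transport_fun (f j) (peval q) p \<partial>\<mu> j)\<bar>
        \<le> \<epsilon> * (\<bar>B j\<bar> * measure (\<mu> j) (space (\<mu> j)))" if j: "j \<in> J" for j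
    proof -
      have "\<bar>transport_fun (f j) v p - transport_fun (f j) (peval q) p\<bar> \<le> \<epsilon> * \<bar>B j\<bar>" if p: "p \<in> K" for p
      proof -
        have "\<epsilon> * (1 + (\<Sum>k\<in>UNIV. \<bar>peval (f j $ k) p\<bar>)) \<le> \<epsilon> * \<bar>B j\<bar>"
          using B[OF p, of j] \<epsilon> by (intro mult_left_mono) auto
        then show ?thesis using transport_fun_close[OF close, of p "f j"] p by auto
      qed
      from integral_close_finite_borel_measures[OF \<mu>[OF j] K continuous_on_transport_fun[OF v]
          continuous_on_transport_fun[OF C1_real_peval] this]
      show ?thesis by (simp add: mult.assoc)
    qed
    then have "\<bar>(\<Sum>j\<in>J. \<integral>p. transport_fun (f j) v p \<partial>\<mu> j) - (\<Sum>j\<in>J. \<integral>p. transport_fun (f j) (peval q) p \<partial>\<mu> j)\<bar>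
        \<le> (\<Sum>j\<in>J. \<epsilon> * (\<bar>B j\<bar> * measure (\<mu> j) (space (\<mu> j))))"
      unfolding sum_subtractf[symmetric] by (intro order.trans[OF sum_abs] sum_mono)
    moreover have "\<bar>v b - peval q b\<bar> \<le> \<epsilon>" "\<bar>v a - peval q a\<bar> \<le> \<epsilon>"
      using close by (auto simp: C1_close_def)
    moreover have "\<epsilon> * C = (\<Sum>j\<in>J. \<epsilon> * (\<bar>B j\<bar> * measure (\<mu> j) (space (\<mu> j)))) + 2 * \<epsilon>"
      by (simp add: C_def distrib_left sum_distrib_left)
    ultimately show ?thesis using D_poly[of q] unfolding D_def by linarith
  qed
  \<comment> \<open>This choice of \<open>\<epsilon>\<close> gives \<open>\<bar>D v\<bar> \<le> \<bar>D v\<bar> / 2\<close>.\<close>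
  from this[of "\<bar>D v\<bar> / (2 * C)"] C have "D v = 0" by (cases "D v = 0") auto
  then show ?thesis by (simp add: D_def)
qed

lemma measure_moments_riesz:
  assumes \<mu>: "\<mu> \<in> finite_borel_measures K" and K: "compact K"
  shows "riesz (\<lambda>\<beta>. \<integral>p. monom_val \<beta> p \<partial>\<mu>) q = (\<integral>p. peval q p \<partial>\<mu>)"
proof -
  have "integrable \<mu> (monom_val \<beta>)" for \<beta>
    by (rule integrable_continuous_finite_borel_measures[OF \<mu> K continuous_on_monom_val])
  then show ?thesis by (simp add: riesz_def peval_def)
qed

lemma measure_moments_feasible:
  fixes g :: "nat \<Rightarrow> ('n::finite) rpoly"
  assumes K: "K = {p. \<forall>i\<in>{1..nK}. 0 \<le> peval (g i) p}" and g0: "g 0 = 1" and comp: "compact K"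
    and \<mu>: "\<mu> \<in> measure_feasible m K f T x0 xT"
  shows "(\<lambda>j\<in>{1..m}. \<lambda>\<beta>. \<integral>p. monom_val \<beta> p \<partial>\<mu> j) \<in> moment_feasible m nK g f T x0 xT" (is "?y \<in> _")
proof -
  have fb: "\<mu> j \<in> finite_borel_measures K" if "j \<in> {1..m}" for j
    using \<mu> that by (auto simp: measure_feasible_def)
  have r: "riesz (?y j) q = (\<integral>p. peval q p \<partial>\<mu> j)" if "j \<in> {1..m}" for j q
    using measure_moments_riesz[OF fb[OF that] comp] that by simp
  have "liouville_eq m f T x0 xT ?y \<alpha>" for \<alpha>
  proof -
    have "(\<Sum>j=1..m. riesz (?y j) (transport_poly (f j) (monomial_poly \<alpha>)))
        = (\<Sum>j=1..m. \<integral>p. transport_fun (f j) (monom_val \<alpha>) p \<partial>\<mu> j)"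
      by (intro sum.cong refl) (simp only: r transport_fun_monom_val)
    also have "\<dots> = monom_val \<alpha> (T, xT) - monom_val \<alpha> (0, x0)"
      using \<mu> C1_real_monom_val[of \<alpha>] unfolding measure_feasible_def C1_fun_iff_C1_real by blast
    finally show ?thesis by (simp only: liouville_eq_def)
  qed
  moreover have "psd_on (expos_upto d) (localizing (g i) (?y j))" if i: "i \<in> {0..nK}" and j: "j \<in> {1..m}" for i j d
  proof (rule psd_on_localizingI)
    fix q
    have "space (\<mu> j) = K"
      using fb[OF j] sets_eq_imp_space_eq[of "\<mu> j" "restrict_space borel K"]
      by (simp add: finite_borel_measures_def space_restrict_space)
    moreover have "0 \<le> peval (g i) p" if "p \<in> K" for p
      using that i K g0 by (cases "i = 0") auto
    ultimately have "0 \<le> (\<integral>p. peval (g i * (q * q)) p \<partial>\<mu> j)"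
      by (intro integral_nonneg_AE AE_I2) simp
    then show "0 \<le> riesz (?y j) (g i * (q * q))" by (simp only: r[OF j])
  qed
  ultimately show ?thesis by (simp add: moment_feasible_def)
qed

text \<open>
  The moments of a feasible tuple of measures form a feasible tuple of sequences of the same cost.
\<close>

lemma moment_value_le_measure_value:
  fixes g l :: "nat \<Rightarrow> ('n::finite) rpoly"
  assumes K: "K = {p. \<forall>i\<in>{1..nK}. 0 \<le> peval (g i) p}" and g0: "g 0 = 1" and comp: "compact K"
  shows "moment_value m nK g l f T x0 xT \<le> measure_value m K l f T x0 xT"
  unfolding moment_value_def measure_value_def
proof (rule INF_mono)
  fix \<mu> assume \<mu>: "\<mu> \<in> measure_feasible m K f T x0 xT"
  let ?y = "\<lambda>j\<in>{1..m}. \<lambda>\<beta>. \<integral>p. monom_val \<beta> p \<partial>\<mu> j"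
  have "(\<Sum>j=1..m. riesz (?y j) (l j)) = (\<Sum>j=1..m. \<integral>p. peval (l j) p \<partial>\<mu> j)"
  proof (intro sum.cong refl)
    fix j assume j: "j \<in> {1..m}"
    then have "\<mu> j \<in> finite_borel_measures K" using \<mu> by (auto simp: measure_feasible_def)
    from measure_moments_riesz[OF this comp] j show "riesz (?y j) (l j) = (\<integral>p. peval (l j) p \<partial>\<mu> j)" by simp
  qed
  then show "\<exists>y\<in>moment_feasible m nK g f T x0 xT. ereal (\<Sum>j=1..m. riesz (y j) (l j)) \<le> ereal (\<Sum>j=1..m. \<integral>p. peval (l j) p \<partial>\<mu> j)"
    using measure_moments_feasible[OF K g0 comp \<mu>] by (intro bexI[of _ ?y]) simp_all
qed

lemma moment_feasible_psd_bounded: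
  fixes g :: "nat \<Rightarrow> ('n::finite) rpoly"
  assumes g0: "g 0 = 1" and ball: "i0 \<in> {1..nK}" "g i0 = ball_poly R"
    and y: "y \<in> moment_feasible m nK g f T x0 xT" and j: "j \<in> {1..m}"
  shows "psd_bounded (max 1 \<bar>R\<bar>) (y j)"
    and "i \<in> {0..nK} \<Longrightarrow> 0 \<le> riesz (y j) (g i * (q * q))"
proof -
  have psd: "psd_on (expos_upto d) (localizing (g i) (y j))" if "i \<in> {0..nK}" for i d
    using y j that by (auto simp: moment_feasible_def)
  show nonneg: "0 \<le> riesz (y j) (g i * (q * q))" if "i \<in> {0..nK}" for i q
    by (rule psd_on_localizingD[OF psd[OF that] keys_subset_expos_upto_pdeg])
  have "\<bar>y j \<gamma>\<bar> \<le> (max 1 \<bar>R\<bar> * y j 0) * max 1 \<bar>R\<bar> ^ expo_deg \<gamma>" for \<gamma>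
  proof -
    have "\<bar>y j \<gamma>\<bar> \<le> max 1 \<bar>R\<bar> ^ Suc (expo_deg \<gamma>) * y j 0"
      using psd[of 0 "expo_deg \<gamma>"] psd[of i0 "expo_deg \<gamma> - 1"] ball g0
      by (intro truncated_moment_bound[where d="expo_deg \<gamma>"]) auto
    then show ?thesis by (simp add: mult_ac)
  qed
  then show "psd_bounded (max 1 \<bar>R\<bar>) (y j)"
    unfolding psd_bounded_def using nonneg[of 0] g0 by auto
qed

text \<open>
  Every component of a feasible tuple of sequences has a representing measure on \<open>K\<close>, and the equation for
  monomials extends to all C1 test functions by density.
\<close>

lemma measure_value_le_moment_value:
  fixes g l :: "nat \<Rightarrow> ('n::finite) rpoly"
  assumes K: "K = {p. \<forall>i\<in>{1..nK}. 0 \<le> peval (g i) p}" and g0: "g 0 = 1" and comp: "compact K"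
    and ball: "i0 \<in> {1..nK}" "g i0 = ball_poly R"
  shows "measure_value m K l f T x0 xT \<le> moment_value m nK g l f T x0 xT"
  unfolding moment_value_def measure_value_def
proof (rule INF_mono)
  fix y assume y: "y \<in> moment_feasible m nK g f T x0 xT"
  note bounded = moment_feasible_psd_bounded[OF g0 ball y]
  have "\<exists>\<mu>. \<mu> \<in> finite_borel_measures K \<and> (\<forall>q. riesz (y j) q = (\<integral>p. peval q p \<partial>\<mu>))" if j: "j \<in> {1..m}" for j
  proof -
    have R: "0 < max 1 \<bar>R\<bar>" by simp
    have loc: "0 \<le> riesz (y j) (g i * (q * q))" if "i \<in> {1..nK}" for i q
      using bounded(2)[OF j] that by simp
    from representing_measure_semialgebraic[OF R bounded(1)[OF j] loc K finite_atLeastAtMost]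
    show ?thesis by metis
  qed
  then obtain \<nu> where \<nu>: "\<And>j. j \<in> {1..m} \<Longrightarrow> \<nu> j \<in> finite_borel_measures K"
    "\<And>j q. j \<in> {1..m} \<Longrightarrow> riesz (y j) q = (\<integral>p. peval q p \<partial>\<nu> j)" by metis
  define \<mu> where "\<mu> = (\<lambda>j\<in>{1..m}. \<nu> j)"
  have \<mu>: "\<mu> j \<in> finite_borel_measures K" "riesz (y j) q = (\<integral>p. peval q p \<partial>\<mu> j)" if "j \<in> {1..m}" for j q
    using \<nu> that by (simp_all add: \<mu>_def)
  have mono: "(\<Sum>j=1..m. \<integral>p. transport_fun (f j) (monom_val \<alpha>) p \<partial>\<mu> j) = monom_val \<alpha> (T, xT) - monom_val \<alpha> (0, x0)" for \<alpha>
  proof -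
    have "(\<Sum>j=1..m. \<integral>p. transport_fun (f j) (monom_val \<alpha>) p \<partial>\<mu> j)
        = (\<Sum>j=1..m. riesz (y j) (transport_poly (f j) (monomial_poly \<alpha>)))"
      by (intro sum.cong refl) (simp only: \<mu>(2) transport_fun_monom_val)
    also have "\<dots> = monom_val \<alpha> (T, xT) - monom_val \<alpha> (0, x0)"
      using y unfolding moment_feasible_def liouville_eq_def by blast
    finally show ?thesis .
  qed
  have "\<mu> \<in> measure_feasible m K f T x0 xT"
    unfolding measure_feasible_def C1_fun_iff_C1_real
    using liouville_monomials_imp_C1[OF finite_atLeastAtMost \<mu>(1) comp mono] \<mu>(1)
    by (auto simp: PiE_iff) (simp add: \<mu>_def)
  moreover have "(\<Sum>j=1..m. \<integral>p. peval (l j) p \<partial>\<mu> j) = (\<Sum>j=1..m. riesz (y j) (l j))"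
    by (intro sum.cong refl) (simp only: \<mu>(2))
  ultimately show "\<exists>\<mu>\<in>measure_feasible m K f T x0 xT. ereal (\<Sum>j=1..m. \<integral>p. peval (l j) p \<partial>\<mu> j) \<le> ereal (\<Sum>j=1..m. riesz (y j) (l j))"
    by (intro bexI[of _ \<mu>]) simp_all
qed

section \<open>Monotonicity of the relaxations\<close>

lemma basis_order_keys:
  fixes g l :: "nat \<Rightarrow> ('n::finite) rpoly"
  assumes "basis_order m nK g l f \<le> d"
  shows "j \<in> {1..m} \<Longrightarrow> Poly_Mapping.keys (l j) \<subseteq> expos_upto (2 * d)"
    and "i \<in> {0..nK} \<Longrightarrow> Poly_Mapping.keys (g i) \<subseteq> expos_upto (2 * d)"
proof -
  let ?P = "\<lambda>d. (\<forall>j\<in>{1..m}. Poly_Mapping.keys (l j) \<subseteq> expos_upto (2 * d)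
        \<and> (\<forall>k. Poly_Mapping.keys (f j $ k) \<subseteq> expos_upto (2 * d)))
     \<and> (\<forall>i\<in>{0..nK}. Poly_Mapping.keys (g i) \<subseteq> expos_upto (2 * d))"
  define N where "N = Max ((\<lambda>j. pdeg (l j)) ` {1..m} \<union> (\<lambda>(j, k). pdeg (f j $ k)) ` ({1..m} \<times> UNIV) \<union> (\<lambda>i. pdeg (g i)) ` {0..nK})"
  have N: "pdeg q \<le> 2 * N" if "pdeg q \<in> (\<lambda>j. pdeg (l j)) ` {1..m} \<union> (\<lambda>(j, k). pdeg (f j $ k)) ` ({1..m} \<times> UNIV) \<union> (\<lambda>i. pdeg (g i)) ` {0..nK}" for q :: "'n rpoly"
  proof -
    have "pdeg q \<le> N" unfolding N_def by (rule Max_ge[OF _ that]) auto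
    then show ?thesis by simp
  qed
  have "?P N"
    unfolding pdeg_le_iff[symmetric] by (intro conjI ballI allI N) auto
  then have "?P (basis_order m nK g l f)" unfolding basis_order_def by (rule LeastI)
  moreover have "expos_upto (2 * basis_order m nK g l f) \<subseteq> (expos_upto (2 * d) :: 'n expo set)"
    using assms by (intro expos_upto_mono) simp
  ultimately show "j \<in> {1..m} \<Longrightarrow> Poly_Mapping.keys (l j) \<subseteq> expos_upto (2 * d)"
    "i \<in> {0..nK} \<Longrightarrow> Poly_Mapping.keys (g i) \<subseteq> expos_upto (2 * d)" by blast+
qed

text \<open>
  All polynomials in the constraints of order \<open>d\<close> and in the cost have degree at most \<open>2 d\<close>, so they do not
  see the entries that are cut off. The sequences \<open>z\<close> come either from the next relaxation or from the
  full moment problem.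
\<close>

lemma truncation_relax_feasible:
  fixes g l :: "nat \<Rightarrow> ('n::finite) rpoly"
  assumes d: "basis_order m nK g l f \<le> d"
    and liouville: "\<And>\<alpha>. \<alpha> \<in> test_expos m f d \<Longrightarrow> liouville_eq m f T x0 xT z \<alpha>"
    and psd: "\<And>i j. i \<in> {0..nK} \<Longrightarrow> j \<in> {1..m} \<Longrightarrow>
      psd_on (expos_upto (d - nat \<lceil>real (pdeg (g i)) / 2\<rceil>)) (localizing (g i) (z j))"
  defines "y \<equiv> (\<lambda>j\<in>{1..m}. restrict (z j) (expos_upto (2 * d)))"
  shows "y \<in> relax_feasible m nK g f T x0 xT d"
    and "(\<Sum>j=1..m. riesz (y j) (l j)) = (\<Sum>j=1..m. riesz (z j) (l j))"
proof -
  have agree: "riesz (y j) q = riesz (z j) q" if "j \<in> {1..m}" "Poly_Mapping.keys q \<subseteq> expos_upto (2 * d)" for j q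
    using that by (intro riesz_cong) (auto simp: y_def)
  show "(\<Sum>j=1..m. riesz (y j) (l j)) = (\<Sum>j=1..m. riesz (z j) (l j))"
    by (intro sum.cong refl agree basis_order_keys(1)[OF d])
  have "liouville_eq m f T x0 xT y \<alpha>" if \<alpha>: "\<alpha> \<in> test_expos m f d" for \<alpha>
  proof -
    have "(\<Sum>j=1..m. riesz (y j) (transport_poly (f j) (monomial_poly \<alpha>)))
        = (\<Sum>j=1..m. riesz (z j) (transport_poly (f j) (monomial_poly \<alpha>)))"
      using \<alpha> by (intro sum.cong refl agree) (auto simp: test_expos_def pdeg_le_iff)
    then show ?thesis using liouville[OF \<alpha>] by (simp add: liouville_eq_def)
  qed
  moreover have "psd_on (expos_upto (d - nat \<lceil>real (pdeg (g i)) / 2\<rceil>)) (localizing (g i) (y j))"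
    if i: "i \<in> {0..nK}" and j: "j \<in> {1..m}" for i j
  proof -
    define h where "h = nat \<lceil>real (pdeg (g i)) / 2\<rceil>"
    have "pdeg (g i) \<le> 2 * d" using basis_order_keys(2)[OF d i] by (simp add: pdeg_le_iff)
    then have h: "h \<le> d" "pdeg (g i) \<le> 2 * h" unfolding h_def by linarith+
    have "localizing (g i) (y j) a b = localizing (g i) (z j) a b"
      if "a \<in> expos_upto (d - h)" "b \<in> expos_upto (d - h)" for a b
      unfolding localizing_def
    proof (rule agree[OF j])
      have "Poly_Mapping.keys (g i) \<subseteq> expos_upto (2 * h)" using h(2) by (simp only: pdeg_le_iff)
      then have "Poly_Mapping.keys (g i * monomial_poly (a + b)) \<subseteq> expos_upto (2 * h + 2 * (d - h))"
        by (rule keys_mult_monomial_poly) (use that in \<open>simp add: expos_upto_def\<close>)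
      then show "Poly_Mapping.keys (g i * monomial_poly (a + b)) \<subseteq> expos_upto (2 * d)"
        using h by (simp add: distrib_left[symmetric])
    qed
    then show ?thesis
      using psd[OF i j] unfolding h_def[symmetric] psd_on_def by simp
  qed
  ultimately show "y \<in> relax_feasible m nK g f T x0 xT d"
    by (auto simp: relax_feasible_def y_def PiE_iff)
qed

lemma relax_value_mono:
  fixes g l :: "nat \<Rightarrow> ('n::finite) rpoly"
  assumes d: "basis_order m nK g l f \<le> d"
  shows "relax_value m nK g l f T x0 xT d \<le> relax_value m nK g l f T x0 xT (Suc d)"
  unfolding relax_value_def
proof (rule INF_mono)
  fix z assume z: "z \<in> relax_feasible m nK g f T x0 xT (Suc d)"
  have "test_expos m f d \<subseteq> test_expos m f (Suc d)" by (auto simp: test_expos_def)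
  then have 1: "liouville_eq m f T x0 xT z \<alpha>" if "\<alpha> \<in> test_expos m f d" for \<alpha>
    using z that by (auto simp: relax_feasible_def)
  have 2: "psd_on (expos_upto (d - nat \<lceil>real (pdeg (g i)) / 2\<rceil>)) (localizing (g i) (z j))"
    if "i \<in> {0..nK}" "j \<in> {1..m}" for i j
    by (rule psd_on_localizing_subset[of "Suc d - nat \<lceil>real (pdeg (g i)) / 2\<rceil>"])
       (use z that in \<open>auto simp: relax_feasible_def\<close>)
  show "\<exists>y\<in>relax_feasible m nK g f T x0 xT d. ereal (\<Sum>j=1..m. riesz (y j) (l j)) \<le> ereal (\<Sum>j=1..m. riesz (z j) (l j))"
    by (rule bexI[OF _ truncation_relax_feasible(1)[OF d 1 2]])
       (simp_all only: truncation_relax_feasible(2)[OF d 1 2] order_refl)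
qed

lemma relax_value_le_moment_value:
  fixes g l :: "nat \<Rightarrow> ('n::finite) rpoly"
  assumes d: "basis_order m nK g l f \<le> d"
  shows "relax_value m nK g l f T x0 xT d \<le> moment_value m nK g l f T x0 xT"
  unfolding relax_value_def moment_value_def
proof (rule INF_mono)
  fix z assume z: "z \<in> moment_feasible m nK g f T x0 xT"
  have 1: "liouville_eq m f T x0 xT z \<alpha>" for \<alpha>
    using z unfolding moment_feasible_def by blast
  have 2: "psd_on (expos_upto (d - nat \<lceil>real (pdeg (g i)) / 2\<rceil>)) (localizing (g i) (z j))"
    if "i \<in> {0..nK}" "j \<in> {1..m}" for i j
    using z that by (auto simp: moment_feasible_def)
  show "\<exists>y\<in>relax_feasible m nK g f T x0 xT d. ereal (\<Sum>j=1..m. riesz (y j) (l j)) \<le> ereal (\<Sum>j=1..m. riesz (z j) (l j))"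
    by (rule bexI[OF _ truncation_relax_feasible(1)[OF d 1 2]])
       (simp_all only: truncation_relax_feasible(2)[OF d 1 2] order_refl)
qed

section \<open>Convergence of the relaxations\<close>

text \<open>
  The test function t, whose derivative along every trajectory is 1, turns the equation into a statement
  about the masses.
\<close>

lemma transport_poly_time: "transport_poly F (monomial_poly (unit_expo None)) = 1"
  by (simp add: transport_poly_def pderiv_t_def pderiv_x_def monomial_poly_def unit_expo_def)

lemma pdeg_one: "pdeg 1 = 0"
  by (simp add: pdeg_def)

lemma total_mass:
  assumes "liouville_eq m f T x0 xT y (unit_expo None)"
  shows "(\<Sum>j=1..m. y j 0) = T"
  using assms by (simp add: liouville_eq_def transport_poly_time coord_def)

lemma pdeg_ball_poly: "pdeg (ball_poly R :: ('n::finite) rpoly) \<le> 2"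
proof -
  have "Poly_Mapping.keys (\<Sum>k\<in>UNIV. monomial_poly (0, axis k 2) :: 'n rpoly) \<subseteq> expos_upto 2"
    by (rule order.trans[OF keys_sum]) (auto simp: monomial_poly_def expos_upto_def expo_deg_def sum_axis)
  moreover have "Poly_Mapping.keys (Poly_Mapping.single 0 (R\<^sup>2) - monomial_poly (2, 0) :: 'n rpoly) \<subseteq> expos_upto 2"
    by (rule order.trans[OF keys_diff]) (auto simp: monomial_poly_def expos_upto_def expo_deg_def)
  ultimately show ?thesis
    unfolding pdeg_le_iff ball_poly_def by (intro order.trans[OF keys_diff]) auto
qed

text \<open>
  Each mass is at most the total mass \<open>T\<close>, and the ball constraint bounds all other moments by the masses.
\<close>

lemma relax_feasible_bound:
  fixes g :: "nat \<Rightarrow> ('n::finite) rpoly"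
  assumes g0: "g 0 = 1" and ball: "i0 \<in> {1..nK}" "g i0 = ball_poly R"
    and y: "y \<in> relax_feasible m nK g f T x0 xT d" and j: "j \<in> {1..m}" and \<gamma>: "expo_deg \<gamma> \<le> 2 * d"
  shows "\<bar>y j \<gamma>\<bar> \<le> max 1 \<bar>R\<bar> ^ Suc (expo_deg \<gamma>) * T"
proof -
  have psd: "psd_on (expos_upto (d - nat \<lceil>real (pdeg (g i)) / 2\<rceil>)) (localizing (g i) (y j))"
    if "i \<in> {0..nK}" "j \<in> {1..m}" for i j
    using y that by (auto simp: relax_feasible_def)
  have one: "psd_on (expos_upto d) (localizing 1 (y j))" if "j \<in> {1..m}" for j
    using psd[OF _ that, of 0] g0 by (simp add: pdeg_one)
  have pos: "0 \<le> y j 0" if "j \<in> {1..m}" for j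
    using psd_on_localizing_diag[OF one[OF that], of 0] by simp
  have "unit_expo None \<in> test_expos m f d"
    by (simp add: test_expos_def transport_poly_time pdeg_one)
  then have "(\<Sum>j=1..m. y j 0) = T" using y by (intro total_mass) (auto simp: relax_feasible_def)
  moreover have "y j 0 \<le> (\<Sum>j=1..m. y j 0)" by (rule member_le_sum) (use j pos in auto)
  ultimately have mass: "y j 0 \<le> T" by simp
  have "nat \<lceil>real (pdeg (ball_poly R :: 'n rpoly)) / 2\<rceil> \<le> 1" using pdeg_ball_poly[where 'n='n, of R] by (simp add: nat_le_iff ceiling_le_iff)
  then have le: "d - 1 \<le> d - nat \<lceil>real (pdeg (ball_poly R :: 'n rpoly)) / 2\<rceil>"
    by (rule diff_le_mono2)
  have "psd_on (expos_upto (d - 1)) (localizing (ball_poly R) (y j))"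
    by (rule psd_on_localizing_subset[OF psd[of i0 j, unfolded ball(2)] le]) (use ball(1) j in auto)
  from truncated_moment_bound[OF one[OF j] this \<gamma>]
  have "\<bar>y j \<gamma>\<bar> \<le> max 1 \<bar>R\<bar> ^ Suc (expo_deg \<gamma>) * y j 0" .
  also have "\<dots> \<le> max 1 \<bar>R\<bar> ^ Suc (expo_deg \<gamma>) * T"
    using mass by (rule mult_left_mono) simp
  finally show ?thesis .
qed

text \<open>
  The bounds on the entries of \<open>y d\<close> do not depend on \<open>d\<close>, so the entries converge along a subsequence. A
  constraint of the moment problem involves finitely many entries and is implied by the constraints of all
  relaxations of large order; hence it holds for the limit.
\<close>

lemma moment_feasible_limit:
  fixes g l :: "nat \<Rightarrow> ('n::finite) rpoly"
  assumes g0: "g 0 = 1" and ball: "i0 \<in> {1..nK}" "g i0 = ball_poly R"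
    and y: "\<And>d. d \<ge> d0 \<Longrightarrow> y d \<in> relax_feasible m nK g f T x0 xT d"
    and val: "\<And>d. d \<ge> d0 \<Longrightarrow> (\<Sum>j=1..m. riesz (y d j) (l j)) \<le> c"
  shows "\<exists>z\<in>moment_feasible m nK g f T x0 xT. (\<Sum>j=1..m. riesz (z j) (l j)) \<le> c"
proof -
  \<comment> \<open>Entries of \<open>y d\<close> of degree above \<open>2 d\<close> carry no information; the value 0 keeps them bounded.\<close>
  define u where "u n jb = (if expo_deg (snd jb) \<le> 2 * (n + d0) then y (n + d0) (fst jb) (snd jb) else 0)"
    for n and jb :: "nat \<times> 'n expo"
  let ?S = "{1..m} \<times> (UNIV :: 'n expo set)"
  have S: "countable ?S" by (intro countable_SIGMA countable_finite countable_expo) simp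
  have u_bound: "\<bar>u n jb\<bar> \<le> \<bar>max 1 \<bar>R\<bar> ^ Suc (expo_deg (snd jb)) * T\<bar>" if "jb \<in> ?S" for n jb
  proof (cases "expo_deg (snd jb) \<le> 2 * (n + d0)")
    case True
    have "fst jb \<in> {1..m}" using that by auto
    from relax_feasible_bound[OF g0 ball y[of "n + d0"] this True] True
    show ?thesis unfolding u_def by (simp only: if_True) linarith
  qed (simp add: u_def)
  have "\<exists>r. strict_mono r \<and> (\<forall>jb\<in>?S. convergent (\<lambda>n. u (r n) jb))"
    by (rule pointwise_convergent_subsequence[OF S]) (rule u_bound)
  then obtain r where r: "strict_mono r" and conv: "\<And>jb. jb \<in> ?S \<Longrightarrow> convergent (\<lambda>n. u (r n) jb)"
    by blast
  define e where "e n = r n + d0" for n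
  have e_ge: "n \<le> e n" for n using seq_suble[OF r, of n] by (simp add: e_def)
  define z where "z = (\<lambda>j\<in>{1..m}. \<lambda>\<beta>. lim (\<lambda>n. u (r n) (j, \<beta>)))"
  have lim: "(\<lambda>n. y (e n) j \<beta>) \<longlonglongrightarrow> z j \<beta>" if j: "j \<in> {1..m}" for j \<beta>
  proof -
    have "(\<lambda>n. u (r n) (j, \<beta>)) \<longlonglongrightarrow> z j \<beta>"
      using conv[of "(j, \<beta>)"] j by (simp add: z_def convergent_LIMSEQ_iff)
    moreover have "\<forall>\<^sub>F n in sequentially. u (r n) (j, \<beta>) = y (e n) j \<beta>"
    proof (rule eventually_sequentiallyI)
      fix n assume "expo_deg \<beta> \<le> n"
      also have "n \<le> e n" by (rule e_ge)
      also have "e n \<le> 2 * (r n + d0)" by (simp add: e_def)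
      finally have "expo_deg \<beta> \<le> 2 * (r n + d0)" .
      then show "u (r n) (j, \<beta>) = y (e n) j \<beta>" by (simp add: u_def e_def)
    qed
    ultimately show ?thesis by (rule Lim_transform_eventually)
  qed
  have lim_riesz: "(\<lambda>n. riesz (y (e n) j) q) \<longlonglongrightarrow> riesz (z j) q" if "j \<in> {1..m}" for j q
    by (intro riesz_tendsto lim that)
  have feas: "y (e n) \<in> relax_feasible m nK g f T x0 xT (e n)" for n
    by (rule y) (simp add: e_def)
  have "liouville_eq m f T x0 xT z \<alpha>" for \<alpha>
  proof -
    define D where "D = Max (insert 0 ((\<lambda>j. pdeg (transport_poly (f j) (monomial_poly \<alpha>))) ` {1..m}))"
    have D: "pdeg (transport_poly (f j) (monomial_poly \<alpha>)) \<le> D" if "j \<in> {1..m}" for j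
      unfolding D_def using that by (intro Max_ge) auto
    have "(\<lambda>n. \<Sum>j=1..m. riesz (y (e n) j) (transport_poly (f j) (monomial_poly \<alpha>)))
        \<longlonglongrightarrow> (\<Sum>j=1..m. riesz (z j) (transport_poly (f j) (monomial_poly \<alpha>)))"
      by (intro tendsto_sum lim_riesz)
    moreover have "\<forall>\<^sub>F n in sequentially. (\<Sum>j=1..m. riesz (y (e n) j) (transport_poly (f j) (monomial_poly \<alpha>)))
        = monom_val \<alpha> (T, xT) - monom_val \<alpha> (0, x0)"
    proof (rule eventually_sequentiallyI)
      fix n assume "n \<ge> D"
      then have "D \<le> 2 * e n" using e_ge[of n] by linarith
      then have "\<alpha> \<in> test_expos m f (e n)" unfolding test_expos_def using D by fastforce
      then show "(\<Sum>j=1..m. riesz (y (e n) j) (transport_poly (f j) (monomial_poly \<alpha>)))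
        = monom_val \<alpha> (T, xT) - monom_val \<alpha> (0, x0)"
        using feas[of n] by (simp add: relax_feasible_def liouville_eq_def)
    qed
    ultimately have "(\<lambda>n. monom_val \<alpha> (T, xT) - monom_val \<alpha> (0, x0))
        \<longlonglongrightarrow> (\<Sum>j=1..m. riesz (z j) (transport_poly (f j) (monomial_poly \<alpha>)))"
      by (rule Lim_transform_eventually)
    then show ?thesis unfolding liouville_eq_def by (simp add: LIMSEQ_const_iff)
  qed
  moreover have "psd_on (expos_upto d) (localizing (g i) (z j))" if i: "i \<in> {0..nK}" and j: "j \<in> {1..m}" for i j d
  proof (rule psd_on_localizingI)
    fix q
    define h where "h = nat \<lceil>real (pdeg (g i)) / 2\<rceil>"
    show "0 \<le> riesz (z j) (g i * (q * q))"
    proof (rule tendsto_lowerbound[OF lim_riesz[OF j]])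
      show "\<forall>\<^sub>F n in sequentially. 0 \<le> riesz (y (e n) j) (g i * (q * q))"
      proof (rule eventually_sequentiallyI)
        fix n assume "n \<ge> pdeg q + h"
        then have "pdeg q \<le> e n - h" using e_ge[of n] by linarith
        then have "Poly_Mapping.keys q \<subseteq> expos_upto (e n - h)" by (simp only: pdeg_le_iff)
        moreover have "psd_on (expos_upto (e n - h)) (localizing (g i) (y (e n) j))"
          using feas[of n] i j unfolding relax_feasible_def h_def by blast
        ultimately show "0 \<le> riesz (y (e n) j) (g i * (q * q))" by (rule psd_on_localizingD[rotated])
      qed
    qed simp
  qed
  ultimately have "z \<in> moment_feasible m nK g f T x0 xT"
    by (simp add: moment_feasible_def z_def)
  moreover have "(\<Sum>j=1..m. riesz (z j) (l j)) \<le> c"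
  proof (rule tendsto_upperbound)
    show "(\<lambda>n. \<Sum>j=1..m. riesz (y (e n) j) (l j)) \<longlonglongrightarrow> (\<Sum>j=1..m. riesz (z j) (l j))"
      by (intro tendsto_sum lim_riesz)
    show "\<forall>\<^sub>F n in sequentially. (\<Sum>j=1..m. riesz (y (e n) j) (l j)) \<le> c"
      by (intro always_eventually allI val) (simp add: e_def)
  qed simp
  ultimately show ?thesis by blast
qed

text \<open>
  By monotonicity the limit is the supremum. If that were smaller than the moment value, some real \<open>c\<close> would
  lie strictly between them; the relaxations would have feasible points of cost below \<open>c\<close> at every order,
  and their limit point would be a moment sequence of cost at most \<open>c\<close>.
\<close>

theorem relax_value_tendsto_moment_value:
  fixes g l :: "nat \<Rightarrow> ('n::finite) rpoly"
  assumes g0: "g 0 = 1" and ball: "i0 \<in> {1..nK}" "g i0 = ball_poly R"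
  shows "(\<lambda>d. relax_value m nK g l f T x0 xT d) \<longlonglongrightarrow> moment_value m nK g l f T x0 xT"
proof -
  define d0 where "d0 = basis_order m nK g l f"
  let ?p = "\<lambda>d. relax_value m nK g l f T x0 xT d" and ?L = "moment_value m nK g l f T x0 xT"
  have inc: "incseq (\<lambda>n. ?p (n + d0))"
    by (rule incseq_SucI) (simp add: d0_def relax_value_mono[of m nK g l f])
  have le: "?p d \<le> ?L" if "d \<ge> d0" for d using that by (simp add: relax_value_le_moment_value d0_def)
  have "?L \<le> (SUP n. ?p (n + d0))"
  proof (rule ccontr)
    assume "\<not> ?L \<le> (SUP n. ?p (n + d0))"
    then obtain c where c: "(SUP n. ?p (n + d0)) < ereal c" "ereal c < ?L"
      using ereal_dense2[of "SUP n. ?p (n + d0)" ?L] by (auto simp: not_le)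
    have "\<exists>y\<in>relax_feasible m nK g f T x0 xT d. ereal (\<Sum>j=1..m. riesz (y j) (l j)) < ereal c" if "d \<ge> d0" for d
    proof -
      have "?p (d - d0 + d0) \<le> (SUP n. ?p (n + d0))" by (rule SUP_upper) simp
      then have "?p d < ereal c" using c(1) that by simp
      then show ?thesis by (simp add: relax_value_def INF_less_iff)
    qed
    then obtain y where y: "\<And>d. d \<ge> d0 \<Longrightarrow> y d \<in> relax_feasible m nK g f T x0 xT d"
      "\<And>d. d \<ge> d0 \<Longrightarrow> ereal (\<Sum>j=1..m. riesz (y d j) (l j)) < ereal c" by metis
    have "(\<Sum>j=1..m. riesz (y d j) (l j)) \<le> c" if "d \<ge> d0" for d
      using y(2)[OF that] by simp
    from moment_feasible_limit[OF g0 ball y(1) this]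
    obtain z where z: "z \<in> moment_feasible m nK g f T x0 xT" "(\<Sum>j=1..m. riesz (z j) (l j)) \<le> c" by blast
    have "?L \<le> ereal (\<Sum>j=1..m. riesz (z j) (l j))"
      unfolding moment_value_def by (rule INF_lower[OF z(1)])
    also have "\<dots> \<le> ereal c" using z(2) by simp
    finally show False using c(2) by simp
  qed
  moreover have "(SUP n. ?p (n + d0)) \<le> ?L" by (intro SUP_least le) simp
  ultimately have "(SUP n. ?p (n + d0)) = ?L" by (rule antisym[rotated])
  with LIMSEQ_SUP[OF inc] have "(\<lambda>n. ?p (n + d0)) \<longlonglongrightarrow> ?L" by simp
  then show ?thesis by (rule LIMSEQ_offset)
qed

theorem theorem5:
  fixes T :: real and x0 xT :: "real^'n" and X :: "(real^'n) set"
    and m nK :: nat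
    and g l :: "nat \<Rightarrow> ('n::finite) rpoly" and f :: "nat \<Rightarrow> 'n rpoly ^ 'n"
  assumes T_pos: "T > 0"
    and X_compact: "compact X"
    and K_semialg: "{0..T} \<times> X = {p. \<forall>i\<in>{1..nK}. peval (g i) p \<ge> 0}"
    and g0: "g 0 = 1"
    and ball: "\<exists>i\<in>{1..nK}. \<exists>R. g i = ball_poly R"
    and test_finite: "\<forall>d\<ge>basis_order m nK g l f. finite (test_expos m f d)"
  shows "(\<forall>d\<ge>basis_order m nK g l f.
            relax_value m nK g l f T x0 xT d \<le> relax_value m nK g l f T x0 xT (Suc d)
            \<and> relax_value m nK g l f T x0 xT d \<le> moment_value m nK g l f T x0 xT)
         \<and> (\<lambda>d. relax_value m nK g l f T x0 xT d) \<longlonglongrightarrow> moment_value m nK g l f T x0 xT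
         \<and> moment_value m nK g l f T x0 xT = measure_value m ({0..T} \<times> X) l f T x0 xT"
proof -
  obtain i0 R where i0: "i0 \<in> {1..nK}" "g i0 = ball_poly R" using ball by blast
  have K_compact: "compact ({0..T} \<times> X)" by (intro compact_Times compact_Icc X_compact)
  have "moment_value m nK g l f T x0 xT = measure_value m ({0..T} \<times> X) l f T x0 xT"
    by (rule antisym[OF moment_value_le_measure_value[OF K_semialg g0 K_compact]
          measure_value_le_moment_value[OF K_semialg g0 K_compact i0]])
  then show ?thesis
    by (intro conjI allI impI relax_value_mono relax_value_le_moment_value
        relax_value_tendsto_moment_value[OF g0 i0])
qed

end
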